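(* Let $m,r$ be integers with $1\le m<r$, put $\alpha=m/r$, and let $1\le k\le n$ be integers. Let $$\mathbb{G}_{\alpha}^{(n,k)}(t)=\frac{\alpha^{k}t^{-k\alpha}}{\Gamma(n-k\alpha)f_{\alpha}(t)}\int_{0}^{1}f_{\alpha}(tu)(1-u)^{n-k\alpha-1}\,du ,\qquad t>0,$$ and define the parameter vectors $$\tau^{(k)}_{m,r}=\Big(\big(1-\tfrac1m-\tfrac{i+k}{r}\big)_{i=1}^{r-1},\ \big(\tfrac{i-1}{m}-\tfrac kr\big)_{i=1}^{m}\Big),\qquad \delta^{(k)}_{m,r}=\Big(\big(1-\tfrac1m-\tfrac jm-\tfrac kr\big)_{j=1}^{m-1},\ \big(\tfrac{j-1-n}{m}\big)_{j=1}^{m}\Big).$$ Then for all $t>0$ $$\mathbb{G}^{(n,k)}_{\frac mr}(t)=\frac{m^{k-n}\;G^{0,\,m+r-1}_{m+r-1,\,2m-1}\left(\frac{r^r}{m^m}t^m\,\middle|\,\begin{matrix}\tau^{(k)}_{m,r}\\ \delta^{(k)}_{m,r}\end{matrix}\right)}{G^{0,\,r-1}_{r-1,\,m-1}\left(\frac{r^r}{m^m}t^m\,\middle|\,\begin{matrix}(1-\frac1m-\frac ir)_{i=1}^{r-1}\\(1-\frac1m-\frac jm)_{j=1}^{m-1}\end{matrix}\right)},$$ or, equivalently, for all $s>0$ $$\mathbb{G}^{(n,k)}_{\frac mr}\!\left(\frac{m}{r^{r/m}}s^{1/m}\right)=\frac{m^{k-n}\;G^{0,\,m+r-1}_{m+r-1,\,2m-1}\left(s\,\middle|\,\begin{matrix}\tau^{(k)}_{m,r}\\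 \delta^{(k)}_{m,r}\end{matrix}\right)}{G^{0,\,r-1}_{r-1,\,m-1}\left(s\,\middle|\,\begin{matrix}(1-\frac1m-\frac ir)_{i=1}^{r-1}\\(1-\frac1m-\frac jm)_{j=1}^{m-1}\end{matrix}\right)} .$$
   Context: For $0<\alpha<1$, $f_\alpha$ is the density on $(0,\infty)$ of the positive $\alpha$-stable random variable $S_\alpha$ with $\mathbb{E}[e^{-\lambda S_\alpha}]=e^{-\lambda^\alpha}$, $\lambda>0$. Meijer $G$-function: for integers $0\le M\le Q$, $0\le N\le P$ and complex $a_i,b_j$, $$G^{M,N}_{P,Q}\left(z\,\middle|\,\begin{matrix}(a_i)_1^P\\(b_j)_1^Q\end{matrix}\right)=\frac1{2\pi i}\int_{\mathfrak L}\frac{\prod_{j=1}^{M}\Gamma(b_j+s)\prod_{i=1}^{N}\Gamma(1-a_i-s)}{\prod_{i=N+1}^{P}\Gamma(a_i+s)\prod_{j=M+1}^{Q}\Gamma(1-b_j-s)}z^{-s}ds,$$ empty products being $1$, where $\mathfrak L$ is an infinite contour leaving all poles of $\Gamma(b_j+s)$, $j\le M$, to its left and all poles of $\Gamma(1-a_i-s)$, $i\le N$, to its right; $\mathfrak L$ is a loop from $-\infty+i\varphi_1$ to $-\infty+i\varphi_2$, or a loop from $+\infty+i\varphi_1$ to $+\infty+i\varphi_2$ ($\varphi_1<\varphi_2$), or runs from $\gamma-i\infty$ to $\gamma+i\infty$ ($\gamma$ real), chosen so that the integral converges. A vector indexed from $1$ to $0$ is empty. *)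

theory Defs
  imports "HOL-Probability.Probability" "HOL-Complex_Analysis.Complex_Analysis"
begin

section \<open>Positive stable random variables\<close>

definition positive_stable :: "'a measure \<Rightarrow> real \<Rightarrow> ('a \<Rightarrow> real) \<Rightarrow> bool" where
  "positive_stable M \<alpha> S \<longleftrightarrow>
     prob_space M \<and> S \<in> borel_measurable M \<and> (AE \<omega> in M. 0 < S \<omega>) \<and>
     (\<forall>l>0. (\<integral>\<omega>. exp (- l * S \<omega>) \<partial>M) = exp (- (l powr \<alpha>)))"

text \<open>
  A density is determined only almost everywhere, while the identities below are pointwise.
  The density on \<open>(0,\<infinity>)\<close> is therefore taken to be the continuous, nonnegative version; only the
  values of \<open>f\<close> on \<open>(0,\<infinity>)\<close> are constrained.
\<close>

definition stable_density_of :: "'a measure \<Rightarrow> real \<Rightarrow> ('a \<Rightarrow> real) \<Rightarrow> (real \<Rightarrow> real) \<Rightarrow> bool" where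
  "stable_density_of M \<alpha> S f \<longleftrightarrow>
     positive_stable M \<alpha> S \<and>
     distributed M lborel S (\<lambda>x. ennreal (indicator {0<..} x * f x)) \<and>
     continuous_on {0<..} f \<and> (\<forall>x>0. 0 \<le> f x)"

definition GG :: "(real \<Rightarrow> real) \<Rightarrow> real \<Rightarrow> nat \<Rightarrow> nat \<Rightarrow> real \<Rightarrow> real" where
  "GG f \<alpha> n k t =
     \<alpha> ^ k * t powr (- (real k * \<alpha>)) / (Gamma (real n - real k * \<alpha>) * f t) *
     (LBINT u=0..1. f (t * u) * (1 - u) powr (real n - real k * \<alpha> - 1))"

section \<open>Infinite contours\<close>

text \<open>
  An infinite contour is a finite path \<open>p\<close> preceded by a ray coming in from infinity to the start
  of \<open>p\<close> and followed by a ray going out from the end of \<open>p\<close> to infinity.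
  \<open>Left_Loop\<close> runs from \<open>-\<infinity> + i\<phi>\<^sub>1\<close> to \<open>-\<infinity> + i\<phi>\<^sub>2\<close>, \<open>Right_Loop\<close> from \<open>+\<infinity> + i\<phi>\<^sub>1\<close> to \<open>+\<infinity> + i\<phi>\<^sub>2\<close>
  (with \<open>\<phi>\<^sub>1 < \<phi>\<^sub>2\<close> the imaginary parts of the end points of \<open>p\<close>), and \<open>Vertical\<close> from \<open>\<gamma> - i\<infinity>\<close>
  to \<open>\<gamma> + i\<infinity>\<close> (with \<open>\<gamma>\<close> the common real part of the end points of \<open>p\<close>).
\<close>

datatype contour_kind = Left_Loop | Right_Loop | Vertical

text \<open>Directions in which the two rays leave the end points of the finite path.\<close>

fun in_dir :: "contour_kind \<Rightarrow> complex" where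
  "in_dir Left_Loop = -1"
| "in_dir Right_Loop = 1"
| "in_dir Vertical = - \<i>"

fun out_dir :: "contour_kind \<Rightarrow> complex" where
  "out_dir Left_Loop = -1"
| "out_dir Right_Loop = 1"
| "out_dir Vertical = \<i>"

definition trunc_contour :: "contour_kind \<Rightarrow> (real \<Rightarrow> complex) \<Rightarrow> real \<Rightarrow> real \<Rightarrow> complex" where
  "trunc_contour K p R =
     linepath (pathstart p + of_real R * in_dir K) (pathstart p) +++ p +++
     linepath (pathfinish p) (pathfinish p + of_real R * out_dir K)"

definition infinite_contour :: "contour_kind \<Rightarrow> (real \<Rightarrow> complex) \<Rightarrow> bool" where
  "infinite_contour K p \<longleftrightarrow>
     valid_path p \<and> (\<forall>R>0. arc (trunc_contour K p R)) \<and>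
     (if K = Vertical then Re (pathstart p) = Re (pathfinish p)
      else Im (pathstart p) < Im (pathfinish p))"

text \<open>
  The total change of \<open>arg (s - w)\<close> along the contour, divided by \<open>2\<pi>\<close>: for an open path the
  real part of the library's \<open>winding_number\<close> is exactly this quantity.
\<close>

definition has_contour_index :: "contour_kind \<Rightarrow> (real \<Rightarrow> complex) \<Rightarrow> complex \<Rightarrow> real \<Rightarrow> bool" where
  "has_contour_index K p w c \<longleftrightarrow>
     (\<forall>R>0. w \<notin> path_image (trunc_contour K p R)) \<and>
     ((\<lambda>R. Re (winding_number (trunc_contour K p R) w)) \<longlongrightarrow> c) at_top"

text \<open>
  A point on the left of an infinite contour has index one larger than a point on its right.
  A left loop runs counterclockwise around the points on its left, a right loop runs clockwise
  around the points on its right, and seen from a point off an upward vertical contour the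
  argument changes by \<open>\<pi>\<close> (point on the left) or \<open>-\<pi>\<close> (point on the right).
\<close>

fun left_index :: "contour_kind \<Rightarrow> real" where
  "left_index Left_Loop = 1"
| "left_index Right_Loop = 0"
| "left_index Vertical = 1/2"

definition left_of_contour :: "contour_kind \<Rightarrow> (real \<Rightarrow> complex) \<Rightarrow> complex \<Rightarrow> bool" where
  "left_of_contour K p w \<longleftrightarrow> has_contour_index K p w (left_index K)"

definition right_of_contour :: "contour_kind \<Rightarrow> (real \<Rightarrow> complex) \<Rightarrow> complex \<Rightarrow> bool" where
  "right_of_contour K p w \<longleftrightarrow> has_contour_index K p w (left_index K - 1)"

text \<open>
  On the half-line \<open>{0..}\<close> the gauge integral \<open>has_integral\<close> is the improper integral, so
  conditionally convergent contour integrals are included.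
\<close>

definition has_infinite_contour_integral ::
    "(complex \<Rightarrow> complex) \<Rightarrow> complex \<Rightarrow> contour_kind \<Rightarrow> (real \<Rightarrow> complex) \<Rightarrow> bool" where
  "has_infinite_contour_integral F I K p \<longleftrightarrow>
     (\<exists>I1 I2 I3.
        ((\<lambda>x. F (pathstart p + of_real x * in_dir K) * in_dir K) has_integral I1) {0..} \<and>
        (F has_contour_integral I2) p \<and>
        ((\<lambda>x. F (pathfinish p + of_real x * out_dir K) * out_dir K) has_integral I3) {0..} \<and>
        I = - I1 + I2 + I3)"

section \<open>Meijer's G-function\<close>

text \<open>
  The lower indices \<open>P\<close> and \<open>Q\<close> of \<open>G\<close> are the lengths of the parameter lists \<open>av\<close> and \<open>bv\<close>;
  \<open>rGamma\<close> is the entire function \<open>1/\<Gamma>\<close>, and \<open>z powr (-s)\<close> uses the principal branch.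
\<close>

definition meijer_integrand ::
    "nat \<Rightarrow> nat \<Rightarrow> complex list \<Rightarrow> complex list \<Rightarrow> complex \<Rightarrow> complex \<Rightarrow> complex" where
  "meijer_integrand M N av bv z s =
     (\<Prod>b\<leftarrow>take M bv. Gamma (b + s)) * (\<Prod>a\<leftarrow>take N av. Gamma (1 - a - s)) *
     (\<Prod>a\<leftarrow>drop N av. rGamma (a + s)) * (\<Prod>b\<leftarrow>drop M bv. rGamma (1 - b - s)) *
     z powr (- s)"

definition has_meijer_G ::
    "nat \<Rightarrow> nat \<Rightarrow> complex list \<Rightarrow> complex list \<Rightarrow> complex \<Rightarrow> complex \<Rightarrow> bool" where
  "has_meijer_G M N av bv z v \<longleftrightarrow>
     M \<le> length bv \<and> N \<le> length av \<and>
     (\<exists>K p I. infinite_contour K p \<and>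
        (\<forall>b\<in>set (take M bv). \<forall>s. b + s \<in> \<int>\<^sub>\<le>\<^sub>0 \<longrightarrow> left_of_contour K p s) \<and>
        (\<forall>a\<in>set (take N av). \<forall>s. 1 - a - s \<in> \<int>\<^sub>\<le>\<^sub>0 \<longrightarrow> right_of_contour K p s) \<and>
        has_infinite_contour_integral (meijer_integrand M N av bv z) I K p \<and>
        v = 1 / (2 * of_real pi * \<i>) * I)"

text \<open>The value common to all admissible contours along which the integral converges.\<close>

definition meijer_G ::
    "nat \<Rightarrow> nat \<Rightarrow> complex list \<Rightarrow> complex list \<Rightarrow> complex \<Rightarrow> complex" where
  "meijer_G M N av bv z = (THE v. has_meijer_G M N av bv z v)"

section \<open>Parameter vectors\<close>

definition tau_params :: "nat \<Rightarrow> nat \<Rightarrow> nat \<Rightarrow> complex list" where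
  "tau_params m r k =
     map (\<lambda>i. of_real (1 - 1 / real m - (real i + real k) / real r)) [1..<r] @
     map (\<lambda>i. of_real ((real i - 1) / real m - real k / real r)) [1..<Suc m]"

definition delta_params :: "nat \<Rightarrow> nat \<Rightarrow> nat \<Rightarrow> nat \<Rightarrow> complex list" where
  "delta_params m r n k =
     map (\<lambda>j. of_real (1 - 1 / real m - real j / real m - real k / real r)) [1..<m] @
     map (\<lambda>j. of_real ((real j - 1 - real n) / real m)) [1..<Suc m]"

definition stable_upper :: "nat \<Rightarrow> nat \<Rightarrow> complex list" where
  "stable_upper m r = map (\<lambda>i. of_real (1 - 1 / real m - real i / real r)) [1..<r]"

definition stable_lower :: "nat \<Rightarrow> complex list" where
  "stable_lower m = map (\<lambda>j. of_real (1 - 1 / real m - real j / real m)) [1..<m]"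

lemma length_params:
  assumes "1 \<le> m" "m < r"
  shows "length (tau_params m r k) = m + r - 1" "length (delta_params m r n k) = 2 * m - 1"
    "length (stable_upper m r) = r - 1" "length (stable_lower m) = m - 1"
  using assms by (auto simp: tau_params_def delta_params_def stable_upper_def stable_lower_def)

end

theory Submission imports Defs begin

text \<open>
  Both \<open>G\<close>-functions have \<open>M = 0\<close>, all upper parameters in the numerator, and fewer lower than upper
  parameters, so their integrands are quotients of products \<open>\<Gamma>(1 - a - s)\<close> over fewer products
  \<open>\<Gamma>(1 - b - s)\<close>, times \<open>z\<^sup>-\<^sup>s\<close>.  Since every \<open>a < 1\<close>, all poles lie on the positive real axis.

  The value of such a \<open>G\<close>-function is \<open>1 / (2\<pi>)\<close> times the integral of the integrand over the imaginary
  axis, whatever contour is used (\<open>meijer_G_eq_axis_integral\<close>).  The plane slit along the poles is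
  starlike, so the integrand has a primitive \<open>\<Phi>\<close> there.  The index condition on a truncated contour implies
  that closing it up through the origin gives a closed path with winding number 0 around each
  pole, so the truncated integral is a difference of values of \<open>\<Phi>\<close> at the two ends
  (\<open>contour_integral_trunc_contour_primitive\<close>).  The surplus Gamma factors make the integrand decay in
  vertical strips and under \<open>s \<mapsto> s + 1\<close>; hence \<open>\<Phi>\<close> has the same two limits at the ends of a vertical
  contour and of a right loop.  Under \<open>s \<mapsto> s - 1\<close> the integrand grows so fast, and its phase turns so
  slowly, that no ray to the left has a convergent integral (\<open>left_ray_diverges\<close>).

  On the imaginary axis most Gamma factors of the parameter vectors cancel, and Gauss multiplication turns
  the rest into \<open>\<Gamma>(r/m + k - r s) / \<Gamma>(n + 1 - m s)\<close> times a constant and a power of \<open>t\<close>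
  (\<open>gamma_quotient_reduced\<close>); the second \<open>G\<close>-function is the case \<open>k = n = 0\<close>.

  On the probabilistic side put \<open>b = n - k \<alpha>\<close>.  The Riemann-Liouville integral \<open>q\<close> of order \<open>b\<close> of the
  stable density \<open>f\<close> (and \<open>f\<close> itself for \<open>b = 0\<close>) has Laplace transform \<open>l\<^sup>-\<^sup>b exp(-l\<^sup>\<alpha>)\<close>.  Integrating this against
  \<open>l\<^sup>w\<^sup>-\<^sup>1\<close> gives \<open>\<Gamma>(w)\<close> times the integral of \<open>t\<^sup>-\<^sup>w q(t)\<close> on one side and \<open>\<Gamma>((w - b) / \<alpha>) / \<alpha>\<close> on the other
  (\<open>mellin_of_log_laplace\<close>).  Mellin inversion, that is, Fourier inversion in \<open>ln t\<close>, then recovers \<open>q\<close>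
  pointwise, because \<open>q\<close> is continuous and its Mellin transform is integrable on vertical lines.  With
  \<open>w = n + 1 - m s\<close> the inversion integral is exactly the reduced integral over the imaginary axis.  So both
  \<open>G\<close>-functions are the same constant times \<open>t\<^sup>-\<^sup>n q(t)\<close> and \<open>f(t)\<close>, up to a ratio \<open>m\<^sup>n / r\<^sup>k\<close>, and
  \<open>m\<^sup>k\<^sup>-\<^sup>n m\<^sup>n / r\<^sup>k = \<alpha>\<^sup>k\<close> (\<open>GG_eq_meijer_quotient\<close>).
\<close>

section \<open>Growth of the Gamma function in vertical strips\<close>

lemma div_cmod_mono:
  fixes u v y :: real
  assumes "0 < u" "u \<le> v"
  shows "u / cmod (Complex u y) \<le> v / cmod (Complex v y)"
proof -
  have "(u * sqrt (v\<^sup>2 + y\<^sup>2))\<^sup>2 \<le> (v * sqrt (u\<^sup>2 + y\<^sup>2))\<^sup>2"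
  proof -
    have "u\<^sup>2 * y\<^sup>2 \<le> v\<^sup>2 * y\<^sup>2"
      using assms by (intro mult_right_mono power_mono) auto
    thus ?thesis by (simp add: power_mult_distrib algebra_simps)
  qed
  hence "u * sqrt (v\<^sup>2 + y\<^sup>2) \<le> v * sqrt (u\<^sup>2 + y\<^sup>2)"
    by (rule power2_le_imp_le) (use assms in auto)
  moreover have "sqrt (u\<^sup>2 + y\<^sup>2) > 0" "sqrt (v\<^sup>2 + y\<^sup>2) > 0"
    using assms by (simp_all add: add_pos_nonneg)
  ultimately show ?thesis by (simp add: cmod_def field_simps)
qed

lemma cmod_Gamma_series:
  fixes a y :: real
  assumes "0 < a"
  shows "cmod (Gamma_series (Complex a y) n) / Gamma_series a n =
           (\<Prod>k\<le>n. (a + real k) / cmod (Complex (a + real k) y))"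
proof -
  have "pochhammer (Complex a y) (Suc n) = (\<Prod>k\<le>n. Complex (a + real k) y)"
    unfolding pochhammer_prod atLeast0LessThan lessThan_Suc_atMost
    by (intro prod.cong refl) (simp add: complex_eq_iff)
  hence p: "cmod (pochhammer (Complex a y) (Suc n)) = (\<Prod>k\<le>n. cmod (Complex (a + real k) y))"
    by (simp add: prod_norm)
  have q: "pochhammer a (Suc n) = (\<Prod>k\<le>n. a + real k)"
    by (simp add: pochhammer_prod atLeast0LessThan lessThan_Suc_atMost)
  have "(\<Prod>k\<le>n. a + real k) > 0" using assms by (intro prod_pos) auto
  moreover have "(\<Prod>k\<le>n. cmod (Complex (a + real k) y)) > 0"
    using assms by (intro prod_pos) (auto simp: complex_eq_iff)
  moreover have "cmod (exp (Complex a y * of_real (ln (real n)))) = exp (a * ln (real n))"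
    by simp
  ultimately show ?thesis
    unfolding Gamma_series_def
    by (simp add: norm_divide norm_mult p q prod_dividef field_simps)
qed

text \<open>
  Euler's limit writes the left-hand side as the product of \<open>(a + k) / \<bar>a + k + i y\<bar>\<close>, and each factor
  increases with \<open>a\<close>.  This monotonicity replaces Stirling's formula: it compares Gamma values with equal
  imaginary parts, which is all that a quotient with equal numbers of factors requires.
\<close>
lemma cmod_Gamma_div_mono:
  fixes a b y :: real
  assumes "0 < a" "a \<le> b"
  shows "cmod (Gamma (Complex a y)) / Gamma a \<le> cmod (Gamma (Complex b y)) / Gamma b"
proof (rule LIMSEQ_le)
  have "(\<lambda>n. cmod (Gamma_series (Complex c y) n) / Gamma_series c n)
          \<longlonglongrightarrow> cmod (Gamma (Complex c y)) / Gamma c" if "c > 0" for c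
    using Gamma_real_pos[OF that]
    by (intro tendsto_intros Gamma_series_LIMSEQ) auto
  from this[of a] this[of b] assms
  show "(\<lambda>n. cmod (Gamma_series (Complex a y) n) / Gamma_series a n)
          \<longlonglongrightarrow> cmod (Gamma (Complex a y)) / Gamma a"
       "(\<lambda>n. cmod (Gamma_series (Complex b y) n) / Gamma_series b n)
          \<longlonglongrightarrow> cmod (Gamma (Complex b y)) / Gamma b" by auto
  show "\<exists>N. \<forall>n\<ge>N. cmod (Gamma_series (Complex a y) n) / Gamma_series a n
                   \<le> cmod (Gamma_series (Complex b y) n) / Gamma_series b n"
    using assms
    by (auto simp: cmod_Gamma_series intro!: prod_mono div_cmod_mono exI[of _ 0])
qed

lemma cmod_Gamma_le:
  fixes a y :: real
  assumes "0 < a"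
  shows "cmod (Gamma (Complex a y)) \<le> Gamma a"
proof -
  have "cmod (Gamma (Complex a y)) / Gamma a \<le> 1"
  proof (rule LIMSEQ_le_const2)
    show "(\<lambda>n. cmod (Gamma_series (Complex a y) n) / Gamma_series a n)
          \<longlonglongrightarrow> cmod (Gamma (Complex a y)) / Gamma a"
      using Gamma_real_pos[OF assms]
      by (intro tendsto_intros Gamma_series_LIMSEQ) auto
    have "u / cmod (Complex u y) \<le> 1" if "u > 0" for u
    proof -
      have "u \<le> cmod (Complex u y)" using complex_Re_le_cmod[of "Complex u y"] by simp
      with that show ?thesis by (subst divide_le_eq_1_pos) auto
    qed
    thus "\<exists>N. \<forall>n\<ge>N. cmod (Gamma_series (Complex a y) n) / Gamma_series a n \<le> 1"
      using assms by (auto simp: cmod_Gamma_series intro!: prod_le_1 exI[of _ 0])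
  qed
  with Gamma_real_pos[OF assms] show ?thesis by (simp add: field_simps)
qed

lemma pochhammer_one_plus_iy:
  "pochhammer (Complex 1 y) n * Gamma (Complex 1 y) = Gamma (Complex (1 + real n) y)"
proof -
  have "Complex 1 y \<notin> \<int>\<^sub>\<le>\<^sub>0"
    by (auto elim!: nonpos_Ints_cases simp: complex_eq_iff)
  moreover have "Complex 1 y + of_nat n = Complex (1 + real n) y"
    by (simp add: complex_eq_iff)
  ultimately show ?thesis using pochhammer_Gamma[of "Complex 1 y" n]
    by (simp add: Gamma_eq_zero_iff)
qed

text \<open>
  Decay of arbitrary polynomial order: \<open>J\<close> steps of the functional equation divide the bounded number
  \<open>\<Gamma>(1 + J + i y)\<close> by \<open>J\<close> factors of modulus at least \<open>(1 + \<bar>y\<bar>) / 2\<close>.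
\<close>
lemma cmod_Gamma_one_decay:
  "cmod (Gamma (Complex 1 y)) \<le> fact J * 2 ^ J / (1 + \<bar>y\<bar>) ^ J"
proof -
  have "((1 + \<bar>y\<bar>) / 2) ^ J \<le> cmod (pochhammer (Complex 1 y) J)"
  proof -
    have "(1 + \<bar>y\<bar>) / 2 \<le> cmod (Complex 1 y + of_nat k)" for k
    proof -
      have "\<bar>y\<bar> \<le> cmod (Complex 1 y + of_nat k)" "1 \<le> cmod (Complex 1 y + of_nat k)"
        using abs_Im_le_cmod[of "Complex 1 y + of_nat k"]
              complex_Re_le_cmod[of "Complex 1 y + of_nat k"] by auto
      thus ?thesis by simp
    qed
    hence "(\<Prod>k\<in>{0..<J}. (1 + \<bar>y\<bar>) / 2) \<le> (\<Prod>k\<in>{0..<J}. cmod (Complex 1 y + of_nat k))"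
      by (intro prod_mono) auto
    thus ?thesis by (simp add: pochhammer_prod prod_norm)
  qed
  hence "((1 + \<bar>y\<bar>) / 2) ^ J * cmod (Gamma (Complex 1 y))
           \<le> cmod (pochhammer (Complex 1 y) J * Gamma (Complex 1 y))"
    by (simp add: norm_mult mult_right_mono)
  also have "\<dots> \<le> Gamma (1 + real J)"
    unfolding pochhammer_one_plus_iy by (rule cmod_Gamma_le) auto
  also have "\<dots> = fact J" by (simp add: Gamma_fact)
  finally show ?thesis
    by (simp add: power_divide field_simps)
qed

text \<open>
  On a strip both \<open>\<Gamma>\<close> and \<open>1 / \<Gamma>\<close> are compared with the single function \<open>\<bar>\<Gamma>(1 + i y)\<bar>\<close>, so that in a
  quotient all but the surplus factors cancel up to a power of \<open>\<bar>y\<bar>\<close>.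
\<close>
lemma cmod_Gamma_upper:
  obtains C where "C > 0"
    "\<And>u y. u \<in> {1..1 + real M} \<Longrightarrow> cmod (Gamma (Complex u y)) \<le> C * (1 + \<bar>y\<bar>) ^ M * cmod (Gamma (Complex 1 y))"
    "\<And>u y. u \<in> {1..1 + real M} \<Longrightarrow> cmod (rGamma (Complex u y)) \<le> C / cmod (Gamma (Complex 1 y))"
proof -
  have c1: "continuous_on {1..1 + real M} (Gamma :: real \<Rightarrow> real)"
    by (intro continuous_intros) (auto elim!: nonpos_Ints_cases)
  have c2: "continuous_on {1..1 + real M} (rGamma :: real \<Rightarrow> real)"
    by (intro continuous_intros)
  from compact_imp_bounded[OF compact_continuous_image[OF c1]] obtain C1 where C1: "C1 > 0"
    "\<And>u. u \<in> {1..1 + real M} \<Longrightarrow> \<bar>Gamma u\<bar> \<le> C1"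
    by (auto simp: bounded_pos)
  from compact_imp_bounded[OF compact_continuous_image[OF c2]] obtain C2 where C2: "C2 > 0"
    "\<And>u. u \<in> {1..1 + real M} \<Longrightarrow> \<bar>rGamma u\<bar> \<le> C2"
    by (auto simp: bounded_pos)
  define C where "C = C1 * (1 + real M) ^ M / fact M + C2"
  have "C > 0" using C1 C2 unfolding C_def by (intro add_nonneg_pos) auto
  have nz: "cmod (Gamma (Complex 1 y)) > 0" for y
  proof -
    have "Complex 1 y \<notin> \<int>\<^sub>\<le>\<^sub>0" by (auto elim!: nonpos_Ints_cases simp: complex_eq_iff)
    thus ?thesis by (simp add: Gamma_eq_zero_iff)
  qed
  show ?thesis
  proof (rule that[OF \<open>C > 0\<close>])
    fix u y assume u: "u \<in> {1..1 + real M}"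
    have Gu: "Gamma u > 0" using u by (intro Gamma_real_pos) auto
    have "cmod (Gamma (Complex u y)) / Gamma u \<le> cmod (Gamma (Complex (1 + real M) y)) / Gamma (1 + real M)"
      using u by (intro cmod_Gamma_div_mono) auto
    hence "cmod (Gamma (Complex u y)) \<le> Gamma u * (cmod (Gamma (Complex (1 + real M) y)) / fact M)"
      using Gu by (simp add: Gamma_fact field_simps)
    also have "\<dots> \<le> C1 * (cmod (Gamma (Complex (1 + real M) y)) / fact M)"
      using C1(2)[OF u] Gu by (intro mult_right_mono) auto
    also have "cmod (Gamma (Complex (1 + real M) y)) = cmod (pochhammer (Complex 1 y) M) * cmod (Gamma (Complex 1 y))"
      by (simp add: norm_mult flip: pochhammer_one_plus_iy)
    also have "cmod (pochhammer (Complex 1 y) M) \<le> ((1 + real M) * (1 + \<bar>y\<bar>)) ^ M"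
    proof -
      have "cmod (Complex 1 y + of_nat k) \<le> (1 + real M) * (1 + \<bar>y\<bar>)" if "k < M" for k
      proof -
        have "cmod (Complex 1 y + of_nat k) \<le> \<bar>1 + real k\<bar> + \<bar>y\<bar>"
          using cmod_le[of "Complex 1 y + of_nat k"] by simp
        also have "\<dots> \<le> (1 + real M) + (1 + real M) * \<bar>y\<bar>"
          using that by (intro add_mono) (auto simp: algebra_simps)
        finally show ?thesis by (simp add: algebra_simps)
      qed
      hence "(\<Prod>k\<in>{0..<M}. cmod (Complex 1 y + of_nat k)) \<le> (\<Prod>k\<in>{0..<M}. (1 + real M) * (1 + \<bar>y\<bar>))"
        by (intro prod_mono) auto
      thus ?thesis by (simp add: pochhammer_prod prod_norm)
    qed
    finally have "cmod (Gamma (Complex u y)) \<le>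
       C1 * (((1 + real M) * (1 + \<bar>y\<bar>)) ^ M * cmod (Gamma (Complex 1 y)) / fact M)"
      using C1(1) by (simp add: mult_right_mono divide_right_mono)
    also have "\<dots> = (C1 * (1 + real M) ^ M / fact M) * ((1 + \<bar>y\<bar>) ^ M * cmod (Gamma (Complex 1 y)))"
      by (simp add: power_mult_distrib)
    also have "\<dots> \<le> C * ((1 + \<bar>y\<bar>) ^ M * cmod (Gamma (Complex 1 y)))"
      using C2(1) unfolding C_def by (intro mult_right_mono) auto
    finally show "cmod (Gamma (Complex u y)) \<le> C * (1 + \<bar>y\<bar>) ^ M * cmod (Gamma (Complex 1 y))"
      by (simp add: mult.assoc)
    have "cmod (Gamma (Complex 1 y)) / Gamma 1 \<le> cmod (Gamma (Complex u y)) / Gamma u"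
      using u by (intro cmod_Gamma_div_mono) auto
    hence "cmod (Gamma (Complex 1 y)) \<le> cmod (Gamma (Complex u y)) * rGamma u"
      by (simp add: rGamma_inverse_Gamma field_simps)
    also have "\<dots> \<le> cmod (Gamma (Complex u y)) * C"
    proof (intro mult_left_mono)
      have "rGamma u \<le> C2" using C2(2)[OF u] by simp
      also have "\<dots> \<le> C" using C1(1) by (simp add: C_def)
      finally show "rGamma u \<le> C" .
    qed auto
    finally have *: "cmod (Gamma (Complex 1 y)) \<le> cmod (Gamma (Complex u y)) * C" .
    with nz[of y] have "cmod (Gamma (Complex u y)) * C > 0" by linarith
    hence "cmod (Gamma (Complex u y)) > 0" using \<open>C > 0\<close> by (simp add: zero_less_mult_iff)
    hence "inverse (cmod (Gamma (Complex u y))) \<le> C / cmod (Gamma (Complex 1 y))"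
      using * nz[of y] by (simp add: field_simps)
    thus "cmod (rGamma (Complex u y)) \<le> C / cmod (Gamma (Complex 1 y))"
      by (simp only: rGamma_inverse_Gamma norm_inverse)
  qed
qed

text \<open>The integrand of a \<open>G\<close>-function with \<open>M = 0\<close>, \<open>N = P\<close>, real parameters and positive argument.\<close>
definition gamma_quotient :: "real list \<Rightarrow> real list \<Rightarrow> real \<Rightarrow> complex \<Rightarrow> complex" where
  "gamma_quotient A B z s =
     (\<Prod>a\<leftarrow>A. Gamma (1 - of_real a - s)) * (\<Prod>b\<leftarrow>B. rGamma (1 - of_real b - s)) *
     of_real z powr (- s)"

lemma cmod_prod_list_le:
  fixes f :: "real \<Rightarrow> complex"
  assumes "\<And>a. a \<in> set A \<Longrightarrow> cmod (f a) \<le> K" "K \<ge> 0"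
  shows "cmod (\<Prod>a\<leftarrow>A. f a) \<le> K ^ length A"
  using assms by (induction A) (auto simp: norm_mult intro!: mult_mono)

text \<open>
  Where all Gamma arguments have real part at least 1, the quotient is at most a power of \<open>1 + \<bar>y\<bar>\<close> times
  \<open>\<bar>\<Gamma>(1 + i y)\<bar>\<close> to the number of surplus factors.  As this number is positive, the superpolynomial decay
  of \<open>\<Gamma>(1 + i y)\<close> wins.
\<close>
lemma gamma_quotient_far_left_bound:
  assumes len: "length B < length A" and z: "z > 0"
    and far: "\<And>a. a \<in> set A \<union> set B \<Longrightarrow> a + x2 \<le> 0"
  obtains C where "C > 0"
    "\<And>x y. x \<in> {x1..x2} \<Longrightarrow> cmod (gamma_quotient A B z (Complex x y)) \<le> C / (1 + \<bar>y\<bar>) ^ 2"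
proof -
  obtain M :: nat where M: "\<And>a. a \<in> set A \<union> set B \<Longrightarrow> - a - x1 \<le> real M"
  proof -
    have "bdd_above ((\<lambda>a. - a - x1) ` (set A \<union> set B))"
      by (intro bdd_above_finite) auto
    then obtain m where m: "\<And>a. a \<in> set A \<union> set B \<Longrightarrow> - a - x1 \<le> m"
      by (auto simp: bdd_above_def)
    have "m \<le> real (nat \<lceil>m\<rceil>)" by (rule real_nat_ceiling_ge)
    with m show ?thesis by (intro that[of "nat \<lceil>m\<rceil>"]) force
  qed
  obtain C where C: "C > 0"
    "\<And>u y. u \<in> {1..1 + real M} \<Longrightarrow> cmod (Gamma (Complex u y)) \<le> C * (1 + \<bar>y\<bar>) ^ M * cmod (Gamma (Complex 1 y))"
    "\<And>u y. u \<in> {1..1 + real M} \<Longrightarrow> cmod (rGamma (Complex u y)) \<le> C / cmod (Gamma (Complex 1 y))"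
    using cmod_Gamma_upper[of M] by metis
  define P where "P = length A"
  define Q where "Q = length B"
  \<comment> \<open>The decay order \<open>J\<close> absorbs the growth \<open>(1 + \<bar>y\<bar>)\<^sup>M\<^sup>P\<close> of the numerator and leaves the square.\<close>
  define J where "J = M * P + 2"
  \<comment> \<open>The last factor bounds \<open>\<bar>z\<^sup>-\<^sup>s\<bar> = z\<^sup>-\<^sup>x\<close> on the strip.\<close>
  define D where "D = C ^ P * C ^ Q * (fact J * 2 ^ J) * exp ((\<bar>x1\<bar> + \<bar>x2\<bar>) * \<bar>ln z\<bar>)"
  show ?thesis
  proof (rule that[of D])
    show "D > 0" using C(1) by (simp add: D_def)
    fix x y :: real assume x: "x \<in> {x1..x2}"
    define G where "G = cmod (Gamma (Complex 1 (-y)))"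
    have "Complex 1 (-y) \<notin> \<int>\<^sub>\<le>\<^sub>0" by (auto elim!: nonpos_Ints_cases simp: complex_eq_iff)
    hence G0: "G > 0" by (simp add: G_def Gamma_eq_zero_iff)
    have G1: "G \<le> 1" using cmod_Gamma_le[of 1 "-y"] by (simp add: G_def)
    have rng: "1 - a - x \<in> {1..1 + real M}" if "a \<in> set A \<union> set B" for a
      using far[OF that] M[OF that] x by auto
    have eq: "1 - of_real a - Complex x y = Complex (1 - a - x) (-y)" for a
      by (simp add: complex_eq_iff)
    have A: "cmod (\<Prod>a\<leftarrow>A. Gamma (1 - of_real a - Complex x y)) \<le> (C * (1 + \<bar>y\<bar>) ^ M * G) ^ P"
      unfolding P_def
    proof (rule cmod_prod_list_le)
      fix a assume "a \<in> set A"
      with C(2)[OF rng, of a "-y"]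
      show "cmod (Gamma (1 - of_real a - Complex x y)) \<le> C * (1 + \<bar>y\<bar>) ^ M * G"
        unfolding eq G_def by auto
    qed (use C G0 in auto)
    have B: "cmod (\<Prod>a\<leftarrow>B. rGamma (1 - of_real a - Complex x y)) \<le> (C / G) ^ Q"
      unfolding Q_def
    proof (rule cmod_prod_list_le)
      fix a assume "a \<in> set B"
      with C(3)[OF rng, of a "-y"]
      show "cmod (rGamma (1 - of_real a - Complex x y)) \<le> C / G"
        unfolding eq G_def by auto
    qed (use C G0 in auto)
    have E: "cmod (of_real z powr (- Complex x y)) \<le> exp ((\<bar>x1\<bar> + \<bar>x2\<bar>) * \<bar>ln z\<bar>)"
    proof -
      have "cmod (of_real z powr (- Complex x y)) = exp (- x * ln z)"
        using z by (simp add: norm_powr_real_powr powr_def)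
      also have "- x * ln z \<le> \<bar>x\<bar> * \<bar>ln z\<bar>"
        by (metis abs_ge_self abs_mult abs_minus_cancel)
      also have "\<dots> \<le> (\<bar>x1\<bar> + \<bar>x2\<bar>) * \<bar>ln z\<bar>"
        using x by (intro mult_right_mono) auto
      finally show ?thesis by simp
    qed
    have PQ: "G ^ P / G ^ Q \<le> G"
    proof -
      have "G ^ P / G ^ Q = G ^ (P - Q)"
        using G0 len by (simp add: P_def Q_def power_diff)
      also have "\<dots> \<le> G ^ 1"
        using G0 G1 len by (intro power_decreasing) (auto simp: P_def Q_def)
      finally show ?thesis by simp
    qed
    have "cmod (gamma_quotient A B z (Complex x y)) \<le>
            (C * (1 + \<bar>y\<bar>) ^ M * G) ^ P * (C / G) ^ Q * exp ((\<bar>x1\<bar> + \<bar>x2\<bar>) * \<bar>ln z\<bar>)"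
      unfolding gamma_quotient_def norm_mult
      by (intro mult_mono A B E) (use C G0 in auto)
    also have "\<dots> = C ^ P * C ^ Q * exp ((\<bar>x1\<bar> + \<bar>x2\<bar>) * \<bar>ln z\<bar>) * (1 + \<bar>y\<bar>) ^ (M * P) * (G ^ P / G ^ Q)"
      by (simp add: power_mult_distrib power_divide power_mult)
    also have "\<dots> \<le> C ^ P * C ^ Q * exp ((\<bar>x1\<bar> + \<bar>x2\<bar>) * \<bar>ln z\<bar>) * (1 + \<bar>y\<bar>) ^ (M * P) * (fact J * 2 ^ J / (1 + \<bar>y\<bar>) ^ J)"
      using PQ cmod_Gamma_one_decay[of "-y" J] C(1)
      by (intro mult_left_mono) (auto simp: G_def intro: order_trans)
    also have "\<dots> = D / (1 + \<bar>y\<bar>) ^ 2"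
    proof -
      have "(1 + \<bar>y\<bar>) ^ J = (1 + \<bar>y\<bar>) ^ (M * P) * (1 + \<bar>y\<bar>) ^ 2" "1 + \<bar>y\<bar> \<noteq> 0"
        unfolding J_def power_add by auto
      thus ?thesis by (simp add: D_def)
    qed
    finally show "cmod (gamma_quotient A B z (Complex x y)) \<le> D / (1 + \<bar>y\<bar>) ^ 2" .
  qed
qed

section \<open>Shifting the integrand by one\<close>

text \<open>The factor by which the integrand changes under \<open>s \<mapsto> s + 1\<close>; it is a rational function.\<close>
definition shift_ratio :: "real list \<Rightarrow> real list \<Rightarrow> real \<Rightarrow> complex \<Rightarrow> complex" where
  "shift_ratio A B z s =
     (\<Prod>b\<leftarrow>B. - (of_real b + s)) / (\<Prod>a\<leftarrow>A. - (of_real a + s)) / of_real z"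

text \<open>
  As \<open>\<Gamma>\<close> takes the value 0 at its poles, this form of the functional equation covers the negative integers as well.
\<close>
lemma Gamma_minus_1:
  fixes s :: complex
  assumes "s \<noteq> 0"
  shows "Gamma s = Gamma (s + 1) / s"
proof -
  have "rGamma s = s * rGamma (s + 1)" by (simp add: rGamma_plus1)
  thus ?thesis using assms by (simp add: Gamma_def field_simps)
qed

lemma gamma_quotient_plus_1:
  assumes z: "z > 0" and nz: "\<And>a. a \<in> set A \<Longrightarrow> of_real a + s \<noteq> 0"
  shows "gamma_quotient A B z (s + 1) = gamma_quotient A B z s * shift_ratio A B z s"
proof -
  have "(\<Prod>a\<leftarrow>A. Gamma (1 - of_real a - (s + 1))) =
          (\<Prod>a\<leftarrow>A. Gamma (1 - of_real a - s)) / (\<Prod>a\<leftarrow>A. - (of_real a + s))"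
    using nz
  proof (induction A)
    case (Cons a A)
    have "- (of_real a + s) \<noteq> 0" using Cons.prems[of a] by (simp add: add_eq_0_iff)
    from Gamma_minus_1[OF this]
    have "Gamma (1 - of_real a - (s + 1)) = Gamma (1 - of_real a - s) / (- (of_real a + s))"
      by (simp add: algebra_simps)
    moreover have "(\<Prod>a\<leftarrow>A. Gamma (1 - of_real a - (s + 1))) =
          (\<Prod>a\<leftarrow>A. Gamma (1 - of_real a - s)) / (\<Prod>a\<leftarrow>A. - (of_real a + s))"
      using Cons by simp
    ultimately show ?case unfolding list.map prod_list.Cons by (simp only: times_divide_times_eq)
  qed auto
  moreover have "(\<Prod>b\<leftarrow>B. rGamma (1 - of_real b - (s + 1))) =
          (\<Prod>b\<leftarrow>B. rGamma (1 - of_real b - s)) * (\<Prod>b\<leftarrow>B. - (of_real b + s))"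
  proof (induction B)
    case (Cons b B)
    have "rGamma (1 - of_real b - (s + 1)) = - (of_real b + s) * rGamma (1 - of_real b - s)"
      using rGamma_plus1[of "- (of_real b + s)"] by (simp add: algebra_simps)
    thus ?case using Cons by simp
  qed auto
  moreover have "of_real z powr (- (s + 1)) = of_real z powr (- s) / (of_real z :: complex)"
  proof -
    have "of_real z powr (- (s + 1)) = of_real z powr (- s - (1::complex))" by simp
    also have "\<dots> = of_real z powr (- s) / (of_real z :: complex)"
      using z by (subst powr_diff) auto
    finally show ?thesis .
  qed
  ultimately show ?thesis by (simp add: gamma_quotient_def shift_ratio_def)
qed

lemma tendsto_quotient_linear_at_infinity:
  "((\<lambda>s. (c + s) / (d + s)) \<longlongrightarrow> 1) at_infinity" for c d :: complex
proof -
  have f: "filterlim (\<lambda>s. d + s) at_infinity at_infinity"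
    by (rule tendsto_add_filterlim_at_infinity[OF tendsto_const filterlim_ident])
  have "((\<lambda>s. 1 + (c - d) / (d + s)) \<longlongrightarrow> 1 + 0) at_infinity"
    by (intro tendsto_add tendsto_const tendsto_divide_0[OF tendsto_const f])
  moreover have "eventually (\<lambda>s. 1 + (c - d) / (d + s) = (c + s) / (d + s)) at_infinity"
    using eventually_not_equal_at_infinity[of "-d"]
  proof eventually_elim
    case (elim s)
    hence "d + s \<noteq> 0" by (metis add.commute eq_neg_iff_add_eq_0)
    thus ?case by (simp add: field_simps)
  qed
  ultimately show ?thesis by (simp add: tendsto_cong)
qed

lemma prod_quotient_converges_at_infinity:
  assumes "length B \<le> length A"
  shows "\<exists>l. ((\<lambda>s. (\<Prod>b\<leftarrow>B. - (of_real b + s)) / (\<Prod>a\<leftarrow>A. - (of_real a + s :: complex))) \<longlongrightarrow> l) at_infinity"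
  using assms
proof (induction A arbitrary: B)
  case (Cons a A)
  show ?case
  proof (cases B)
    case Nil
    from Cons.IH[of "[]"] obtain l where l:
      "((\<lambda>s. 1 / (\<Prod>a\<leftarrow>A. - (of_real a + s :: complex))) \<longlongrightarrow> l) at_infinity" by auto
    have f: "filterlim (\<lambda>s::complex. of_real a + s) at_infinity at_infinity"
      by (rule tendsto_add_filterlim_at_infinity[OF tendsto_const filterlim_ident])
    have "((\<lambda>s. (-1) / (of_real a + s) * (1 / (\<Prod>a\<leftarrow>A. - (of_real a + s :: complex)))) \<longlongrightarrow> 0 * l) at_infinity"
      by (intro tendsto_mult l tendsto_divide_0[OF tendsto_const f])
    moreover have "(-1) / (of_real a + s) * (1 / (\<Prod>a\<leftarrow>A. - (of_real a + s :: complex))) =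
            (\<Prod>b\<leftarrow>B. - (of_real b + s)) / (\<Prod>a\<leftarrow>a # A. - (of_real a + s :: complex))" for s
      unfolding Nil list.map prod_list.Cons prod_list.Nil times_divide_times_eq
      by (simp only: minus_mult_left[symmetric] divide_minus_right divide_minus_left mult_1)
    ultimately show ?thesis by auto
  next
    case (Cons b B')
    with Cons.IH[of B'] Cons.prems obtain l where l:
      "((\<lambda>s. (\<Prod>b\<leftarrow>B'. - (of_real b + s)) / (\<Prod>a\<leftarrow>A. - (of_real a + s :: complex))) \<longlongrightarrow> l) at_infinity"
      by auto
    have "((\<lambda>s. (of_real b + s) / (of_real a + s) *
            ((\<Prod>b\<leftarrow>B'. - (of_real b + s)) / (\<Prod>a\<leftarrow>A. - (of_real a + s :: complex)))) \<longlongrightarrow> 1 * l) at_infinity"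
      by (intro tendsto_mult l tendsto_quotient_linear_at_infinity)
    moreover have "(of_real b + s) / (of_real a + s) *
            ((\<Prod>b\<leftarrow>B'. - (of_real b + s)) / (\<Prod>a\<leftarrow>A. - (of_real a + s :: complex))) =
            (\<Prod>b\<leftarrow>B. - (of_real b + s)) / (\<Prod>a\<leftarrow>a # A. - (of_real a + s :: complex))" for s
      unfolding Cons list.map prod_list.Cons times_divide_times_eq
      by (simp only: minus_mult_left[symmetric] minus_divide_divide)
    ultimately show ?thesis by auto
  qed
qed auto

text \<open>
  Having more factors below than above, the shift ratio is \<open>O(1 / s)\<close> at infinity: one surplus factor is
  split off and multiplied by \<open>s\<close>, and the remaining quotient still converges.
\<close>
lemma shift_ratio_bound:
  assumes len: "length B < length A"
  obtains C \<rho> where "C > 0" "\<rho> > 0" "\<And>a. a \<in> set A \<Longrightarrow> \<bar>a\<bar> < \<rho>"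
    "\<And>s. cmod s \<ge> \<rho> \<Longrightarrow> cmod (shift_ratio A B z s) \<le> C / cmod s"
proof -
  obtain a0 A' where A: "A = a0 # A'" using len by (cases A) auto
  obtain l where l: "((\<lambda>s. (\<Prod>b\<leftarrow>B. - (of_real b + s)) / (\<Prod>a\<leftarrow>A'. - (of_real a + s :: complex))) \<longlongrightarrow> l) at_infinity"
    using prod_quotient_converges_at_infinity[of B A'] len A by auto
  have "((\<lambda>s. -1 / of_real z * ((0 + s) / (of_real a0 + s)) *
         ((\<Prod>b\<leftarrow>B. - (of_real b + s)) / (\<Prod>a\<leftarrow>A'. - (of_real a + s :: complex)))) \<longlongrightarrow> -1 / of_real z * 1 * l) at_infinity"
    by (intro tendsto_intros l tendsto_quotient_linear_at_infinity)
  also have "(\<lambda>s. -1 / of_real z * ((0 + s) / (of_real a0 + s)) *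
         ((\<Prod>b\<leftarrow>B. - (of_real b + s)) / (\<Prod>a\<leftarrow>A'. - (of_real a + s :: complex)))) =
       (\<lambda>s. s * shift_ratio A B z s)"
  proof
    fix s :: complex
    define p q where "p = (\<Prod>b\<leftarrow>B. - (of_real b + s))" and "q = (\<Prod>a\<leftarrow>A'. - (of_real a + s))"
    show "-1 / of_real z * ((0 + s) / (of_real a0 + s)) * ((\<Prod>b\<leftarrow>B. - (of_real b + s)) / (\<Prod>a\<leftarrow>A'. - (of_real a + s)))
            = s * shift_ratio A B z s"
      unfolding shift_ratio_def A list.map prod_list.Cons p_def[symmetric] q_def[symmetric]
      by (simp only: minus_mult_left[symmetric] divide_minus_right divide_minus_left
            times_divide_times_eq times_divide_eq_left times_divide_eq_right divide_divide_eq_left mult_ac add_0 mult_1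
            mult_minus_left mult_minus_right)
  qed
  finally have lim: "((\<lambda>s. s * shift_ratio A B z s) \<longlongrightarrow> -1 / of_real z * 1 * l) at_infinity" .
  define C where "C = cmod (-1 / of_real z * 1 * l) + 1"
  have C: "C > 0" "eventually (\<lambda>s. cmod (s * shift_ratio A B z s) \<le> C) at_infinity"
  proof -
    show "C > 0" by (simp add: C_def add_nonneg_pos)
    from tendstoD[OF lim zero_less_one]
    show "eventually (\<lambda>s. cmod (s * shift_ratio A B z s) \<le> C) at_infinity"
    proof eventually_elim
      case (elim s)
      have "cmod (s * shift_ratio A B z s) - cmod (-1 / of_real z * 1 * l) \<le>
              cmod (s * shift_ratio A B z s - (-1 / of_real z * 1 * l))"
        by (rule norm_triangle_ineq2)
      with elim show ?case by (simp add: C_def dist_norm)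
    qed
  qed
  then obtain \<rho>0 where r0: "\<And>s. cmod s \<ge> \<rho>0 \<Longrightarrow> cmod (s * shift_ratio A B z s) \<le> C"
    by (auto simp: eventually_at_infinity)
  define \<rho> where "\<rho> = 1 + \<bar>\<rho>0\<bar> + (\<Sum>a\<in>set A. \<bar>a\<bar>)"
  have s0: "(\<Sum>a\<in>set A. \<bar>a\<bar>) \<ge> 0" by (intro sum_nonneg) auto
  show ?thesis
  proof (rule that[of C \<rho>])
    show "C > 0" by fact
    show pos: "\<rho> > 0" unfolding \<rho>_def using s0 by linarith
    show "\<bar>a\<bar> < \<rho>" if "a \<in> set A" for a
      using member_le_sum[of a "set A" abs] that by (simp add: \<rho>_def)
    fix s assume s: "cmod s \<ge> \<rho>"
    show "cmod (shift_ratio A B z s) \<le> C / cmod s"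
    proof -
      have "cmod s > 0" "\<rho>0 \<le> cmod s" using s pos s0 unfolding \<rho>_def by linarith+
      with r0[of s] show ?thesis by (simp add: norm_mult field_simps)
    qed
  qed
qed

text \<open>The derivative bound is Cauchy's estimate on the disc of radius \<open>\<bar>s\<bar> / 2\<close>, where the ratio is still \<open>O(1 / s)\<close>.\<close>
lemma shift_ratio_deriv_bound:
  assumes len: "length B < length A"
  obtains C \<rho> where "C > 0" "\<rho> > 0" 
    "\<And>s. cmod s \<ge> \<rho> \<Longrightarrow> cmod (shift_ratio A B z s) \<le> C / cmod s"
    "\<And>s. cmod s \<ge> \<rho> \<Longrightarrow> shift_ratio A B z field_differentiable at s"
    "\<And>s. cmod s \<ge> \<rho> \<Longrightarrow> cmod (deriv (shift_ratio A B z) s) \<le> C / cmod s ^ 2"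
    "\<And>s a. cmod s \<ge> \<rho> \<Longrightarrow> a \<in> set A \<Longrightarrow> of_real a + s \<noteq> 0"
proof -
  obtain C \<rho> where C: "C > 0" "\<rho> > 0" "\<And>a. a \<in> set A \<Longrightarrow> \<bar>a\<bar> < \<rho>"
    "\<And>s. cmod s \<ge> \<rho> \<Longrightarrow> cmod (shift_ratio A B z s) \<le> C / cmod s"
    using shift_ratio_bound[OF len, of z] by metis
  have nz: "of_real a + s \<noteq> 0" if "cmod s \<ge> \<rho>" "a \<in> set A" for s a
  proof
    assume "of_real a + s = 0"
    hence "s = - of_real a" by (simp add: add_eq_0_iff2)
    hence "cmod s = \<bar>a\<bar>" by simp
    with that C(3)[of a] show False by auto
  qed
  have fd: "shift_ratio A B z field_differentiable at s" if "cmod s \<ge> \<rho>" for s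
  proof -
    have 1: "(\<lambda>s. \<Prod>b\<leftarrow>L. - (of_real b + s :: complex)) field_differentiable at s" for L
      by (induction L) (auto intro!: derivative_intros field_differentiable_mult field_differentiable_minus
            field_differentiable_add)
    have 2: "(\<Prod>a\<leftarrow>A. - (of_real a + s)) \<noteq> 0"
    proof
      assume "(\<Prod>a\<leftarrow>A. - (of_real a + s)) = 0"
      then obtain a where "a \<in> set A" "- (of_real a + s) = 0"
        unfolding prod_list_zero_iff by auto
      with nz[OF that, of a] show False by (simp only: neg_equal_0_iff_equal)
    qed
    show ?thesis
      unfolding shift_ratio_def divide_inverse[of _ "of_real z"]
      by (intro field_differentiable_mult field_differentiable_divide 1 2 field_differentiable_const)
  qed
  show ?thesis
  proof (rule that[of "4 * C" "2 * \<rho>"])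
    fix s assume s: "cmod s \<ge> 2 * \<rho>"
    have s0: "cmod s > 0" using s C(2) by linarith
    have inball: "cmod x \<ge> cmod s / 2" if "x \<in> cball s (cmod s / 2)" for x
    proof -
      have "cmod s - cmod x \<le> cmod (s - x)" by (rule norm_triangle_ineq2)
      with that show ?thesis by (auto simp: dist_norm)
    qed
    have "cmod (shift_ratio A B z s) \<le> C / cmod s" using C s by (intro C(4)) auto
    also have "\<dots> \<le> 4 * C / cmod s" using C(1) by (intro divide_right_mono) auto
    finally show "cmod (shift_ratio A B z s) \<le> 4 * C / cmod s" .
    show "shift_ratio A B z field_differentiable at s" using fd[of s] C(2) s by auto
    show "of_real a + s \<noteq> 0" if "a \<in> set A" for a using nz[of s a] that C(2) s by auto
    have hol: "shift_ratio A B z holomorphic_on cball s (cmod s / 2)"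
      unfolding holomorphic_on_def
    proof
      fix x assume "x \<in> cball s (cmod s / 2)"
      hence "cmod x \<ge> \<rho>" using inball[of x] s by auto
      from fd[OF this] show "shift_ratio A B z field_differentiable at x within cball s (cmod s / 2)"
        by (rule field_differentiable_at_within)
    qed
    have "cmod ((deriv ^^ 1) (shift_ratio A B z) s) \<le> fact 1 * (2 * C / cmod s) / (cmod s / 2) ^ 1"
    proof (rule Cauchy_inequality)
      show "shift_ratio A B z holomorphic_on ball s (cmod s / 2)"
        by (rule holomorphic_on_subset[OF hol]) auto
      show "continuous_on (cball s (cmod s / 2)) (shift_ratio A B z)"
        by (rule holomorphic_on_imp_continuous_on[OF hol])
      show "cmod s / 2 > 0" using s0 by simp
      fix x assume x: "cmod (s - x) = cmod s / 2"
      hence x2: "cmod x \<ge> cmod s / 2" using inball[of x] by (auto simp: dist_norm)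
      hence "cmod (shift_ratio A B z x) \<le> C / cmod x" using s by (intro C(4)) auto
      also have "\<dots> \<le> C / (cmod s / 2)"
        using x2 s0 C(1) by (intro divide_left_mono mult_pos_pos) linarith+
      finally show "cmod (shift_ratio A B z x) \<le> 2 * C / cmod s" by (simp add: mult.commute)
    qed
    thus "cmod (deriv (shift_ratio A B z) s) \<le> 4 * C / cmod s ^ 2"
      by (simp add: power2_eq_square)
  qed (use C in auto)
qed

definition gamma_poles :: "real list \<Rightarrow> complex set" where
  "gamma_poles A = {s. \<exists>a\<in>set A. 1 - of_real a - s \<in> \<int>\<^sub>\<le>\<^sub>0}"

lemma gamma_polesE:
  assumes "s \<in> gamma_poles A"
  obtains a n where "a \<in> set A" "s = of_real (1 - a + real n)"
proof -
  obtain a where a: "a \<in> set A" "1 - of_real a - s \<in> \<int>\<^sub>\<le>\<^sub>0" using assms by (auto simp: gamma_poles_def)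
  then obtain n where "1 - of_real a - s = - of_nat n" by (elim nonpos_Ints_cases')
  hence "s = of_real (1 - a + real n)" by (simp add: algebra_simps)
  with a show ?thesis by (intro that)
qed

lemma gamma_poles_nonreal: "Im s \<noteq> 0 \<Longrightarrow> s \<notin> gamma_poles A"
  by (auto elim!: gamma_polesE)

lemma closed_gamma_poles: "closed (gamma_poles A)"
proof -
  have "gamma_poles A = (\<Union>a\<in>set A. (\<lambda>s. 1 - of_real a - s) -` \<int>\<^sub>\<le>\<^sub>0)"
    by (auto simp: gamma_poles_def)
  also have "closed \<dots>"
    by (intro closed_UN ballI closed_vimage continuous_intros) auto
  finally show ?thesis .
qed

lemma gamma_quotient_holomorphic:
  assumes "z > 0"
  shows "gamma_quotient A B z holomorphic_on - gamma_poles A"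
proof -
  have 1: "(\<lambda>s. \<Prod>a\<leftarrow>L. Gamma (1 - of_real a - s)) holomorphic_on - gamma_poles A" if "set L \<subseteq> set A" for L
    using that
    by (induction L) (auto intro!: holomorphic_intros simp: gamma_poles_def)
  have 2: "(\<lambda>s. \<Prod>a\<leftarrow>L. rGamma (1 - of_real a - s)) holomorphic_on - gamma_poles A" for L
    by (induction L) (auto intro!: holomorphic_intros)
  show ?thesis unfolding gamma_quotient_def[abs_def]
    using assms by (intro holomorphic_intros 1 2) auto
qed

lemma gamma_quotient_continuous:
  assumes "z > 0" "continuous_on S f" "\<And>x. x \<in> S \<Longrightarrow> f x \<notin> gamma_poles A"
  shows "continuous_on S (\<lambda>x. gamma_quotient A B z (f x))"
proof -
  have "continuous_on (- gamma_poles A) (gamma_quotient A B z)"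
    by (intro holomorphic_on_imp_continuous_on gamma_quotient_holomorphic assms)
  from continuous_on_compose2[OF this assms(2)] assms(3) show ?thesis by auto
qed

text \<open>Far from the origin the shift ratio is at most \<open>1 / 2\<close>, so each step to the right halves the integrand.\<close>
lemma gamma_quotient_shift_decay:
  assumes len: "length B < length A" and z: "z > 0"
  obtains \<rho> where "\<rho> \<ge> 1" "\<And>a. a \<in> set A \<Longrightarrow> \<bar>a\<bar> < \<rho>"
    "\<And>s N. \<lbrakk>\<And>k. k < N \<Longrightarrow> cmod (s + of_nat k) \<ge> \<rho>\<rbrakk> \<Longrightarrow>
        cmod (gamma_quotient A B z (s + of_nat N)) \<le> cmod (gamma_quotient A B z s) * (1 / 2) ^ N"
proof -
  obtain C \<rho>0 where C: "C > 0" "\<rho>0 > 0" "\<And>a. a \<in> set A \<Longrightarrow> \<bar>a\<bar> < \<rho>0"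
    "\<And>s. cmod s \<ge> \<rho>0 \<Longrightarrow> cmod (shift_ratio A B z s) \<le> C / cmod s"
    using shift_ratio_bound[OF len, of z] by metis
  define \<rho> where "\<rho> = max 1 (max \<rho>0 (2 * C))"
  have \<rho>: "\<rho> \<ge> 1" "\<rho> \<ge> \<rho>0" "\<rho> \<ge> 2 * C" by (auto simp: \<rho>_def)
  show ?thesis
  proof (rule that[OF \<rho>(1)])
    show "\<bar>a\<bar> < \<rho>" if "a \<in> set A" for a using C(3)[OF that] \<rho> by auto
    fix s :: complex and N :: nat assume s: "\<And>k. k < N \<Longrightarrow> cmod (s + of_nat k) \<ge> \<rho>"
    thus "cmod (gamma_quotient A B z (s + of_nat N)) \<le> cmod (gamma_quotient A B z s) * (1 / 2) ^ N"
    proof (induction N)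
      case (Suc N)
      define w where "w = s + of_nat N"
      have w: "cmod w \<ge> \<rho>" using Suc.prems[of N] by (simp add: w_def)
      have "of_real a + w \<noteq> 0" if "a \<in> set A" for a
      proof
        assume "of_real a + w = 0"
        hence "w = - of_real a" by (simp add: add_eq_0_iff2)
        hence "cmod w = \<bar>a\<bar>" by simp
        with w \<rho> C(3)[OF that] show False by auto
      qed
      hence "gamma_quotient A B z (w + 1) = gamma_quotient A B z w * shift_ratio A B z w"
        by (intro gamma_quotient_plus_1 z) auto
      moreover have "cmod (shift_ratio A B z w) \<le> 1 / 2"
      proof -
        have "cmod (shift_ratio A B z w) \<le> C / cmod w" using C(4)[of w] w \<rho> by auto
        also have "\<dots> \<le> 1 / 2"
          using w \<rho> C(1) by (subst pos_divide_le_eq) auto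
        finally show ?thesis .
      qed
      ultimately have "cmod (gamma_quotient A B z (w + 1)) \<le> cmod (gamma_quotient A B z w) * (1 / 2)"
        by (simp add: norm_mult mult_left_mono del: times_divide_eq_right)
      also have "\<dots> \<le> cmod (gamma_quotient A B z s) * (1 / 2) ^ N * (1 / 2)"
        using Suc by (intro mult_right_mono) (auto simp: w_def)
      finally show ?case by (simp add: w_def add_ac)
    qed auto
  qed
qed

text \<open>
  A strip is carried from the far left to its place by finitely many unit steps.  At large height these
  steps only decrease the modulus, whatever poles the strip contains.
\<close>
lemma gamma_quotient_strip_bound:
  assumes len: "length B < length A" and z: "z > 0"
  obtains C \<rho> where "C > 0" "\<rho> \<ge> 1"
    "\<And>x y. x \<in> {x1..x2} \<Longrightarrow> \<bar>y\<bar> \<ge> \<rho> \<Longrightarrow> cmod (gamma_quotient A B z (Complex x y)) \<le> C / y ^ 2"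
proof -
  obtain \<rho> where \<rho>: "\<rho> \<ge> 1"
    "\<And>s N. \<lbrakk>\<And>k. k < N \<Longrightarrow> cmod (s + of_nat k) \<ge> \<rho>\<rbrakk> \<Longrightarrow>
        cmod (gamma_quotient A B z (s + of_nat N)) \<le> cmod (gamma_quotient A B z s) * (1 / 2) ^ N"
    using gamma_quotient_shift_decay[OF len z] by metis
  obtain N :: nat where N: "\<And>a. a \<in> set A \<union> set B \<Longrightarrow> a + x2 \<le> real N"
  proof -
    have "bdd_above ((\<lambda>a. a + x2) ` (set A \<union> set B))"
      by (intro bdd_above_finite) auto
    then obtain m where m: "\<And>a. a \<in> set A \<union> set B \<Longrightarrow> a + x2 \<le> m"
      by (auto simp: bdd_above_def)
    have "m \<le> real (nat \<lceil>m\<rceil>)" by (rule real_nat_ceiling_ge)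
    with m show ?thesis by (intro that[of "nat \<lceil>m\<rceil>"]) force
  qed
  obtain C where C: "C > 0"
    "\<And>x y. x \<in> {x1 - real N..x2 - real N} \<Longrightarrow> cmod (gamma_quotient A B z (Complex x y)) \<le> C / (1 + \<bar>y\<bar>) ^ 2"
    using gamma_quotient_far_left_bound[OF len z, of "x2 - real N" "x1 - real N"] N
    by (smt (verit, best))
  show ?thesis
  proof (rule that[OF C(1) \<rho>(1)])
    fix x y assume x: "x \<in> {x1..x2}" and y: "\<bar>y\<bar> \<ge> \<rho>"
    define s where "s = Complex (x - real N) y"
    have "cmod (gamma_quotient A B z (s + of_nat N)) \<le> cmod (gamma_quotient A B z s) * (1 / 2) ^ N"
    proof (rule \<rho>(2))
      fix k show "cmod (s + of_nat k) \<ge> \<rho>"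
        using abs_Im_le_cmod[of "s + of_nat k"] y by (simp add: s_def)
    qed
    also have "\<dots> \<le> cmod (gamma_quotient A B z s)"
      by (intro mult_left_le power_le_one) auto
    also have "\<dots> \<le> C / (1 + \<bar>y\<bar>) ^ 2"
      unfolding s_def using x by (intro C(2)) auto
    also have "\<dots> \<le> C / \<bar>y\<bar> ^ 2"
      using C(1) y \<rho>(1) by (intro divide_left_mono power_mono mult_pos_pos zero_less_power) auto
    also have "s + of_nat N = Complex x y" by (simp add: s_def complex_eq_iff)
    finally show "cmod (gamma_quotient A B z (Complex x y)) \<le> C / y ^ 2" by simp
  qed
qed

lemma gamma_quotient_line_bound:
  assumes len: "length B < length A" and z: "z > 0" and "\<phi> > 0"
  obtains C where "C > 0"
    "\<And>y. \<bar>y\<bar> \<ge> \<phi> \<Longrightarrow> cmod (gamma_quotient A B z (Complex x y)) \<le> C / y ^ 2"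
proof -
  obtain C \<rho> where C: "C > 0" "\<rho> \<ge> 1"
    "\<And>y. \<bar>y\<bar> \<ge> \<rho> \<Longrightarrow> cmod (gamma_quotient A B z (Complex x y)) \<le> C / y ^ 2"
    using gamma_quotient_strip_bound[OF len z, of x x] by (metis atLeastAtMost_iff order_refl)
  have "continuous_on ({-\<rho>..-\<phi>} \<union> {\<phi>..\<rho>}) (\<lambda>y. gamma_quotient A B z (Complex x y))"
    using \<open>\<phi> > 0\<close> z
    by (intro gamma_quotient_continuous gamma_poles_nonreal)
       (auto intro!: continuous_intros simp: Complex_eq)
  moreover have "compact ({-\<rho>..-\<phi>} \<union> {\<phi>..\<rho>})" by (intro compact_Un) auto
  ultimately have "bounded ((\<lambda>y. gamma_quotient A B z (Complex x y)) ` ({-\<rho>..-\<phi>} \<union> {\<phi>..\<rho>}))"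
    by (intro compact_imp_bounded compact_continuous_image)
  then obtain D where D: "D > 0" 
    "\<And>y. y \<in> {-\<rho>..-\<phi>} \<union> {\<phi>..\<rho>} \<Longrightarrow> cmod (gamma_quotient A B z (Complex x y)) \<le> D"
    unfolding bounded_pos by (auto 4 3)
  show ?thesis
  proof (rule that[of "C + D * \<rho>\<^sup>2"])
    show "C + D * \<rho>\<^sup>2 > 0" using C D by (intro add_pos_nonneg) auto
    fix y assume y: "\<bar>y\<bar> \<ge> \<phi>"
    have y2: "y\<^sup>2 > 0" using y \<open>\<phi> > 0\<close> by auto
    show "cmod (gamma_quotient A B z (Complex x y)) \<le> (C + D * \<rho>\<^sup>2) / y ^ 2"
    proof (cases "\<bar>y\<bar> \<ge> \<rho>")
      case True
      have "cmod (gamma_quotient A B z (Complex x y)) \<le> C / y\<^sup>2" by (rule C(3)[OF True])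
      also have "\<dots> \<le> (C + D * \<rho>\<^sup>2) / y\<^sup>2" using D by (intro divide_right_mono) auto
      finally show ?thesis .
    next
      case False
      hence "y\<^sup>2 \<le> \<rho>\<^sup>2" by (intro abs_le_square_iff[THEN iffD1]) (use C in auto)
      have "cmod (gamma_quotient A B z (Complex x y)) * y\<^sup>2 \<le> D * \<rho>\<^sup>2"
        using y False \<open>y\<^sup>2 \<le> \<rho>\<^sup>2\<close> D(1) by (intro mult_mono D(2)) auto
      also have "\<dots> \<le> C + D * \<rho>\<^sup>2" using C by simp
      finally show ?thesis using y2 by (simp add: pos_le_divide_eq)
    qed
  qed
qed

text \<open>
  Along the points \<open>x + N\<close> the halving sets in once \<open>x + N\<close> has left the disc where the shift ratio is large;
  it then holds at every height, and \<open>\<phi>\<close> only keeps the starting line away from the poles.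
\<close>
lemma gamma_quotient_right_bound:
  assumes len: "length B < length A" and z: "z > 0" and "\<phi> > 0"
  obtains C N0 where "C > 0"
    "\<And>y N. N \<ge> N0 \<Longrightarrow> \<bar>y\<bar> \<ge> \<phi> \<Longrightarrow> cmod (gamma_quotient A B z (Complex (x + real N) y)) \<le> C * (1 / 2) ^ N / y ^ 2"
proof -
  obtain \<rho> where \<rho>: "\<rho> \<ge> 1"
    "\<And>s N. \<lbrakk>\<And>k. k < N \<Longrightarrow> cmod (s + of_nat k) \<ge> \<rho>\<rbrakk> \<Longrightarrow>
        cmod (gamma_quotient A B z (s + of_nat N)) \<le> cmod (gamma_quotient A B z s) * (1 / 2) ^ N"
    using gamma_quotient_shift_decay[OF len z] by metis
  define N0 where "N0 = nat \<lceil>\<rho> - x\<rceil>"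
  have N0: "x + real N0 \<ge> \<rho>" unfolding N0_def by linarith
  obtain C where C: "C > 0"
    "\<And>y. \<bar>y\<bar> \<ge> \<phi> \<Longrightarrow> cmod (gamma_quotient A B z (Complex (x + real N0) y)) \<le> C / y ^ 2"
    using gamma_quotient_line_bound[OF len z \<open>\<phi> > 0\<close>, of "x + real N0"] by metis
  show ?thesis
  proof (rule that[of "C * 2 ^ N0" N0])
    show "C * 2 ^ N0 > 0" using C by simp
    fix y N assume N: "N \<ge> N0" and y: "\<bar>y\<bar> \<ge> \<phi>"
    define s where "s = Complex (x + real N0) y"
    have "cmod (gamma_quotient A B z (s + of_nat (N - N0))) \<le> cmod (gamma_quotient A B z s) * (1 / 2) ^ (N - N0)"
    proof (rule \<rho>(2))
      fix k show "cmod (s + of_nat k) \<ge> \<rho>"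
        using abs_Re_le_cmod[of "s + of_nat k"] N0 by (simp add: s_def)
    qed
    also have "\<dots> \<le> C / y ^ 2 * (1 / 2) ^ (N - N0)"
      unfolding s_def using y by (intro mult_right_mono C(2)) auto
    also have "\<dots> = C * 2 ^ N0 * (1 / 2) ^ N / y ^ 2"
      using N by (simp add: power_diff power_divide)
    also have "s + of_nat (N - N0) = Complex (x + real N) y" using N by (simp add: s_def complex_eq_iff)
    finally show "cmod (gamma_quotient A B z (Complex (x + real N) y)) \<le> C * 2 ^ N0 * (1 / 2) ^ N / y ^ 2" .
  qed
qed

lemma gamma_quotient_axis_bound:
  assumes len: "length B < length A" and z: "z > 0" and pos: "\<And>a. a \<in> set A \<Longrightarrow> a < 1"
  obtains C where "C > 0" "\<And>y. cmod (gamma_quotient A B z (Complex 0 y)) \<le> C / (1 + y ^ 2)"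
proof -
  obtain C where C: "C > 0"
    "\<And>y. \<bar>y\<bar> \<ge> 1 \<Longrightarrow> cmod (gamma_quotient A B z (Complex 0 y)) \<le> C / y ^ 2"
    using gamma_quotient_line_bound[OF len z, of 1 0] by (metis zero_less_one)
  have np: "Complex 0 y \<notin> gamma_poles A" for y
    by (auto elim!: gamma_polesE simp: complex_eq_iff dest!: pos)
  have "bounded ((\<lambda>y. gamma_quotient A B z (Complex 0 y)) ` {-1..1})"
    using z np by (intro compact_imp_bounded compact_continuous_image gamma_quotient_continuous)
       (auto intro!: continuous_intros simp: Complex_eq)
  then obtain D where D: "D > 0" 
    "\<And>y. y \<in> {-1..1} \<Longrightarrow> cmod (gamma_quotient A B z (Complex 0 y)) \<le> D"
    unfolding bounded_pos by (auto 4 3)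
  show ?thesis
  proof (rule that[of "2 * (C + D)"])
    show "2 * (C + D) > 0" using C D by auto
    fix y :: real
    show "cmod (gamma_quotient A B z (Complex 0 y)) \<le> 2 * (C + D) / (1 + y ^ 2)"
    proof (cases "\<bar>y\<bar> \<ge> 1")
      case True
      hence "y\<^sup>2 \<ge> 1" using abs_le_square_iff[of 1 y] by simp
      hence "C / y\<^sup>2 \<le> 2 * (C + D) / (1 + y\<^sup>2)"
      proof -
        have "C * (1 + y\<^sup>2) \<le> C * (2 * y\<^sup>2)" using C \<open>y\<^sup>2 \<ge> 1\<close> by (intro mult_left_mono) auto
        also have "\<dots> \<le> 2 * (C + D) * y\<^sup>2" using D by (simp add: algebra_simps)
        finally have *: "C * (1 + y\<^sup>2) \<le> 2 * (C + D) * y\<^sup>2" .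
        have "y\<^sup>2 > 0" "1 + y\<^sup>2 > 0" using \<open>y\<^sup>2 \<ge> 1\<close> by linarith+
        with * show ?thesis by (simp only: frac_le_eq divide_le_eq_1 divide_le_cancel le_divide_eq divide_le_eq if_True times_divide_eq_left)
      qed
      with C(2)[OF True] show ?thesis by linarith
    next
      case False
      hence "y\<^sup>2 \<le> 1" using abs_le_square_iff[of y 1] by simp
      hence "D \<le> 2 * (C + D) / (1 + y\<^sup>2)"
      proof -
        have "D * (1 + y\<^sup>2) \<le> D * 2" using D \<open>y\<^sup>2 \<le> 1\<close> by (intro mult_left_mono) auto
        also have "\<dots> \<le> 2 * (C + D)" using C by simp
        finally show ?thesis by (simp add: pos_le_divide_eq add_pos_nonneg)
      qed
      moreover have "cmod (gamma_quotient A B z (Complex 0 y)) \<le> D"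
        using False by (intro D(2)) auto
      ultimately show ?thesis by linarith
    qed
  qed
qed

section \<open>The plane slit along the positive real axis\<close>

text \<open>The complement of a ray to the right; slit at the first pole it is a starlike set on which the integrand is holomorphic.\<close>
definition slit_plane :: "real \<Rightarrow> complex set" where
  "slit_plane w = {s. Im s \<noteq> 0 \<or> Re s < w}"

lemma open_slit_plane: "open (slit_plane w)"
proof -
  have "slit_plane w = {s. Im s < 0} \<union> {s. Im s > 0} \<union> {s. Re s < w}"
    by (auto simp: slit_plane_def)
  thus ?thesis
    by (auto intro!: open_Un open_halfspace_Im_lt open_halfspace_Im_gt open_halfspace_Re_lt)
qed

lemma starlike_slit_plane: "starlike (slit_plane w)"
  unfolding starlike_def
proof (intro bexI[of _ "of_real (w - 1)"] ballI subsetI)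
  fix s x assume s: "s \<in> slit_plane w" and x: "x \<in> closed_segment (of_real (w - 1)) s"
  then obtain u where u: "0 \<le> u" "u \<le> 1" "x = (1 - u) *\<^sub>R of_real (w - 1) + u *\<^sub>R s"
    by (auto simp: in_segment)
  show "x \<in> slit_plane w"
  proof (cases "u = 0")
    case False
    show ?thesis
    proof (cases "Im s = 0")
      case True
      with s have "Re s < w" by (auto simp: slit_plane_def)
      hence "u * Re s < u * w" using u False by simp
      moreover have "(1 - u) * (w - 1) \<le> (1 - u) * w" using u by (intro mult_left_mono) auto
      ultimately have "(1 - u) * (w - 1) + u * Re s < w" by (simp add: algebra_simps)
      thus ?thesis using u by (simp add: slit_plane_def)
    qed (use u False in \<open>simp add: slit_plane_def\<close>)
  qed (use u in \<open>simp add: slit_plane_def\<close>)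
qed (auto simp: slit_plane_def)

lemma Ln_primitive_slit_plane:
  assumes "s \<in> slit_plane w"
  shows "((\<lambda>s. Ln (of_real w - s)) has_field_derivative 1 / (s - of_real w)) (at s)"
proof -
  have "of_real w - s \<notin> \<real>\<^sub>\<le>\<^sub>0"
    using assms by (auto simp: slit_plane_def complex_nonpos_Reals_iff)
  moreover from this have "of_real w - s \<noteq> 0" by auto
  ultimately have "((\<lambda>s. Ln (of_real w - s)) has_field_derivative (0 - 1) / (of_real w - s)) (at s)"
    by (auto intro!: derivative_eq_intros simp: inverse_eq_divide)
  also have "(0 - 1) / (of_real w - s) = 1 / (s - of_real w)"
    by (metis diff_0 minus_diff_eq minus_divide_divide)
  finally show ?thesis .
qed

text \<open>
  The winding number around \<open>w\<close> of any path from \<open>a\<close> to \<open>b\<close> in the plane slit at \<open>w\<close>; its real part is the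
  change of \<open>arg (s - w)\<close>, divided by \<open>2\<pi>\<close>.  The logarithm of \<open>w - s\<close> is used because its branch cut is that slit.
\<close>
definition sweep :: "real \<Rightarrow> complex \<Rightarrow> complex \<Rightarrow> complex" where
  "sweep w a b = (Ln (of_real w - b) - Ln (of_real w - a)) / (2 * of_real pi * \<i>)"

lemma Re_sweep:
  "Re (sweep w a b) = (Im (Ln (of_real w - b)) - Im (Ln (of_real w - a))) / (2 * pi)"
  by (simp add: sweep_def Re_divide power2_eq_square field_simps)

lemma winding_number_in_slit_plane:
  assumes "valid_path g" "path_image g \<subseteq> slit_plane w"
  shows "winding_number g (of_real w) = sweep w (pathstart g) (pathfinish g)"
proof -
  have "of_real w \<notin> path_image g" using assms(2) by (auto simp: slit_plane_def)
  hence "winding_number g (of_real w) = 1 / (2 * of_real pi * \<i>) * contour_integral g (\<lambda>s. 1 / (s - of_real w))"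
    using winding_number_valid_path[OF assms(1)] by simp
  also have "((\<lambda>s. 1 / (s - of_real w)) has_contour_integral
               (Ln (of_real w - pathfinish g) - Ln (of_real w - pathstart g))) g"
    by (rule contour_integral_primitive[OF _ assms])
       (auto intro: has_field_derivative_at_within Ln_primitive_slit_plane)
  hence "contour_integral g (\<lambda>s. 1 / (s - of_real w)) = Ln (of_real w - pathfinish g) - Ln (of_real w - pathstart g)"
    by (rule contour_integral_unique)
  finally show ?thesis by (simp add: sweep_def)
qed

lemma Im_Ln_below: "Im s < 0 \<Longrightarrow> Im (Ln (of_real w - s)) \<in> {0<..<pi}"
  using Im_Ln_pos_lt_imp[of "of_real w - s"] Im_Ln_pos_lt[of "of_real w - s"] by (cases "of_real w - s = 0") auto

lemma Im_Ln_above: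
  assumes "Im s > 0" shows "Im (Ln (of_real w - s)) \<in> {-pi<..<0}"
proof -
  have "of_real w - s \<notin> \<real>\<^sub>\<le>\<^sub>0" using assms by (auto simp: complex_nonpos_Reals_iff)
  hence "Ln (of_real w - cnj s) = cnj (Ln (of_real w - s))"
    by (subst cnj_Ln) auto
  moreover have "Im (Ln (of_real w - cnj s)) \<in> {0<..<pi}" using assms by (intro Im_Ln_below) auto
  ultimately show ?thesis by auto
qed

section \<open>Contours closed up through the origin\<close>

definition in_end :: "contour_kind \<Rightarrow> (real \<Rightarrow> complex) \<Rightarrow> real \<Rightarrow> complex" where
  "in_end K p R = pathstart p + of_real R * in_dir K"
definition out_end :: "contour_kind \<Rightarrow> (real \<Rightarrow> complex) \<Rightarrow> real \<Rightarrow> complex" where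
  "out_end K p R = pathfinish p + of_real R * out_dir K"

lemma trunc_contour_ends [simp]:
  "pathstart (trunc_contour K p R) = in_end K p R"
  "pathfinish (trunc_contour K p R) = out_end K p R"
  by (simp_all add: trunc_contour_def in_end_def out_end_def)

lemma path_image_trunc_contour:
  "path_image (trunc_contour K p R) =
     closed_segment (in_end K p R) (pathstart p) \<union> path_image p \<union> closed_segment (pathfinish p) (out_end K p R)"
  by (simp add: trunc_contour_def in_end_def out_end_def path_image_join Un_assoc)

lemma valid_path_trunc_contour: "valid_path p \<Longrightarrow> valid_path (trunc_contour K p R)"
  unfolding trunc_contour_def by (intro valid_path_join valid_path_linepath) auto

lemma in_ray_segment:
  assumes "0 \<le> R1" "R1 \<le> R2"
  shows "in_end K p R1 \<in> closed_segment (in_end K p R2) (pathstart p)"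
    and "out_end K p R1 \<in> closed_segment (pathfinish p) (out_end K p R2)"
    and "closed_segment (in_end K p R2) (in_end K p R1) = (\<lambda>R. in_end K p R) ` {R1..R2}"
    and "closed_segment (out_end K p R1) (out_end K p R2) = (\<lambda>R. out_end K p R) ` {R1..R2}"
proof -
  have *: "closed_segment (a + of_real R1 * d) (a + of_real R2 * d) = (\<lambda>R. a + of_real R * d) ` {R1..R2}"
    if "R1 \<le> R2" for a d :: complex and R1 R2 :: real
  proof -
    have "closed_segment (a + of_real R1 * d) (a + of_real R2 * d) =
            (\<lambda>s. a + s) ` closed_segment (of_real R1 * d) (of_real R2 * d)"
      by (rule closed_segment_translation)
    also have "closed_segment (of_real R1 * d) (of_real R2 * d) = (\<lambda>R. of_real R * d) ` closed_segment R1 R2"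
      using closed_segment_linear_image[of "\<lambda>R. of_real R * d" R1 R2] 
      by (simp add: linear_iff algebra_simps scaleR_conv_of_real)
    finally show ?thesis using that by (simp add: image_image closed_segment_eq_real_ivl)
  qed
  show "closed_segment (in_end K p R2) (in_end K p R1) = (\<lambda>R. in_end K p R) ` {R1..R2}"
    unfolding in_end_def by (subst closed_segment_commute) (rule *[OF assms(2)])
  show "closed_segment (out_end K p R1) (out_end K p R2) = (\<lambda>R. out_end K p R) ` {R1..R2}"
    unfolding out_end_def by (rule *[OF assms(2)])
  show "in_end K p R1 \<in> closed_segment (in_end K p R2) (pathstart p)"
    using *[of 0 R2 "pathstart p" "in_dir K"] assms
    by (subst closed_segment_commute) (auto simp: in_end_def)
  show "out_end K p R1 \<in> closed_segment (pathfinish p) (out_end K p R2)"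
    using *[of 0 R2 "pathfinish p" "out_dir K"] assms by (auto simp: out_end_def)
qed

text \<open>
  Lengthening the rays of a truncated contour changes the winding number around \<open>w\<close> only by the sweeps of
  the two added segments, provided these stay in the plane slit at \<open>w\<close>.
\<close>
lemma winding_number_trunc_contour_extend:
  assumes p: "valid_path p" and w: "\<And>R. R > 0 \<Longrightarrow> of_real w \<notin> path_image (trunc_contour K p R)"
    and R: "0 < R1" "R1 \<le> R2"
    and slit: "\<And>R. R \<in> {R1..R2} \<Longrightarrow> in_end K p R \<in> slit_plane w"
      "\<And>R. R \<in> {R1..R2} \<Longrightarrow> out_end K p R \<in> slit_plane w"
  shows "winding_number (trunc_contour K p R2) (of_real w) - winding_number (trunc_contour K p R1) (of_real w) =
     sweep w (in_end K p R2) (in_end K p R1) + sweep w (out_end K p R1) (out_end K p R2)"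
proof -
  have dec: "winding_number (trunc_contour K p R) (of_real w) =
      winding_number (linepath (in_end K p R) (pathstart p)) (of_real w) + winding_number p (of_real w) +
      winding_number (linepath (pathfinish p) (out_end K p R)) (of_real w)" if "R > 0" for R
    using w[OF that] p unfolding path_image_trunc_contour
    unfolding trunc_contour_def in_end_def[symmetric] out_end_def[symmetric]
    by (subst winding_number_join; (subst winding_number_join)?) 
       (auto simp: path_image_join valid_path_imp_path intro!: path_join_imp)
  have s1: "winding_number (linepath (in_end K p R2) (pathstart p)) (of_real w) =
     winding_number (linepath (in_end K p R2) (in_end K p R1)) (of_real w) +
     winding_number (linepath (in_end K p R1) (pathstart p)) (of_real w)"
    using w[of R2] R by (intro winding_number_split_linepath in_ray_segment) (auto simp: path_image_trunc_contour)
  have s2: "winding_number (linepath (pathfinish p) (out_end K p R2)) (of_real w) =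
     winding_number (linepath (pathfinish p) (out_end K p R1)) (of_real w) +
     winding_number (linepath (out_end K p R1) (out_end K p R2)) (of_real w)"
    using w[of R2] R by (intro winding_number_split_linepath in_ray_segment) (auto simp: path_image_trunc_contour)
  have w1: "winding_number (linepath (in_end K p R2) (in_end K p R1)) (of_real w) = sweep w (in_end K p R2) (in_end K p R1)"
    using R slit by (subst winding_number_in_slit_plane) (auto simp: in_ray_segment)
  have w2: "winding_number (linepath (out_end K p R1) (out_end K p R2)) (of_real w) = sweep w (out_end K p R1) (out_end K p R2)"
    using R slit by (subst winding_number_in_slit_plane) (auto simp: in_ray_segment)
  show ?thesis using R by (simp add: dec s1 s2 w1 w2)
qed

text \<open>
  The way back from the end to the start of a truncated contour.  If both are off the real axis, it meets that axis
  only at the origin, to the left of all poles.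
\<close>
definition closing_path :: "contour_kind \<Rightarrow> (real \<Rightarrow> complex) \<Rightarrow> real \<Rightarrow> (real \<Rightarrow> complex)" where
  "closing_path K p R = linepath (out_end K p R) 0 +++ linepath 0 (in_end K p R)"

lemma closing_path_simps [simp]:
  "valid_path (closing_path K p R)"
  "pathstart (closing_path K p R) = out_end K p R"
  "pathfinish (closing_path K p R) = in_end K p R"
  by (auto simp: closing_path_def)

lemma closing_path_image:
  assumes "w > 0" "Im (in_end K p R) \<noteq> 0" "Im (out_end K p R) \<noteq> 0"
  shows "path_image (closing_path K p R) \<subseteq> slit_plane w"
proof -
  have "closed_segment 0 a \<subseteq> slit_plane w" if "Im a \<noteq> 0" for a
  proof
    fix x assume "x \<in> closed_segment 0 a"
    then obtain u where "0 \<le> u" "u \<le> 1" "x = u *\<^sub>R a" by (auto simp: in_segment)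
    with that assms(1) show "x \<in> slit_plane w" by (cases "u = 0") (auto simp: slit_plane_def)
  qed
  from this[OF assms(2)] this[OF assms(3)] show ?thesis
    unfolding closing_path_def by (auto simp: path_image_join closed_segment_commute)
qed

text \<open>
  Around a pole the closed path has an integer winding number, which does not depend on \<open>R\<close>.  For large \<open>R\<close> its
  real part is the index, close to \<open>-1/2\<close> or \<open>-1\<close>, plus a return sweep strictly between 0 and 1; in the case
  \<open>-1\<close> the return sweep exceeds \<open>1/4\<close>, since then the contour starts to the right of the pole.  Hence the real
  part lies strictly between \<open>-1\<close> and 1, and the winding number is 0.  Constancy in \<open>R\<close> makes this hold for all
  of the infinitely many poles at one and the same \<open>R\<close>, as Cauchy's theorem demands.
\<close>
lemma contour_integral_trunc_contour_primitive:
  assumes p: "valid_path p" and F: "F holomorphic_on - P" and P: "closed P"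
    and real: "\<And>w. w \<in> P \<Longrightarrow> Im w = 0 \<and> w0 \<le> Re w" and w0: "w0 > 0"
    and \<Phi>: "\<And>s. s \<in> slit_plane w0 \<Longrightarrow> (\<Phi> has_field_derivative F s) (at s)"
    and idx: "\<And>w. w \<in> P \<Longrightarrow> has_contour_index K p w c"
    and c: "c = -1 / 2 \<or> c = -1 \<and> (\<forall>w\<in>P. eventually (\<lambda>R. Re (in_end K p R) > Re w) at_top)"
    and R0: "R0 > 0" and ends: "\<And>R. R \<ge> R0 \<Longrightarrow> Im (in_end K p R) < 0 \<and> Im (out_end K p R) > 0"
    and R: "R \<ge> R0"
  shows "contour_integral (trunc_contour K p R) F = \<Phi> (out_end K p R) - \<Phi> (in_end K p R)"
proof -
  define cl where "cl = (\<lambda>R. trunc_contour K p R +++ closing_path K p R)"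
  have vp: "valid_path (cl R)" for R
    unfolding cl_def by (intro valid_path_join valid_path_trunc_contour p) auto
  have avoid: "w \<notin> path_image (trunc_contour K p R)" if "w \<in> P" "R > 0" for w R
    using idx[OF that(1)] that(2) by (auto simp: has_contour_index_def)
  have cls: "path_image (closing_path K p R) \<subseteq> slit_plane v" if "R \<ge> R0" "v > 0" for R v
    using ends[OF that(1)] that(2) by (intro closing_path_image) auto
  have wn0: "winding_number (cl R) w = 0" if w: "w \<in> P" for w
  proof -
    define v where "v = Re w"
    have v: "w = of_real v" "v > 0" using real[OF w] w0 by (auto simp: v_def complex_eq_iff)
    have dec: "winding_number (cl R) w = winding_number (trunc_contour K p R) w +
       sweep v (out_end K p R) (in_end K p R)" if "R \<ge> R0" for R
    proof -
      have "w \<notin> path_image (closing_path K p R)"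
        using cls[OF that v(2)] v by (auto simp: slit_plane_def)
      hence "winding_number (cl R) w = winding_number (trunc_contour K p R) w + winding_number (closing_path K p R) w"
        unfolding cl_def using avoid[OF w, of R] that R0 p
        by (intro winding_number_join valid_path_imp_path valid_path_trunc_contour) auto
      also have "winding_number (closing_path K p R) w = sweep v (out_end K p R) (in_end K p R)"
        unfolding v(1) using cls[OF that v(2)] by (subst winding_number_in_slit_plane) auto
      finally show ?thesis .
    qed
    have const: "winding_number (cl R) w = winding_number (cl R0) w" if "R \<ge> R0" for R
    proof -
      have "winding_number (trunc_contour K p R) (of_real v) - winding_number (trunc_contour K p R0) (of_real v) =
          sweep v (in_end K p R) (in_end K p R0) + sweep v (out_end K p R0) (out_end K p R)"
        using that R0 avoid[OF w] v ends
        by (intro winding_number_trunc_contour_extend p) (force simp: slit_plane_def)+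
      hence 1: "winding_number (trunc_contour K p R) (of_real v) = sweep v (in_end K p R) (in_end K p R0) +
          sweep v (out_end K p R0) (out_end K p R) + winding_number (trunc_contour K p R0) (of_real v)"
        by (simp only: diff_eq_eq)
      have "sweep v a b + sweep v b c = sweep v a c" for a b c
        by (simp add: sweep_def add_divide_distrib[symmetric])
      hence 2: "sweep v (out_end K p R0) (in_end K p R0) = sweep v (out_end K p R0) (out_end K p R) +
          (sweep v (out_end K p R) (in_end K p R) + sweep v (in_end K p R) (in_end K p R0))"
        by simp
      show ?thesis unfolding dec[OF that] dec[OF order_refl] unfolding v(1) 1 2 by (simp only: add_ac)
    qed
    have int: "winding_number (cl R) w \<in> \<int>" if "R \<ge> R0" for R
    proof (rule integer_winding_number)
      show "path (cl R)" using vp valid_path_imp_path by blast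
      show "pathfinish (cl R) = pathstart (cl R)" by (simp add: cl_def)
      have "w \<notin> path_image (closing_path K p R)"
        using cls[OF that v(2)] v by (auto simp: slit_plane_def)
      thus "w \<notin> path_image (cl R)" using avoid[OF w, of R] that R0
        unfolding cl_def by (subst path_image_join) auto
    qed
    have lim: "((\<lambda>R. Re (winding_number (trunc_contour K p R) w)) \<longlongrightarrow> c) at_top"
      using idx[OF w] by (simp add: has_contour_index_def)
    have "eventually (\<lambda>R. \<bar>Re (winding_number (cl R) w)\<bar> < 1) at_top"
    proof -
      have e1: "eventually (\<lambda>R. \<bar>Re (winding_number (trunc_contour K p R) w) - c\<bar> < 1 / 4) at_top"
        using tendstoD[OF lim, of "1/4"] by (simp add: dist_real_def)
      have e2: "eventually (\<lambda>R. c = -1 / 2 \<or> c = -1 \<and> Re (in_end K p R) > v) at_top"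
        using c
      proof
        assume c: "c = -1 \<and> (\<forall>w\<in>P. eventually (\<lambda>R. Re (in_end K p R) > Re w) at_top)"
        hence "eventually (\<lambda>R. Re (in_end K p R) > v) at_top" using w by (auto simp: v_def)
        thus ?thesis by eventually_elim (use c in auto)
      qed auto
      show ?thesis using e1 e2 eventually_ge_at_top[of R0]
      proof eventually_elim
        case (elim R)
        have i: "Im (Ln (of_real v - in_end K p R)) \<in> {0<..<pi}"
          using ends[OF elim(3)] by (intro Im_Ln_below) auto
        have o: "Im (Ln (of_real v - out_end K p R)) \<in> {-pi<..<0}"
          using ends[OF elim(3)] by (intro Im_Ln_above) auto
        define th where "th = Im (Ln (of_real v - in_end K p R)) - Im (Ln (of_real v - out_end K p R))"
        have re: "Re (winding_number (cl R) w) = Re (winding_number (trunc_contour K p R) w) + th / (2 * pi)"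
          unfolding dec[OF elim(3)] th_def by (simp add: Re_sweep)
        have th: "0 < th" "th < 2 * pi" using i o by (auto simp: th_def)
        have th1: "0 < th / (2 * pi)" "th / (2 * pi) < 1" using th by (auto simp: field_simps)
        from elim(2) show ?case
        proof
          assume "c = -1 / 2"
          thus ?thesis using re th1 elim(1) by linarith
        next
          assume c: "c = -1 \<and> Re (in_end K p R) > v"
          have "of_real v - in_end K p R \<noteq> 0" using c by (auto simp: complex_eq_iff)
          hence "\<not> \<bar>Im (Ln (of_real v - in_end K p R))\<bar> < pi / 2"
            using c Re_Ln_pos_lt[of "of_real v - in_end K p R"] by auto
          moreover have "of_real v - in_end K p R \<noteq> 0" by fact
          ultimately have "th > pi / 2" using i o by (auto simp: th_def)
          hence "th / (2 * pi) > 1 / 4" by (simp add: field_simps)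
          thus ?thesis using re th1 elim(1) c by linarith
        qed
      qed
    qed
    then obtain R' where R': "R' \<ge> R0" "\<bar>Re (winding_number (cl R') w)\<bar> < 1"
      by (metis (no_types, lifting) eventually_at_top_linorder linorder_le_cases order_refl)
    from int[OF R'(1)] obtain k where "winding_number (cl R') w = of_int k" by (elim Ints_cases)
    with R'(2) have "winding_number (cl R') w = 0" by simp
    with const[OF R'(1)] const[OF R] show ?thesis by simp
  qed
  have cl0: "(F has_contour_integral 0) (cl R)"
  proof (rule Cauchy_theorem_global[OF _ F vp])
    show "open (- P)" using P by auto
    show "pathfinish (cl R) = pathstart (cl R)" by (simp add: cl_def)
    have "P \<inter> path_image (closing_path K p R) = {}"
    proof -
      have "w \<notin> slit_plane w0" if "w \<in> P" for w using real[OF that] by (auto simp: slit_plane_def)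
      thus ?thesis using cls[OF R w0] by blast
    qed
    thus "path_image (cl R) \<subseteq> - P" using avoid[of _ R] R R0
      unfolding cl_def by (subst path_image_join) auto
    show "winding_number (cl R) w = 0" if "w \<notin> - P" for w using wn0 that by auto
  qed
  have "(F has_contour_integral (\<Phi> (in_end K p R) - \<Phi> (out_end K p R))) (closing_path K p R)"
    using contour_integral_primitive[of "slit_plane w0" \<Phi> F "closing_path K p R"] \<Phi> cls[OF R w0]
    by (auto intro: has_field_derivative_at_within)
  moreover have "F contour_integrable_on (trunc_contour K p R)"
    using p F P avoid[of _ R] R R0
    by (intro contour_integrable_holomorphic_simple[of F "- P"] valid_path_trunc_contour) auto
  ultimately have "contour_integral (cl R) F = contour_integral (trunc_contour K p R) F + (\<Phi> (in_end K p R) - \<Phi> (out_end K p R))"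
    unfolding cl_def using p
    by (subst contour_integral_join)
       (auto simp: contour_integral_unique has_contour_integral_integrable intro!: valid_path_trunc_contour)
  with contour_integral_unique[OF cl0] show ?thesis by (simp add: algebra_simps)
qed

section \<open>Improper integrals along rays\<close>

lemma has_integral_half_line_limit:
  fixes f :: "real \<Rightarrow> complex"
  assumes "(f has_integral I) {0..}"
  shows "f integrable_on {0..R}" "((\<lambda>R. integral {0..R} f) \<longlongrightarrow> I) at_top"
proof -
  have A: "(\<lambda>x. if x \<in> {0..} then f x else 0) integrable_on cbox a b" for a b
    using assms by (subst (asm) has_integral_alt') auto
  have B: "\<exists>B>0. \<forall>a b. ball 0 B \<subseteq> cbox a b \<longrightarrow>
       cmod (integral (cbox a b) (\<lambda>x. if x \<in> {0..} then f x else 0) - I) < e" if "e > 0" for e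
    using assms that by (subst (asm) has_integral_alt') auto
  show "f integrable_on {0..R}"
  proof -
    have "(\<lambda>x. if x \<in> {0..} then f x else 0) integrable_on {0..R}" using A[of 0 R] by simp
    thus ?thesis by (rule integrable_eq) auto
  qed
  show "((\<lambda>R. integral {0..R} f) \<longlongrightarrow> I) at_top"
  proof (rule tendstoI)
    fix e :: real assume "e > 0"
    from B[OF this] obtain b where b: "b > 0"
      "\<And>u v. ball 0 b \<subseteq> cbox u v \<Longrightarrow> cmod (integral (cbox u v) (\<lambda>x. if x \<in> {0..} then f x else 0) - I) < e"
      by blast
    show "eventually (\<lambda>R. dist (integral {0..R} f) I < e) at_top"
      using eventually_ge_at_top[of b]
    proof eventually_elim
      case (elim R)
      have "ball 0 b \<subseteq> cbox (-R) R" using elim by (auto simp: dist_real_def)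
      from b(2)[OF this] have "cmod (integral ({-R..R} \<inter> {0..}) f - I) < e"
        by (simp only: integral_restrict_Int box_real Int_commute)
      also have "{-R..R} \<inter> {0..} = {0..R}" using elim b by auto
      finally show ?case by (simp add: dist_norm)
    qed
  qed
qed

lemma has_integral_real_line_limit:
  fixes f :: "real \<Rightarrow> complex"
  assumes "(f has_integral I) UNIV"
  shows "((\<lambda>R. integral {-R..R} f) \<longlongrightarrow> I) at_top"
proof (rule tendstoI)
  fix e :: real assume "e > 0"
  have "\<exists>B>0. \<forall>a b. ball 0 B \<subseteq> cbox a b \<longrightarrow> cmod (integral (cbox a b) f - I) < e"
    using assms \<open>e > 0\<close> by (subst (asm) has_integral_alt') auto
  then obtain b where b: "b > 0" "\<And>u v. ball 0 b \<subseteq> cbox u v \<Longrightarrow> cmod (integral (cbox u v) f - I) < e"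
    by blast
  show "eventually (\<lambda>R. dist (integral {-R..R} f) I < e) at_top"
    using eventually_ge_at_top[of b]
  proof eventually_elim
    case (elim R)
    have "ball 0 b \<subseteq> cbox (-R) R" using elim by (auto simp: dist_real_def)
    from b(2)[OF this] show ?case by (simp add: dist_norm)
  qed
qed

lemma has_contour_integral_ray_segment:
  assumes "((\<lambda>x. F (a + of_real x * d) * d) has_integral J) {0..R}" "R > 0"
  shows "(F has_contour_integral J) (linepath a (a + of_real R * d))"
proof -
  have "((\<lambda>x. F (a + of_real (R * x) * d) * d) has_integral (1 / \<bar>R\<bar>) *\<^sub>R J) ((\<lambda>x. x / R) ` {0..R})"
    using has_integral_stretch_real[OF assms(1), of R] assms(2) by simp
  also have "(\<lambda>x. x / R) ` {0..R} = {0..1}"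
    using assms(2) by (simp add: image_divide_atLeastAtMost)
  finally have "((\<lambda>x. R *\<^sub>R (F (a + of_real (R * x) * d) * d)) has_integral R *\<^sub>R ((1 / \<bar>R\<bar>) *\<^sub>R J)) {0..1}"
    by (rule has_integral_cmul)
  also have "R *\<^sub>R ((1 / \<bar>R\<bar>) *\<^sub>R J) = J" using assms(2) by simp
  also have "(\<lambda>x. R *\<^sub>R (F (a + of_real (R * x) * d) * d)) =
     (\<lambda>x. F (linepath a (a + of_real R * d) x) * (a + of_real R * d - a))"
  proof
    fix x
    have "linepath a (a + of_real R * d) x = a + of_real (R * x) * d"
      by (simp add: linepath_def scaleR_conv_of_real algebra_simps)
    thus "R *\<^sub>R (F (a + of_real (R * x) * d) * d) = F (linepath a (a + of_real R * d) x) * (a + of_real R * d - a)"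
      by (simp add: scaleR_conv_of_real)
  qed
  finally show ?thesis unfolding has_contour_integral_linepath .
qed

lemma contour_integral_trunc_contour_limit:
  assumes "valid_path p" "has_infinite_contour_integral F I K p"
  shows "((\<lambda>R. contour_integral (trunc_contour K p R) F) \<longlongrightarrow> I) at_top"
proof -
  obtain I1 I2 I3 where
    1: "((\<lambda>x. F (pathstart p + of_real x * in_dir K) * in_dir K) has_integral I1) {0..}" and
    2: "(F has_contour_integral I2) p" and
    3: "((\<lambda>x. F (pathfinish p + of_real x * out_dir K) * out_dir K) has_integral I3) {0..}" and
    I: "I = - I1 + I2 + I3"
    using assms(2) unfolding has_infinite_contour_integral_def by blast
  define J1 where "J1 = (\<lambda>R. integral {0..R} (\<lambda>x. F (pathstart p + of_real x * in_dir K) * in_dir K))"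
  define J3 where "J3 = (\<lambda>R. integral {0..R} (\<lambda>x. F (pathfinish p + of_real x * out_dir K) * out_dir K))"
  have "((\<lambda>R. - J1 R + (I2 + J3 R)) \<longlongrightarrow> - I1 + (I2 + I3)) at_top"
    unfolding J1_def J3_def by (intro tendsto_intros has_integral_half_line_limit 1 3)
  moreover have "eventually (\<lambda>R. - J1 R + (I2 + J3 R) = contour_integral (trunc_contour K p R) F) at_top"
    using eventually_gt_at_top[of 0]
  proof eventually_elim
    case (elim R)
    have a: "(F has_contour_integral J1 R) (linepath (pathstart p) (pathstart p + of_real R * in_dir K))"
      unfolding J1_def using has_integral_half_line_limit(1)[OF 1] elim
      by (intro has_contour_integral_ray_segment integrable_integral) auto
    have b: "(F has_contour_integral J3 R) (linepath (pathfinish p) (pathfinish p + of_real R * out_dir K))"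
      unfolding J3_def using has_integral_half_line_limit(1)[OF 3] elim
      by (intro has_contour_integral_ray_segment integrable_integral) auto
    have "(F has_contour_integral (- J1 R + (I2 + J3 R))) (trunc_contour K p R)"
      unfolding trunc_contour_def
      by (intro has_contour_integral_join has_contour_integral_reverse_linepath a b 2 assms(1) valid_path_join)
         auto
    thus ?case by (simp add: contour_integral_unique)
  qed
  ultimately have "((\<lambda>R. contour_integral (trunc_contour K p R) F) \<longlongrightarrow> - I1 + (I2 + I3)) at_top"
    by (simp only: tendsto_cong)
  thus ?thesis by (simp only: I add.assoc)
qed

section \<open>Every admissible contour gives the integral over the imaginary axis\<close>

text \<open>
  The parameters of a \<open>G\<close>-function with \<open>M = 0\<close>, \<open>N = P\<close>, \<open>Q < P\<close> and positive argument.  The condition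
  \<open>a < 1\<close> puts all poles, which are the numbers \<open>1 - a + j\<close> with natural \<open>j\<close>, to the right of the imaginary axis.
\<close>
locale meijer_data =
  fixes A B :: "real list" and z :: real
  assumes length_less: "length B < length A" and z_pos: "z > 0"
    and less_1: "\<And>a. a \<in> set A \<Longrightarrow> a < 1"
begin

abbreviation "F \<equiv> gamma_quotient A B z"

definition w0 :: real where "w0 = Min ((\<lambda>a. 1 - a) ` set A)"

lemma A_nonempty: "A \<noteq> []" using length_less by auto

lemma w0_pos: "w0 > 0" and w0_le: "a \<in> set A \<Longrightarrow> w0 \<le> 1 - a"
  using A_nonempty less_1 by (auto simp: w0_def)

lemma poles_real: "w \<in> gamma_poles A \<Longrightarrow> Im w = 0 \<and> w0 \<le> Re w"
  by (erule gamma_polesE) (use w0_le in force)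

lemma slit_no_pole: "s \<in> slit_plane w0 \<Longrightarrow> s \<notin> gamma_poles A"
  using poles_real[of s] by (auto simp: slit_plane_def)

lemma F_holomorphic: "F holomorphic_on - gamma_poles A"
  by (rule gamma_quotient_holomorphic[OF z_pos])

lemma ex_primitive: "\<exists>\<Phi>. \<forall>s\<in>slit_plane w0. (\<Phi> has_field_derivative F s) (at s)"
proof -
  have hol: "F holomorphic_on slit_plane w0"
    by (rule holomorphic_on_subset[OF F_holomorphic]) (auto dest: slit_no_pole)
  show ?thesis
    by (rule holomorphic_starlike_primitive[of _ _ "{}"])
       (auto intro: holomorphic_on_imp_continuous_on hol open_slit_plane starlike_slit_plane
          holomorphic_on_imp_differentiable_at[OF hol open_slit_plane])
qed

definition \<Phi> :: "complex \<Rightarrow> complex" where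
  "\<Phi> = (SOME f. \<forall>s\<in>slit_plane w0. (f has_field_derivative F s) (at s))"

lemma \<Phi>: "s \<in> slit_plane w0 \<Longrightarrow> (\<Phi> has_field_derivative F s) (at s)"
  using someI_ex[OF ex_primitive] unfolding \<Phi>_def by blast

lemma \<Phi>_vertical:
  assumes "Complex x (\<sigma> * y) \<in> slit_plane w0"
  shows "((\<lambda>y. \<Phi> (Complex x (\<sigma> * y))) has_vector_derivative \<i> * of_real \<sigma> * F (Complex x (\<sigma> * y))) (at y)"
proof -
  have "((\<lambda>y. Complex x (\<sigma> * y)) has_vector_derivative \<i> * of_real \<sigma>) (at y)"
    unfolding Complex_eq by (auto intro!: derivative_eq_intros)
  from field_vector_diff_chain_at[OF this \<Phi>[OF assms]] show ?thesis by (simp add: o_def)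
qed

lemma axis_slit: "Complex 0 y \<in> slit_plane w0"
  using w0_pos by (auto simp: slit_plane_def)

lemma axis_continuous: "continuous_on S (\<lambda>y. F (Complex 0 y))"
  by (intro gamma_quotient_continuous z_pos slit_no_pole axis_slit)
     (auto intro!: continuous_intros simp: Complex_eq)

lemma axis_integrable: "integrable lborel (\<lambda>y. F (Complex 0 y))"
proof -
  obtain C where C: "C > 0" "\<And>y. cmod (F (Complex 0 y)) \<le> C / (1 + y ^ 2)"
    by (rule gamma_quotient_axis_bound[OF length_less z_pos less_1]) (assumption, rule that)
  have "integrable lborel (\<lambda>y::real. C * inverse (1 + y\<^sup>2))"
    using integrable_inverse_1_plus_square by (simp add: set_integrable_def einterval_def)
  thus ?thesis
  proof (rule Bochner_Integration.integrable_bound)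
    show "(\<lambda>y. F (Complex 0 y)) \<in> borel_measurable lborel"
      using axis_continuous[of UNIV] by (simp add: borel_measurable_continuous_onI)
    show "AE y in lborel. cmod (F (Complex 0 y)) \<le> norm (C * inverse (1 + y\<^sup>2))"
      using C by (intro AE_I2) (simp add: divide_inverse abs_mult)
  qed
qed

lemma axis_integrable_on: "S \<in> sets borel \<Longrightarrow> (\<lambda>y. F (Complex 0 y)) integrable_on S"
  using set_borel_integral_eq_integral(1)[of S "\<lambda>y. F (Complex 0 y)"] axis_integrable
  by (simp add: set_integrable_def integrable_mult_indicator)

text \<open>The common value of the contour integrals.\<close>
definition V :: complex where "V = \<i> * integral UNIV (\<lambda>y. F (Complex 0 y))"

lemma \<Phi>_axis_integral:
  assumes "a \<le> b"
  shows "\<i> * integral {a..b} (\<lambda>y. F (Complex 0 y)) = \<Phi> (Complex 0 b) - \<Phi> (Complex 0 a)"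
proof -
  have "((\<lambda>y. \<i> * F (Complex 0 y)) has_integral (\<Phi> (Complex 0 b) - \<Phi> (Complex 0 a))) {a..b}"
    using \<Phi>_vertical[of 0 1, OF axis_slit] assms
    by (intro fundamental_theorem_of_calculus) (auto intro: has_vector_derivative_at_within)
  thus ?thesis by (simp add: integral_unique flip: integral_mult_right)
qed

text \<open>The decay in strips makes the limit of \<open>\<Phi>\<close> along vertical lines independent of the line.\<close>
lemma \<Phi>_horizontal:
  assumes "\<sigma> = 1 \<or> \<sigma> = -1"
  shows "((\<lambda>T. \<Phi> (Complex x (\<sigma> * T)) - \<Phi> (Complex 0 (\<sigma> * T))) \<longlongrightarrow> 0) at_top"
proof -
  obtain C \<rho> where C: "C > 0" "\<rho> \<ge> 1"
    "\<And>x' y. x' \<in> {min 0 x..max 0 x} \<Longrightarrow> \<bar>y\<bar> \<ge> \<rho> \<Longrightarrow> cmod (F (Complex x' y)) \<le> C / y ^ 2"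
    by (rule gamma_quotient_strip_bound[OF length_less z_pos, of "min 0 x" "max 0 x"]) (rule that)
  show ?thesis
  proof (rule Lim_null_comparison)
    show "eventually (\<lambda>T. cmod (\<Phi> (Complex x (\<sigma> * T)) - \<Phi> (Complex 0 (\<sigma> * T))) \<le> C / T\<^sup>2 * \<bar>x\<bar>) at_top"
      using eventually_ge_at_top[of \<rho>]
    proof eventually_elim
      case (elim T)
      define y where "y = \<sigma> * T"
      have y: "\<bar>y\<bar> \<ge> \<rho>" "y\<^sup>2 = T\<^sup>2" "y \<noteq> 0"
        using elim C(2) assms by (auto simp: y_def power2_eq_square)
      define S where "S = closed_segment (Complex 0 y) (Complex x y)"
      have S: "Im s = y \<and> Re s \<in> {min 0 x..max 0 x}" if "s \<in> S" for s
        using that unfolding S_def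
        by (subst (asm) closed_segment_same_Im) (auto simp: complex_eq_iff closed_segment_eq_real_ivl split: if_splits)
      have "cmod (\<Phi> (Complex x y) - \<Phi> (Complex 0 y)) \<le> C / y\<^sup>2 * cmod (Complex x y - Complex 0 y)"
      proof (rule field_differentiable_bound)
        show "convex S" by (simp add: S_def)
        fix s assume s: "s \<in> S"
        have "s \<in> slit_plane w0" using S[OF s] y by (auto simp: slit_plane_def complex_eq_iff)
        thus "(\<Phi> has_field_derivative F s) (at s within S)"
          by (rule has_field_derivative_at_within[OF \<Phi>])
        show "cmod (F s) \<le> C / y\<^sup>2"
          using C(3)[of "Re s" "Im s", unfolded complex_surj] S[OF s] y by simp
      qed (auto simp: S_def)
      also have "cmod (Complex x y - Complex 0 y) = \<bar>x\<bar>" by (simp add: cmod_def)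
      finally show ?case using y(2) by (simp add: y_def)
    qed
    show "((\<lambda>T. C / T\<^sup>2 * \<bar>x\<bar>) \<longlongrightarrow> 0) at_top" by real_asymp
  qed
qed

lemma \<Phi>_limits:
  obtains L where "L 1 - L (-1) = V"
    "\<And>x \<sigma>. \<sigma> = 1 \<or> \<sigma> = -1 \<Longrightarrow> ((\<lambda>T. \<Phi> (Complex x (\<sigma> * T))) \<longlongrightarrow> L \<sigma>) at_top"
proof -
  define Lp where "Lp = \<Phi> (Complex 0 0) + \<i> * integral {0..} (\<lambda>y. F (Complex 0 y))"
  define L where "L = (\<lambda>\<sigma>::real. if \<sigma> = 1 then Lp else Lp - V)"
  have p: "((\<lambda>T. \<Phi> (Complex 0 T)) \<longlongrightarrow> Lp) at_top"
  proof -
    have "((\<lambda>T. \<Phi> (Complex 0 0) + \<i> * integral {0..T} (\<lambda>y. F (Complex 0 y))) \<longlongrightarrow> Lp) at_top"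
      unfolding Lp_def
      by (intro tendsto_intros has_integral_half_line_limit integrable_integral axis_integrable_on) auto
    moreover have "eventually (\<lambda>T. \<Phi> (Complex 0 0) + \<i> * integral {0..T} (\<lambda>y. F (Complex 0 y)) = \<Phi> (Complex 0 T)) at_top"
      using eventually_ge_at_top[of 0] by eventually_elim (simp add: \<Phi>_axis_integral)
    ultimately show ?thesis by (simp add: tendsto_cong)
  qed
  have m: "((\<lambda>T. \<Phi> (Complex 0 (-T))) \<longlongrightarrow> Lp - V) at_top"
  proof -
    have "((\<lambda>T. \<Phi> (Complex 0 T) - \<i> * integral {-T..T} (\<lambda>y. F (Complex 0 y))) \<longlongrightarrow> Lp - V) at_top"
      unfolding V_def
      by (intro tendsto_intros p has_integral_real_line_limit integrable_integral axis_integrable_on) auto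
    moreover have "eventually (\<lambda>T. \<Phi> (Complex 0 T) - \<i> * integral {-T..T} (\<lambda>y. F (Complex 0 y)) = \<Phi> (Complex 0 (-T))) at_top"
      using eventually_ge_at_top[of 0] by eventually_elim (simp add: \<Phi>_axis_integral)
    ultimately show ?thesis by (simp add: tendsto_cong)
  qed
  show ?thesis
  proof (rule that[of L])
    show "L 1 - L (-1) = V" by (simp add: L_def)
    fix x \<sigma> :: real assume \<sigma>: "\<sigma> = 1 \<or> \<sigma> = -1"
    have "((\<lambda>T. \<Phi> (Complex 0 (\<sigma> * T))) \<longlongrightarrow> L \<sigma>) at_top"
      using \<sigma> p m by (auto simp: L_def)
    from tendsto_add[OF \<Phi>_horizontal[OF \<sigma>, of x] this]
    show "((\<lambda>T. \<Phi> (Complex x (\<sigma> * T))) \<longlongrightarrow> L \<sigma>) at_top" by simp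
  qed
qed

text \<open>
  Moving to the right at a fixed nonzero height leads to the same limit as moving up (or down): the two differ by
  the integral over a vertical ray at \<open>x + N\<close>, which is \<open>O(2\<^sup>-\<^sup>N)\<close>.
\<close>
lemma \<Phi>_right_limit:
  assumes L: "\<And>x. ((\<lambda>T. \<Phi> (Complex x (\<sigma> * T))) \<longlongrightarrow> L) at_top"
    and \<sigma>: "\<sigma> = 1 \<or> \<sigma> = -1" and \<phi>: "\<phi> > 0"
  shows "(\<lambda>N. \<Phi> (Complex (x + real N) (\<sigma> * \<phi>))) \<longlonglongrightarrow> L"
proof -
  obtain C N0 where C: "C > 0"
    "\<And>y N. N \<ge> N0 \<Longrightarrow> \<bar>y\<bar> \<ge> \<phi> \<Longrightarrow> cmod (F (Complex (x + real N) y)) \<le> C * (1 / 2) ^ N / y ^ 2"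
    by (rule gamma_quotient_right_bound[OF length_less z_pos \<phi>, of x]) (rule that)
  have "cmod (L - \<Phi> (Complex (x + real N) (\<sigma> * \<phi>))) \<le> C * (1 / 2) ^ N / \<phi>" if N: "N \<ge> N0" for N
  proof (rule Lim_norm_ubound)
    show "((\<lambda>T. \<Phi> (Complex (x + real N) (\<sigma> * T)) - \<Phi> (Complex (x + real N) (\<sigma> * \<phi>))) \<longlongrightarrow>
             L - \<Phi> (Complex (x + real N) (\<sigma> * \<phi>))) at_top"
      by (intro tendsto_intros L)
    show "eventually (\<lambda>T. cmod (\<Phi> (Complex (x + real N) (\<sigma> * T)) - \<Phi> (Complex (x + real N) (\<sigma> * \<phi>)))
             \<le> C * (1 / 2) ^ N / \<phi>) at_top"
      using eventually_gt_at_top[of \<phi>]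
    proof eventually_elim
      case (elim T)
      define e where "e = C * (1 / 2) ^ N"
      have e: "e > 0" using C by (simp add: e_def)
      have slit: "Complex (x + real N) (\<sigma> * y) \<in> slit_plane w0" if "y \<ge> \<phi>" for y
        using that \<phi> \<sigma> by (auto simp: slit_plane_def)
      \<comment> \<open>Mean value inequality with the antiderivative \<open>- e / y\<close> of the bound \<open>e / y\<^sup>2\<close>.\<close>
      have "cmod (\<Phi> (Complex (x + real N) (\<sigma> * T)) - \<Phi> (Complex (x + real N) (\<sigma> * \<phi>))) \<le> (- e / T) - (- e / \<phi>)"
      proof (rule differentiable_bound_general[OF elim])
        show "continuous_on {\<phi>..T} (\<lambda>a. - e / a)" using \<phi> by (auto intro!: continuous_intros)
        show "continuous_on {\<phi>..T} (\<lambda>y. \<Phi> (Complex (x + real N) (\<sigma> * y)))"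
          by (intro continuous_at_imp_continuous_on ballI has_vector_derivative_continuous[OF \<Phi>_vertical] slit) auto
        fix y assume y: "\<phi> < y" "y < T"
        show "((\<lambda>y. \<Phi> (Complex (x + real N) (\<sigma> * y))) has_vector_derivative \<i> * of_real \<sigma> * F (Complex (x + real N) (\<sigma> * y))) (at y)"
          using y by (intro \<Phi>_vertical slit) auto
        show "((\<lambda>a. - e / a) has_vector_derivative e / y\<^sup>2) (at y)"
          using y \<phi> unfolding has_real_derivative_iff_has_vector_derivative[symmetric]
          by (auto intro!: derivative_eq_intros simp: power2_eq_square)
        have "cmod (F (Complex (x + real N) (\<sigma> * y))) \<le> C * (1 / 2) ^ N / (\<sigma> * y)\<^sup>2"
          using y \<phi> \<sigma> by (intro C(2) N) auto
        thus "cmod (\<i> * of_real \<sigma> * F (Complex (x + real N) (\<sigma> * y))) \<le> e / y\<^sup>2"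
          using \<sigma> by (auto simp: norm_mult e_def)
      qed
      also have "\<dots> \<le> e / \<phi>" using e elim \<phi> by simp
      finally show ?case by (simp add: e_def)
    qed
  qed auto
  hence "eventually (\<lambda>N. cmod (\<Phi> (Complex (x + real N) (\<sigma> * \<phi>)) - L) \<le> C * (1 / 2) ^ N / \<phi>) sequentially"
    by (intro eventually_mono[OF eventually_ge_at_top[of N0]]) (simp add: norm_minus_commute)
  moreover have "(\<lambda>N. C * (1 / 2) ^ N / \<phi>) \<longlonglongrightarrow> C * 0 / \<phi>"
    using \<phi> by (intro tendsto_intros LIMSEQ_power_zero) auto
  hence "(\<lambda>N. C * (1 / 2) ^ N / \<phi>) \<longlonglongrightarrow> 0" by simp
  ultimately have "(\<lambda>N. \<Phi> (Complex (x + real N) (\<sigma> * \<phi>)) - L) \<longlonglongrightarrow> 0"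
    by (rule Lim_null_comparison)
  thus ?thesis by (simp add: LIM_zero_iff)
qed

text \<open>
  A pole beyond the finite part of the contour has index \<open>-1\<close> only if the two rays pass it on opposite sides.
  If both were on the same side, the whole contour would lie in the plane slit at that pole, where the argument
  changes by less than \<open>\<pi>\<close>.
\<close>
lemma right_loop_ends:
  assumes p: "infinite_contour Right_Loop p"
    and idx: "\<And>w. w \<in> gamma_poles A \<Longrightarrow> has_contour_index Right_Loop p w (-1)"
  shows "Im (pathstart p) < 0" "Im (pathfinish p) > 0"
proof -
  have vp: "valid_path p" and lt: "Im (pathstart p) < Im (pathfinish p)"
    using p by (auto simp: infinite_contour_def)
  obtain b where b: "\<And>s. s \<in> path_image p \<Longrightarrow> cmod s \<le> b"
    using compact_imp_bounded[OF compact_valid_path_image[OF vp]] by (auto simp: bounded_iff)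
  obtain a where a: "a \<in> set A" using A_nonempty by (cases A) auto
  define n where "n = nat \<lceil>b + a\<rceil>"
  define v where "v = 1 - a + real n"
  have vb: "v > b" unfolding v_def n_def by linarith
  have v: "of_real v \<in> gamma_poles A"
    using a by (auto simp: gamma_poles_def v_def intro!: bexI[of _ a])
  have pb: "Re s < v" if "s \<in> path_image p" for s
    using b[OF that] vb complex_Re_le_cmod[of s] by linarith
  have avoid: "of_real v \<notin> path_image (trunc_contour Right_Loop p R)" if "R > 0" for R
    using idx[OF v] that by (auto simp: has_contour_index_def)
  have start: "Im (pathstart p) \<noteq> 0"
  proof
    assume "Im (pathstart p) = 0"
    hence "in_end Right_Loop p (v - Re (pathstart p)) = of_real v"
      by (simp add: in_end_def complex_eq_iff)
    moreover have "in_end Right_Loop p (v - Re (pathstart p)) \<in> path_image (trunc_contour Right_Loop p (v - Re (pathstart p)))"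
      by (simp add: path_image_trunc_contour)
    ultimately show False using avoid[of "v - Re (pathstart p)"] pb[of "pathstart p"] by auto
  qed
  have fin: "Im (pathfinish p) \<noteq> 0"
  proof
    assume "Im (pathfinish p) = 0"
    hence "out_end Right_Loop p (v - Re (pathfinish p)) = of_real v"
      by (simp add: out_end_def complex_eq_iff)
    moreover have "out_end Right_Loop p (v - Re (pathfinish p)) \<in> path_image (trunc_contour Right_Loop p (v - Re (pathfinish p)))"
      by (simp add: path_image_trunc_contour)
    ultimately show False using avoid[of "v - Re (pathfinish p)"] pb[of "pathfinish p"] by auto
  qed
  have "\<not> (Im (pathstart p) > 0 \<or> Im (pathfinish p) < 0)"
  proof
    assume same: "Im (pathstart p) > 0 \<or> Im (pathfinish p) < 0"
    have "Re (winding_number (trunc_contour Right_Loop p R) (of_real v)) > - (1 / 2)" if "R > 0" for R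
    proof -
      have "path_image (trunc_contour Right_Loop p R) \<subseteq> slit_plane v"
        using pb start fin unfolding path_image_trunc_contour
        by (auto simp: slit_plane_def in_end_def out_end_def closed_segment_same_Im)
      hence re: "Re (winding_number (trunc_contour Right_Loop p R) (of_real v)) =
        (Im (Ln (of_real v - out_end Right_Loop p R)) - Im (Ln (of_real v - in_end Right_Loop p R))) / (2 * pi)"
        using vp by (subst winding_number_in_slit_plane) (auto simp: Re_sweep intro: valid_path_trunc_contour)
      have "\<bar>Im (Ln (of_real v - out_end Right_Loop p R)) - Im (Ln (of_real v - in_end Right_Loop p R))\<bar> < pi"
        using same
      proof
        assume "Im (pathstart p) > 0"
        hence "Im (in_end Right_Loop p R) > 0" "Im (out_end Right_Loop p R) > 0"
          using lt by (auto simp: in_end_def out_end_def)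
        from Im_Ln_above[OF this(1), of v] Im_Ln_above[OF this(2), of v] show ?thesis by auto
      next
        assume "Im (pathfinish p) < 0"
        hence "Im (in_end Right_Loop p R) < 0" "Im (out_end Right_Loop p R) < 0"
          using lt by (auto simp: in_end_def out_end_def)
        from Im_Ln_below[OF this(1), of v] Im_Ln_below[OF this(2), of v] show ?thesis by auto
      qed
      thus ?thesis unfolding re by (simp add: field_simps abs_less_iff)
    qed
    hence "eventually (\<lambda>R. - (1 / 2) \<le> Re (winding_number (trunc_contour Right_Loop p R) (of_real v))) at_top"
      by (intro eventually_mono[OF eventually_gt_at_top[of "0::real"]] less_imp_le)
    moreover have "((\<lambda>R. Re (winding_number (trunc_contour Right_Loop p R) (of_real v))) \<longlongrightarrow> -1) at_top"
      using idx[OF v] by (simp add: has_contour_index_def)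
    ultimately have "- (1 / 2) \<le> (-1 :: real)"
      by (intro tendsto_lowerbound[of _ "-1::real"]) auto
    thus False by simp
  qed
  thus "Im (pathstart p) < 0" "Im (pathfinish p) > 0" using start fin by auto
qed

lemma contour_value_Vertical:
  assumes p: "infinite_contour Vertical p"
    and idx: "\<And>w. w \<in> gamma_poles A \<Longrightarrow> right_of_contour Vertical p w"
    and I: "has_infinite_contour_integral F I Vertical p"
  shows "I = V"
proof -
  have vp: "valid_path p" using p by (auto simp: infinite_contour_def)
  obtain L where L: "L 1 - L (-1) = V"
    "\<And>x \<sigma>. \<sigma> = 1 \<or> \<sigma> = -1 \<Longrightarrow> ((\<lambda>T. \<Phi> (Complex x (\<sigma> * T))) \<longlongrightarrow> L \<sigma>) at_top"
    by (rule \<Phi>_limits) (rule that)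
  define R0 where "R0 = 1 + \<bar>Im (pathstart p)\<bar> + \<bar>Im (pathfinish p)\<bar>"
  have ends: "in_end Vertical p R = Complex (Re (pathstart p)) ((-1) * (R + - Im (pathstart p)))"
    "out_end Vertical p R = Complex (Re (pathfinish p)) (1 * (R + Im (pathfinish p)))" for R
    by (auto simp: in_end_def out_end_def complex_eq_iff)
  have sh: "filterlim (\<lambda>R. R + c) at_top at_top" for c :: real by real_asymp
  have "((\<lambda>R. \<Phi> (out_end Vertical p R) - \<Phi> (in_end Vertical p R)) \<longlongrightarrow> L 1 - L (-1)) at_top"
    unfolding ends by (intro tendsto_diff filterlim_compose[OF L(2) sh]) auto
  moreover have "eventually (\<lambda>R. \<Phi> (out_end Vertical p R) - \<Phi> (in_end Vertical p R) = contour_integral (trunc_contour Vertical p R) F) at_top"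
    using eventually_ge_at_top[of R0]
  proof eventually_elim
    case (elim R)
    show ?case
    proof (rule sym, rule contour_integral_trunc_contour_primitive[OF vp F_holomorphic closed_gamma_poles poles_real w0_pos \<Phi>])
      show "has_contour_index Vertical p w (-1/2)" if "w \<in> gamma_poles A" for w
        using idx[OF that] by (simp add: right_of_contour_def)
      show "R0 > 0" by (simp add: R0_def)
      show "Im (in_end Vertical p R) < 0 \<and> 0 < Im (out_end Vertical p R)" if "R \<ge> R0" for R
        using that by (auto simp: ends R0_def)
    qed (use elim in auto)
  qed
  ultimately have "((\<lambda>R. contour_integral (trunc_contour Vertical p R) F) \<longlongrightarrow> V) at_top"
    using L(1) by (simp add: tendsto_cong)
  moreover have "((\<lambda>R. contour_integral (trunc_contour Vertical p R) F) \<longlongrightarrow> I) at_top"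
    by (rule contour_integral_trunc_contour_limit[OF vp I])
  ultimately show "I = V" by (rule tendsto_unique[OF trivial_limit_at_top_linorder, symmetric])
qed

text \<open>
  The truncation length runs through the integers only, so that both ends move by unit steps and the decay under
  \<open>s \<mapsto> s + 1\<close> applies.
\<close>
lemma contour_value_Right_Loop:
  assumes p: "infinite_contour Right_Loop p"
    and idx: "\<And>w. w \<in> gamma_poles A \<Longrightarrow> right_of_contour Right_Loop p w"
    and I: "has_infinite_contour_integral F I Right_Loop p"
  shows "I = V"
proof -
  have vp: "valid_path p" using p by (auto simp: infinite_contour_def)
  have idx': "has_contour_index Right_Loop p w (-1)" if "w \<in> gamma_poles A" for w
    using idx[OF that] by (simp add: right_of_contour_def)
  note im = right_loop_ends[OF p idx']
  obtain L where L: "L 1 - L (-1) = V"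
    "\<And>x \<sigma>. \<sigma> = 1 \<or> \<sigma> = -1 \<Longrightarrow> ((\<lambda>T. \<Phi> (Complex x (\<sigma> * T))) \<longlongrightarrow> L \<sigma>) at_top"
    by (rule \<Phi>_limits) (rule that)
  have ends: "in_end Right_Loop p R = Complex (Re (pathstart p) + R) ((-1) * (- Im (pathstart p)))"
    "out_end Right_Loop p R = Complex (Re (pathfinish p) + R) (1 * Im (pathfinish p))" for R
    by (auto simp: in_end_def out_end_def complex_eq_iff)
  have "(\<lambda>N. \<Phi> (out_end Right_Loop p (real N)) - \<Phi> (in_end Right_Loop p (real N))) \<longlonglongrightarrow> L 1 - L (-1)"
    unfolding ends using im by (intro tendsto_diff \<Phi>_right_limit L(2)) auto
  moreover have "eventually (\<lambda>N. \<Phi> (out_end Right_Loop p (real N)) - \<Phi> (in_end Right_Loop p (real N)) = contour_integral (trunc_contour Right_Loop p (real N)) F) sequentially"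
    using eventually_ge_at_top[of 1]
  proof eventually_elim
    case (elim N)
    show ?case
    proof (rule sym, rule contour_integral_trunc_contour_primitive[OF vp F_holomorphic closed_gamma_poles poles_real w0_pos \<Phi> idx'])
      have "eventually (\<lambda>R. Re w < Re (pathstart p) + R) at_top" for w
        by (rule eventually_mono[OF eventually_gt_at_top[of "Re w - Re (pathstart p)"]]) auto
      thus "-1 = (-1/2 :: real) \<or> (-1::real) = -1 \<and> (\<forall>w\<in>gamma_poles A. eventually (\<lambda>R. Re w < Re (in_end Right_Loop p R)) at_top)"
        by (simp add: ends)
      show "1 > (0::real)" by simp
      show "Im (in_end Right_Loop p R) < 0 \<and> 0 < Im (out_end Right_Loop p R)" if "R \<ge> 1" for R
        using im by (auto simp: ends)
    qed (use elim in auto)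
  qed
  ultimately have "(\<lambda>N. contour_integral (trunc_contour Right_Loop p (real N)) F) \<longlonglongrightarrow> V"
    using L(1) by (simp add: tendsto_cong)
  moreover have "(\<lambda>N. contour_integral (trunc_contour Right_Loop p (real N)) F) \<longlonglongrightarrow> I"
    by (rule filterlim_compose[OF contour_integral_trunc_contour_limit[OF vp I] filterlim_real_sequentially])
  ultimately show "I = V" by (rule LIMSEQ_unique[symmetric])
qed

end

section \<open>Loops to the left diverge; the imaginary axis is admissible\<close>

lemma gamma_quotient_nonzero:
  assumes "z > 0" "\<And>a. a \<in> set A \<union> set B \<Longrightarrow> a + Re s < 1"
  shows "gamma_quotient A B z s \<noteq> 0"
proof -
  have np: "1 - of_real a - s \<notin> \<int>\<^sub>\<le>\<^sub>0" if "a \<in> set A \<union> set B" for a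
    using assms(2)[OF that] by (auto elim!: nonpos_Ints_cases' simp: complex_eq_iff)
  have "(\<Prod>a\<leftarrow>A. Gamma (1 - of_real a - s)) \<noteq> 0"
    using np by (auto simp: prod_list_zero_iff Gamma_eq_zero_iff)
  moreover have "(\<Prod>b\<leftarrow>B. rGamma (1 - of_real b - s)) \<noteq> 0"
    using np by (auto simp: prod_list_zero_iff rGamma_eq_zero_iff)
  ultimately show ?thesis using assms(1) by (simp add: gamma_quotient_def)
qed

text \<open>
  Think of \<open>T\<close> as the tail of a convergent integral of \<open>g\<close>, where \<open>g(x) = h(x) g(x + 1)\<close> and \<open>h\<close> tends to 0
  regularly, so that \<open>g\<close> grows.  Integration by parts expresses \<open>T(x)\<close> through \<open>T(x + 1)\<close> and later tails with
  small coefficients, so the supremum of \<open>\<bar>T\<bar>\<close> over a late half-line is at most half of itself and vanishes.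
\<close>
lemma shift_tail_vanishes:
  fixes T g h h' :: "real \<Rightarrow> complex"
  assumes T: "\<And>x. x > X0 \<Longrightarrow> (T has_vector_derivative - g x) (at x)"
    and lim: "(T \<longlongrightarrow> 0) at_top"
    and g: "\<And>x. x > X0 \<Longrightarrow> g x = h x * g (x + 1)"
    and h: "\<And>x. x > X0 \<Longrightarrow> (h has_vector_derivative h' x) (at x)"
    and bd: "\<And>x. x > X0 \<Longrightarrow> cmod (h x) \<le> C / (x - X0)" "\<And>x. x > X0 \<Longrightarrow> cmod (h' x) \<le> C / (x - X0)\<^sup>2"
    and C: "C > 0"
  shows "eventually (\<lambda>x. T x = 0) at_top"
proof -
  have "eventually (\<lambda>x. cmod (T x) \<le> 1) at_top"
    using tendstoD[OF lim zero_less_one] by eventually_elim simp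
  then obtain X2 where X2: "\<And>x. x \<ge> X2 \<Longrightarrow> cmod (T x) \<le> 1" by (auto simp: eventually_at_top_linorder)
  define X1 where "X1 = max X2 (X0 + 4 * C)"
  have X1: "X1 \<ge> X2" "X1 \<ge> X0 + 4 * C" "X1 > X0" using C by (auto simp: X1_def)
  \<comment> \<open>The boundary term is subtracted, so that the derivative of \<open>W\<close> contains only \<open>h'\<close>, which is integrable.\<close>
  define W where "W = (\<lambda>x. T x - h x * T (x + 1))"
  have W': "(W has_vector_derivative - (h' x * T (x + 1))) (at x)" if "x > X0" for x
  proof -
    have "((\<lambda>x. T (x + 1)) has_vector_derivative 1 *\<^sub>R (- g (x + 1))) (at x)"
    proof -
      have "((\<lambda>x::real. x + 1) has_vector_derivative 1 + 0) (at x)"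
        by (intro has_vector_derivative_add has_vector_derivative_id has_vector_derivative_const)
      from vector_diff_chain_at[OF this, of T "- g (x + 1)"] T[of "x + 1"] that
      show ?thesis by (simp add: o_def)
    qed
    hence "(W has_vector_derivative (- g x - (h x * (- g (x + 1)) + h' x * T (x + 1)))) (at x)"
      unfolding W_def using T[OF that] h[OF that]
      by (intro has_vector_derivative_diff has_vector_derivative_mult) auto
    thus ?thesis using g[OF that] by simp
  qed
  have h0: "(h \<longlongrightarrow> 0) at_top"
  proof (rule Lim_null_comparison)
    show "eventually (\<lambda>x. cmod (h x) \<le> C / (x - X0)) at_top"
      using eventually_gt_at_top[of X0] by eventually_elim (rule bd)
    show "((\<lambda>x. C / (x - X0)) \<longlongrightarrow> 0) at_top" by real_asymp
  qed
  have W0: "(W \<longlongrightarrow> 0) at_top"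
  proof -
    have "filterlim (\<lambda>x::real. x + 1) at_top at_top" by real_asymp
    hence "((\<lambda>x. T (x + 1)) \<longlongrightarrow> 0) at_top" using lim filterlim_compose by blast
    hence "((\<lambda>x. T x - h x * T (x + 1)) \<longlongrightarrow> 0 - 0 * 0) at_top" by (intro tendsto_intros lim h0)
    thus ?thesis by (simp add: W_def)
  qed
  have halve: "cmod (T x) \<le> S / 2" if S: "\<And>y. y \<ge> X1 \<Longrightarrow> cmod (T y) \<le> S" and x: "x \<ge> X1" for x S
  proof -
    have S0: "S \<ge> 0" using S[of X1] norm_ge_zero[of "T X1"] by linarith
    have xX: "x > X0" using x X1 by linarith
    have "cmod (0 - W x) \<le> C * S / (x - X0)"
    proof (rule Lim_norm_ubound)
      show "((\<lambda>Y. W Y - W x) \<longlongrightarrow> 0 - W x) at_top" by (intro tendsto_intros W0)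
      show "eventually (\<lambda>Y. cmod (W Y - W x) \<le> C * S / (x - X0)) at_top"
        using eventually_gt_at_top[of x]
      proof eventually_elim
        case (elim Y)
        have "cmod (W Y - W x) \<le> - (C * S) / (Y - X0) - (- (C * S) / (x - X0))"
        proof (rule differentiable_bound_general[OF elim])
          show "continuous_on {x..Y} W" using xX
            by (intro continuous_at_imp_continuous_on ballI has_vector_derivative_continuous[OF W']) auto
          show "continuous_on {x..Y} (\<lambda>a. - (C * S) / (a - X0))" using xX by (auto intro!: continuous_intros)
          fix y assume y: "x < y" "y < Y"
          show "(W has_vector_derivative - (h' y * T (y + 1))) (at y)" using y xX by (intro W') auto
          show "((\<lambda>a. - (C * S) / (a - X0)) has_vector_derivative C / (y - X0)\<^sup>2 * S) (at y)"
            using y xX unfolding has_real_derivative_iff_has_vector_derivative[symmetric]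
            by (auto intro!: derivative_eq_intros simp: power2_eq_square)
          show "cmod (- (h' y * T (y + 1))) \<le> C / (y - X0)\<^sup>2 * S"
            using y x xX C unfolding norm_minus_cancel norm_mult by (intro mult_mono bd S) auto
        qed
        also have "\<dots> \<le> C * S / (x - X0)" using xX elim C S0 by simp
        finally show ?case .
      qed
    qed auto
    hence "cmod (W x) \<le> C * S / (x - X0)" by simp
    moreover have "cmod (h x * T (x + 1)) \<le> C / (x - X0) * S"
      using xX x C unfolding norm_mult by (intro mult_mono bd S) auto
    moreover have "cmod (T x) \<le> cmod (W x) + cmod (h x * T (x + 1))"
      using norm_triangle_ineq[of "W x" "h x * T (x + 1)"] by (simp add: W_def)
    ultimately have "cmod (T x) \<le> C * S / (x - X0) + C / (x - X0) * S" by linarith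
    also have "\<dots> = 2 * C / (x - X0) * S" by simp
    finally have "cmod (T x) \<le> 2 * C / (x - X0) * S" .
    also have "2 * C / (x - X0) \<le> 1 / 2" using x X1 C xX by (subst pos_divide_le_eq) auto
    hence "2 * C / (x - X0) * S \<le> 1 / 2 * S" using S0 by (intro mult_right_mono)
    finally show ?thesis by simp
  qed
  have pow: "cmod (T x) \<le> (1 / 2) ^ n" if "x \<ge> X1" for x n
    using that
  proof (induction n arbitrary: x)
    case 0
    thus ?case using X2 X1 by simp
  next
    case (Suc n)
    from halve[OF Suc.IH Suc.prems] show ?case by simp
  qed
  have "T x = 0" if "x \<ge> X1" for x
  proof -
    have "(\<lambda>n. (1 / 2 :: real) ^ n) \<longlonglongrightarrow> 0" by (intro LIMSEQ_power_zero) auto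
    hence "cmod (T x) \<le> 0" by (rule tendsto_lowerbound) (use pow[OF that] in auto)
    thus ?thesis by simp
  qed
  thus ?thesis by (auto simp: eventually_at_top_linorder)
qed

context meijer_data begin

text \<open>
  Along a ray to the left the integrand satisfies \<open>g(x) = h(x) g(x + 1)\<close> with the shift ratio as \<open>h\<close>.
  A convergent integral would therefore have vanishing tails, although the integrand has no zeros far to the left.
\<close>
lemma left_ray_diverges:
  assumes avoid: "\<And>x. x \<ge> 0 \<Longrightarrow> a - of_real x \<notin> gamma_poles A"
  shows "\<not> ((\<lambda>x. F (a + of_real x * (-1)) * (-1)) has_integral I) {0..}"
proof
  define g where "g = (\<lambda>x. F (a - of_real x) * (-1))"
  assume "((\<lambda>x. F (a + of_real x * (-1)) * (-1)) has_integral I) {0..}"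
  hence I: "(g has_integral I) {0..}" by (simp add: g_def)
  have cont: "continuous_on {0..} g"
    unfolding g_def by (intro continuous_intros gamma_quotient_continuous z_pos avoid) auto
  define T where "T = (\<lambda>x. I - integral {0..x} g)"
  obtain C \<rho> where C: "C > 0" "\<rho> > 0"
    "\<And>s. cmod s \<ge> \<rho> \<Longrightarrow> cmod (shift_ratio A B z s) \<le> C / cmod s"
    "\<And>s. cmod s \<ge> \<rho> \<Longrightarrow> shift_ratio A B z field_differentiable at s"
    "\<And>s. cmod s \<ge> \<rho> \<Longrightarrow> cmod (deriv (shift_ratio A B z) s) \<le> C / cmod s ^ 2"
    "\<And>s a. cmod s \<ge> \<rho> \<Longrightarrow> a \<in> set A \<Longrightarrow> of_real a + s \<noteq> 0"
    by (rule shift_ratio_deriv_bound[OF length_less, of z]) (rule that)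
  define X0 where "X0 = cmod a + \<rho>"
  have X0: "X0 \<ge> 0" using C by (simp add: X0_def)
  define s where "s = (\<lambda>x::real. a - of_real x - 1)"
  have s: "cmod (s x) \<ge> \<rho>" "cmod (s x) \<ge> x - X0" if "x > X0" for x
  proof -
    have "cmod (of_real (x + 1)) - cmod a \<le> cmod (of_real (x + 1) - a)" by (rule norm_triangle_ineq2)
    also have "of_real (x + 1) - a = - s x" by (simp add: s_def)
    finally show "cmod (s x) \<ge> \<rho>" "cmod (s x) \<ge> x - X0"
      using that X0 C(2) by (auto simp: X0_def simp del: of_real_add)
  qed
  define h where "h = (\<lambda>x. shift_ratio A B z (s x))"
  have T': "(T has_vector_derivative - g x) (at x)" if "x > 0" for x
  proof -
    have "((\<lambda>u. integral {0..u} g) has_vector_derivative g x) (at x within {0..x + 1})"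
      using that by (intro integral_has_vector_derivative continuous_on_subset[OF cont]) auto
    hence "((\<lambda>u. integral {0..u} g) has_vector_derivative g x) (at x)"
      using that by (subst (asm) at_within_interior) auto
    hence "(T has_vector_derivative 0 - g x) (at x)"
      unfolding T_def by (intro has_vector_derivative_diff has_vector_derivative_const)
    thus ?thesis by simp
  qed
  have "eventually (\<lambda>x. T x = 0) at_top"
  proof (rule shift_tail_vanishes[where g = g and h = h and h' = "\<lambda>x. - deriv (shift_ratio A B z) (s x)" and ?X0.0 = X0])
    show "(T has_vector_derivative - g x) (at x)" if "x > X0" for x using T'[of x] that X0 by auto
    have "((\<lambda>x. I - integral {0..x} g) \<longlongrightarrow> I - I) at_top"
      by (intro tendsto_intros has_integral_half_line_limit I)
    thus "(T \<longlongrightarrow> 0) at_top" by (simp add: T_def)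
    show "C > 0" by fact
    fix x assume x: "x > X0"
    have "F (s x + 1) = F (s x) * shift_ratio A B z (s x)"
      using C(6)[OF s(1)[OF x]] by (intro gamma_quotient_plus_1 z_pos)
    thus "g x = h x * g (x + 1)" by (simp add: g_def h_def s_def algebra_simps)
    have "(s has_vector_derivative -1) (at x)" unfolding s_def by (auto intro!: derivative_eq_intros)
    moreover have "(shift_ratio A B z has_field_derivative deriv (shift_ratio A B z) (s x)) (at (s x))"
      using C(4)[OF s(1)[OF x]] by (simp add: DERIV_deriv_iff_field_differentiable)
    ultimately show "(h has_vector_derivative - deriv (shift_ratio A B z) (s x)) (at x)"
      unfolding h_def using field_vector_diff_chain_at by (fastforce simp: o_def)
    have pos: "x - X0 > 0" "cmod (s x) > 0" using x s[OF x] C(2) by linarith+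
    have "cmod (h x) \<le> C / cmod (s x)" unfolding h_def by (rule C(3)[OF s(1)[OF x]])
    also have "\<dots> \<le> C / (x - X0)" using pos s(2)[OF x] C(1) by (intro divide_left_mono) auto
    finally show "cmod (h x) \<le> C / (x - X0)" .
    have "cmod (- deriv (shift_ratio A B z) (s x)) \<le> C / cmod (s x) ^ 2" using C(5)[OF s(1)[OF x]] by simp
    also have "\<dots> \<le> C / (x - X0) ^ 2"
      using pos s(2)[OF x] C(1) by (intro divide_left_mono power_mono mult_pos_pos zero_less_power) auto
    finally show "cmod (- deriv (shift_ratio A B z) (s x)) \<le> C / (x - X0) ^ 2" .
  qed
  then obtain X where X: "\<And>x. x \<ge> X \<Longrightarrow> T x = 0" by (auto simp: eventually_at_top_linorder)
  define x where "x = 1 + \<bar>X\<bar> + \<bar>Re a\<bar> + (\<Sum>a\<in>set A \<union> set B. \<bar>a\<bar>)"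
  have sn: "(\<Sum>a\<in>set A \<union> set B. \<bar>a\<bar>) \<ge> 0" by (intro sum_nonneg) auto
  have x: "x > 0" "x > X" unfolding x_def using sn by linarith+
  have "((\<lambda>_. 0) has_vector_derivative - g x) (at x)"
    by (rule has_vector_derivative_transform_within_open[OF T'[OF x(1)], of "{X<..}"]) (use x X in auto)
  hence "g x = 0" using vector_derivative_unique_at[of "\<lambda>_. 0" "- g x" x 0] by auto
  hence "F (a - of_real x) = 0" by (simp add: g_def)
  moreover have "F (a - of_real x) \<noteq> 0"
  proof (rule gamma_quotient_nonzero[OF z_pos])
    fix b assume "b \<in> set A \<union> set B"
    hence "\<bar>b\<bar> \<le> (\<Sum>a\<in>set A \<union> set B. \<bar>a\<bar>)" by (intro member_le_sum) auto
    thus "b + Re (a - of_real x) < 1" unfolding x_def by (auto simp: abs_if split: if_splits)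
  qed
  ultimately show False by simp
qed

lemma contour_value_unique:
  assumes p: "infinite_contour K p"
    and idx: "\<And>w. w \<in> gamma_poles A \<Longrightarrow> right_of_contour K p w"
    and I: "has_infinite_contour_integral F I K p"
  shows "I = V"
proof (cases K)
  case Left_Loop
  obtain I1 where I1: "((\<lambda>x. F (pathstart p + of_real x * (-1)) * (-1)) has_integral I1) {0..}"
    using I by (auto simp: has_infinite_contour_integral_def Left_Loop)
  have "pathstart p - of_real x \<notin> gamma_poles A" if "x \<ge> 0" for x
  proof
    assume w: "pathstart p - of_real x \<in> gamma_poles A"
    have "in_end K p x \<in> path_image (trunc_contour K p (x + 1))"
      using in_ray_segment(1)[of x "x + 1" K p] that by (auto simp: path_image_trunc_contour)
    hence "pathstart p - of_real x \<in> path_image (trunc_contour K p (x + 1))"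
      by (simp add: in_end_def Left_Loop)
    moreover have "x + 1 > 0" using that by simp
    ultimately show False using idx[OF w] by (auto simp: right_of_contour_def has_contour_index_def)
  qed
  with left_ray_diverges I1 show ?thesis by blast
next
  case Right_Loop
  with assms contour_value_Right_Loop show ?thesis by blast
next
  case Vertical
  with assms contour_value_Vertical show ?thesis by blast
qed

definition axis_path :: "real \<Rightarrow> complex" where
  "axis_path = linepath (Complex 0 (-1)) (Complex 0 1)"

lemma closed_segment_axis:
  "a \<le> b \<Longrightarrow> closed_segment (Complex 0 a) (Complex 0 b) = {s. Re s = 0 \<and> a \<le> Im s \<and> Im s \<le> b}"
  by (subst closed_segment_same_Re) (auto simp: closed_segment_eq_real_ivl)

lemma axis_ends:
  "in_end Vertical axis_path R = Complex 0 (- 1 - R)"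
  "out_end Vertical axis_path R = Complex 0 (1 + R)"
  by (simp_all add: in_end_def out_end_def axis_path_def complex_eq_iff)

lemma axis_trunc_image: "R > 0 \<Longrightarrow> path_image (trunc_contour Vertical axis_path R) \<subseteq> {s. Re s = 0}"
  unfolding path_image_trunc_contour axis_ends by (simp add: axis_path_def closed_segment_axis) auto

lemma axis_contour: "infinite_contour Vertical axis_path"
proof -
  have "arc (trunc_contour Vertical axis_path R)" if R: "R > 0" for R
  proof -
    have eq: "trunc_contour Vertical axis_path R =
       linepath (Complex 0 (-1 - R)) (Complex 0 (-1)) +++ linepath (Complex 0 (-1)) (Complex 0 1) +++
       linepath (Complex 0 1) (Complex 0 (1 + R))"
      unfolding trunc_contour_def in_end_def[symmetric] out_end_def[symmetric] axis_ends
      by (simp add: axis_path_def)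
    show ?thesis unfolding eq using R
      by (intro arc_join arc_linepath)
         (auto simp: path_image_join closed_segment_axis complex_eq_iff)
  qed
  thus ?thesis by (auto simp: infinite_contour_def axis_path_def)
qed

text \<open>Seen from a point on the right, the argument along a long piece of the imaginary axis changes by nearly \<open>-\<pi>\<close>.\<close>
lemma axis_right_of:
  assumes w: "w \<in> gamma_poles A"
  shows "right_of_contour Vertical axis_path w"
proof -
  define v where "v = Re w"
  have v: "w = of_real v" "v > 0" using poles_real[OF w] w0_pos by (auto simp: v_def complex_eq_iff)
  have av: "w \<notin> path_image (trunc_contour Vertical axis_path R)" if "R > 0" for R
    using axis_trunc_image[OF that] v by auto
  have "eventually (\<lambda>R. (arctan (- (1 + R) / v) - arctan ((1 + R) / v)) / (2 * pi) =
          Re (winding_number (trunc_contour Vertical axis_path R) w)) at_top"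
    using eventually_gt_at_top[of 0]
  proof eventually_elim
    case (elim R)
    have "Im (Ln (Complex v y)) = arctan (y / v)" for y
      using arg_conv_arctan[of "Complex v y"] v by (subst Arg_eq_Im_Ln[symmetric]) (auto simp: complex_eq_iff)
    moreover have "of_real v - Complex 0 y = Complex v (- y)" for y by (simp add: complex_eq_iff)
    moreover have "valid_path (trunc_contour Vertical axis_path R)"
      using axis_contour by (auto simp: infinite_contour_def intro: valid_path_trunc_contour)
    moreover have "path_image (trunc_contour Vertical axis_path R) \<subseteq> slit_plane v"
      using axis_trunc_image[OF elim] v by (auto simp: slit_plane_def)
    ultimately show ?case unfolding v(1)
      by (subst winding_number_in_slit_plane) (auto simp: Re_sweep axis_ends add.commute)
  qed
  moreover have "((\<lambda>R. (arctan (- (1 + R) / v) - arctan ((1 + R) / v)) / (2 * pi)) \<longlongrightarrow> (- (pi / 2) - pi / 2) / (2 * pi)) at_top"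
  proof -
    have "filterlim (\<lambda>R. - (1 + R) / v) at_bot at_top" "filterlim (\<lambda>R. (1 + R) / v) at_top at_top"
      using v by real_asymp+
    thus ?thesis
      by (intro tendsto_intros filterlim_compose[OF tendsto_arctan_at_top] filterlim_compose[OF tendsto_arctan_at_bot]) auto
  qed
  ultimately have "((\<lambda>R. Re (winding_number (trunc_contour Vertical axis_path R) w)) \<longlongrightarrow> (- (pi / 2) - pi / 2) / (2 * pi)) at_top"
    by (simp only: tendsto_cong)
  thus ?thesis using av by (simp add: right_of_contour_def has_contour_index_def)
qed

text \<open>
  Only the existence of the integral is checked by hand; its value then follows from uniqueness.
\<close>
lemma axis_contour_integral: "has_infinite_contour_integral F V Vertical axis_path"
proof -
  have ray: "((\<lambda>x. F (Complex 0 (c + d * x)) * e) integrable_on {0..})" if "d \<noteq> 0" for c d :: real and e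
  proof -
    have "integrable lborel (\<lambda>x. F (Complex 0 (c + d * x)))"
      using that by (intro lborel_integrable_real_affine axis_integrable)
    hence "integrable lborel (\<lambda>x. F (Complex 0 (c + d * x)) * e)" by (intro integrable_mult_left) auto
    hence "set_integrable lborel {0..} (\<lambda>x. F (Complex 0 (c + d * x)) * e)"
      unfolding set_integrable_def by (intro integrable_mult_indicator) auto
    thus ?thesis by (rule set_borel_integral_eq_integral)
  qed
  have 1: "(\<lambda>x. F (pathstart axis_path + of_real x * in_dir Vertical) * in_dir Vertical) integrable_on {0..}"
  proof -
    have "pathstart axis_path + of_real x * in_dir Vertical = Complex 0 (-1 + (-1) * x)" for x
      by (simp add: axis_path_def complex_eq_iff)
    thus ?thesis using ray[of "-1" "-1" "in_dir Vertical"] by simp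
  qed
  have 3: "(\<lambda>x. F (pathfinish axis_path + of_real x * out_dir Vertical) * out_dir Vertical) integrable_on {0..}"
  proof -
    have "pathfinish axis_path + of_real x * out_dir Vertical = Complex 0 (1 + 1 * x)" for x
      by (simp add: axis_path_def complex_eq_iff)
    thus ?thesis using ray[of 1 1 "out_dir Vertical"] by simp
  qed
  have 2: "F contour_integrable_on axis_path"
    unfolding axis_path_def
  proof (rule contour_integrable_continuous_linepath)
    have "continuous_on (closed_segment (Complex 0 (-1)) (Complex 0 1)) (\<lambda>s. F s)"
      by (intro gamma_quotient_continuous z_pos slit_no_pole continuous_intros)
         (use w0_pos in \<open>auto simp: closed_segment_axis slit_plane_def\<close>)
    thus "continuous_on (closed_segment (Complex 0 (-1)) (Complex 0 1)) F" by simp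
  qed
  obtain I where I: "has_infinite_contour_integral F I Vertical axis_path"
    using 1 2 3 unfolding has_infinite_contour_integral_def integrable_on_def contour_integrable_on_def by blast
  moreover have "I = V" by (rule contour_value_unique[OF axis_contour axis_right_of I])
  ultimately show ?thesis by simp
qed

theorem meijer_G_eq_axis_integral:
  "meijer_G 0 (length A) (map of_real A) (map of_real B) (of_real z) =
     1 / (2 * of_real pi) * (LBINT y. F (Complex 0 y))"
proof -
  have int: "meijer_integrand 0 (length A) (map of_real A) (map of_real B) (of_real z) = F"
    by (intro ext) (simp add: meijer_integrand_def gamma_quotient_def o_def)
  have poles: "(\<forall>a\<in>set (take (length A) (map of_real A)). \<forall>s. 1 - a - s \<in> \<int>\<^sub>\<le>\<^sub>0 \<longrightarrow> right_of_contour K p s) \<longleftrightarrow>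
     (\<forall>s\<in>gamma_poles A. right_of_contour K p s)" for K p
    by (auto simp: gamma_poles_def)
  have iff: "has_meijer_G 0 (length A) (map of_real A) (map of_real B) (of_real z) v \<longleftrightarrow>
          v = 1 / (2 * of_real pi * \<i>) * V" for v
  proof
    assume "has_meijer_G 0 (length A) (map of_real A) (map of_real B) (of_real z) v"
    then obtain K p I where "infinite_contour K p" "\<forall>s\<in>gamma_poles A. right_of_contour K p s"
      "has_infinite_contour_integral F I K p" "v = 1 / (2 * of_real pi * \<i>) * I"
      unfolding has_meijer_G_def int poles by blast
    with contour_value_unique[of K p I] show "v = 1 / (2 * of_real pi * \<i>) * V" by simp
  next
    assume v: "v = 1 / (2 * of_real pi * \<i>) * V"
    have "infinite_contour Vertical axis_path \<and>
        (\<forall>b\<in>set (take 0 (map of_real B)). \<forall>s. b + s \<in> \<int>\<^sub>\<le>\<^sub>0 \<longrightarrow> left_of_contour Vertical axis_path s) \<and>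
        (\<forall>s\<in>gamma_poles A. right_of_contour Vertical axis_path s) \<and>
        has_infinite_contour_integral F V Vertical axis_path \<and> v = 1 / (2 * of_real pi * \<i>) * V"
      using axis_contour axis_right_of axis_contour_integral v by simp
    thus "has_meijer_G 0 (length A) (map of_real A) (map of_real B) (of_real z) v"
      unfolding has_meijer_G_def int poles length_map by blast
  qed
  have "meijer_G 0 (length A) (map of_real A) (map of_real B) (of_real z) = 1 / (2 * of_real pi * \<i>) * V"
    unfolding meijer_G_def by (rule the_equality) (simp_all only: iff)
  also have "integral UNIV (\<lambda>y. F (Complex 0 y)) = (LBINT y. F (Complex 0 y))"
    by (rule integral_lborel) (rule axis_integrable)
  hence "1 / (2 * of_real pi * \<i>) * V = 1 / (2 * of_real pi) * (LBINT y. F (Complex 0 y))"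
    by (simp add: V_def)
  finally show ?thesis .
qed

end

section \<open>Gauss multiplication and the parameter vectors\<close>

text \<open>The \<open>r n\<close> factors \<open>r z + j\<close> are sorted by the residue of \<open>j\<close> modulo \<open>r\<close>.\<close>
lemma pochhammer_multiplication:
  fixes z :: complex
  assumes "r > 0"
  shows "pochhammer (of_nat r * z) (r * n) =
           of_nat r ^ (r * n) * (\<Prod>i<r. pochhammer (z + of_nat i / of_nat r) n)"
proof -
  have "pochhammer (of_nat r * z) (r * n) = (\<Prod>j<n * r. of_nat r * z + of_nat j)"
    by (simp add: pochhammer_prod atLeast0LessThan mult.commute)
  also have "\<dots> = (\<Prod>q<n. \<Prod>j\<in>{q * r..<q * r + r}. of_nat r * z + of_nat j)"
    by (rule prod.nat_group[symmetric])
  also have "\<dots> = (\<Prod>q<n. \<Prod>i<r. of_nat r * ((z + of_nat i / of_nat r) + of_nat q))"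
  proof (rule prod.cong[OF refl])
    fix q
    have "(\<Prod>j\<in>{q * r..<q * r + r}. of_nat r * z + of_nat j) = (\<Prod>i<r. of_nat r * z + of_nat (i + q * r))"
      using prod.shift_bounds_nat_ivl[of "\<lambda>j. of_nat r * z + of_nat j" 0 "q * r" r]
      by (simp add: atLeast0LessThan add.commute)
    also have "\<dots> = (\<Prod>i<r. of_nat r * ((z + of_nat i / of_nat r) + of_nat q))"
      using assms by (intro prod.cong refl) (simp add: field_simps)
    finally show "(\<Prod>j\<in>{q * r..<q * r + r}. of_nat r * z + of_nat j) = (\<Prod>i<r. of_nat r * ((z + of_nat i / of_nat r) + of_nat q))" .
  qed
  also have "\<dots> = (\<Prod>i<r. \<Prod>q<n. of_nat r * ((z + of_nat i / of_nat r) + of_nat q))"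
    by (rule prod.swap)
  also have "\<dots> = of_nat r ^ (r * n) * (\<Prod>i<r. pochhammer (z + of_nat i / of_nat r) n)"
    by (simp add: prod.distrib pochhammer_prod atLeast0LessThan power_mult mult.commute)
  finally show ?thesis .
qed

text \<open>
  Gauss multiplication without evaluating the constant, which cancels in the quotient of the two
  \<open>G\<close>-functions.  For the approximants of Euler's limit the identity is exact, with a factor \<open>K n\<close> that does not
  depend on \<open>z\<close>; the point \<open>z = 1\<close> shows that \<open>K n\<close> converges to a nonzero limit.
\<close>
lemma Gamma_multiplication_up_to_constant:
  assumes r: "r > 0"
  obtains K :: complex where "K \<noteq> 0"
    "\<And>z. Re z > 0 \<Longrightarrow> (\<Prod>i<r. Gamma (z + of_nat i / of_nat r)) =
       K * exp (- (of_nat r * z * of_real (ln (real r)))) * Gamma (of_nat r * z)"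
proof -
  define P where "P = (\<lambda>z n. \<Prod>i<r. Gamma_series' (z + of_nat i / of_nat r :: complex) n)"
  define K where "K = (\<lambda>n. of_nat r ^ (r * n) * (\<Prod>i<r. fact (n - 1) * exp (of_nat i / of_nat r * of_real (ln (real n)))) / fact (r * n - 1) :: complex)"
  define E where "E = (\<lambda>z::complex. exp (- (of_nat r * z * of_real (ln (real r)))))"
  have np: "x \<notin> \<int>\<^sub>\<le>\<^sub>0" if "Re x > 0" for x :: complex
    using that by (auto elim!: nonpos_Ints_cases)
  have PK: "P z n = K n * E z * Gamma_series' (of_nat r * z) (r * n)" if z: "Re z > 0" and n: "n > 0" for z n
  proof -
    have "P z n = (\<Prod>i<r. fact (n - 1) * exp (of_nat i / of_nat r * of_real (ln (real n))) *
                      exp (z * of_real (ln (real n)))) / (\<Prod>i<r. pochhammer (z + of_nat i / of_nat r) n)"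
      by (simp add: P_def Gamma_series'_def prod_dividef ring_distribs exp_add mult_ac)
    also have "(\<Prod>i<r. pochhammer (z + of_nat i / of_nat r) n) = pochhammer (of_nat r * z) (r * n) / of_nat r ^ (r * n)"
      using r by (simp add: pochhammer_multiplication)
    also have "(\<Prod>i<r. fact (n - 1) * exp (of_nat i / of_nat r * of_real (ln (real n))) * exp (z * of_real (ln (real n)))) =
       (\<Prod>i<r. fact (n - 1) * exp (of_nat i / of_nat r * of_real (ln (real n)))) * exp (of_nat r * z * of_real (ln (real n)))"
      by (simp add: prod.distrib mult.assoc flip: exp_of_nat_mult)
    also have "exp (of_nat r * z * of_real (ln (real n))) = E z * exp (of_nat r * z * of_real (ln (of_nat (r * n))))"
      using r n by (simp add: E_def ln_mult ring_distribs flip: exp_add)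
    finally show ?thesis
      by (simp add: K_def Gamma_series'_def)
  qed
  have limP: "P z \<longlonglongrightarrow> (\<Prod>i<r. Gamma (z + of_nat i / of_nat r))" for z
    unfolding P_def by (intro tendsto_prod Gamma_series'_LIMSEQ)
  have limG: "(\<lambda>n. Gamma_series' (of_nat r * z) (r * n)) \<longlonglongrightarrow> Gamma (of_nat r * z)" for z :: complex
    using r by (intro filterlim_compose[OF Gamma_series'_LIMSEQ]) (auto intro!: mult_nat_left_at_top)
  have Enz: "E z \<noteq> 0" for z by (simp add: E_def)
  define L where "L = (\<Prod>i<r. Gamma (1 + of_nat i / of_nat r :: complex)) / (E 1 * Gamma (of_nat r * 1))"
  have G1: "Gamma (of_nat r * 1 :: complex) \<noteq> 0"
    using r np[of "of_nat r"] by (simp add: Gamma_eq_zero_iff)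
  have "(\<lambda>n. P 1 n / (E 1 * Gamma_series' (of_nat r * 1) (r * n))) \<longlonglongrightarrow> L"
    unfolding L_def using G1 Enz by (intro tendsto_intros limP limG) auto
  moreover have "eventually (\<lambda>n. P 1 n / (E 1 * Gamma_series' (of_nat r * 1) (r * n)) = K n) sequentially"
  proof -
    have "eventually (\<lambda>n. Gamma_series' (of_nat r * 1) (r * n) \<noteq> (0::complex)) sequentially"
      using G1 by (intro tendsto_imp_eventually_ne[OF limG])
    thus ?thesis using eventually_gt_at_top[of 0]
    proof eventually_elim
      case (elim n)
      thus ?case using PK[of 1 n] Enz[of 1] by simp
    qed
  qed
  ultimately have K: "K \<longlonglongrightarrow> L" by (simp add: tendsto_cong)
  show ?thesis
  proof (rule that[of L])
    have "(\<Prod>i<r. Gamma (1 + of_nat i / of_nat r :: complex)) \<noteq> 0"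
    proof -
      have "Gamma (1 + of_nat i / of_nat r :: complex) \<noteq> 0" for i
        using np[of "1 + of_nat i / of_nat r"] by (simp add: Gamma_eq_zero_iff add_pos_nonneg)
      thus ?thesis by simp
    qed
    thus "L \<noteq> 0" using G1 Enz by (simp add: L_def)
    fix z :: complex assume z: "Re z > 0"
    have "(\<lambda>n. K n * E z * Gamma_series' (of_nat r * z) (r * n)) \<longlonglongrightarrow> L * E z * Gamma (of_nat r * z)"
      by (intro tendsto_intros K limG)
    moreover have "eventually (\<lambda>n. K n * E z * Gamma_series' (of_nat r * z) (r * n) = P z n) sequentially"
      using eventually_gt_at_top[of 0] by eventually_elim (use PK[OF z] in auto)
    ultimately have "P z \<longlonglongrightarrow> L * E z * Gamma (of_nat r * z)" by (simp add: tendsto_cong)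
    from LIMSEQ_unique[OF limP this]
    show "(\<Prod>i<r. Gamma (z + of_nat i / of_nat r)) = L * exp (- (of_nat r * z * of_real (ln (real r)))) * Gamma (of_nat r * z)"
      by (simp add: E_def)
  qed
qed

definition tau_real :: "nat \<Rightarrow> nat \<Rightarrow> nat \<Rightarrow> real list" where
  "tau_real m r k =
     map (\<lambda>i. 1 - 1 / real m - (real i + real k) / real r) [1..<r] @
     map (\<lambda>i. (real i - 1) / real m - real k / real r) [1..<Suc m]"

definition delta_real :: "nat \<Rightarrow> nat \<Rightarrow> nat \<Rightarrow> nat \<Rightarrow> real list" where
  "delta_real m r n k =
     map (\<lambda>j. 1 - 1 / real m - real j / real m - real k / real r) [1..<m] @
     map (\<lambda>j. (real j - 1 - real n) / real m) [1..<Suc m]"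

definition upper_real :: "nat \<Rightarrow> nat \<Rightarrow> real list" where
  "upper_real m r = map (\<lambda>i. 1 - 1 / real m - real i / real r) [1..<r]"

definition lower_real :: "nat \<Rightarrow> real list" where
  "lower_real m = map (\<lambda>j. 1 - 1 / real m - real j / real m) [1..<m]"

lemma params_of_real:
  "tau_params m r k = map of_real (tau_real m r k)"
  "delta_params m r n k = map of_real (delta_real m r n k)"
  "stable_upper m r = map of_real (upper_real m r)"
  "stable_lower m = map of_real (lower_real m)"
  by (simp_all add: tau_params_def tau_real_def delta_params_def delta_real_def stable_upper_def upper_real_def
     stable_lower_def lower_real_def)

lemma prod_list_upt: "(\<Prod>i\<leftarrow>[a..<b]. f i) = (\<Prod>i\<in>{a..<b}. f i :: complex)"
  using prod.distinct_set_conv_list[of "[a..<b]" f] by simp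

lemma prod_from_0: "0 < (n::nat) \<Longrightarrow> (\<Prod>i<n. f i) = f 0 * (\<Prod>i\<in>{1..<n}. f i :: complex)"
  using prod.atLeast_Suc_lessThan[of 0 n f] by (simp add: atLeast0LessThan)

lemma prod_rev_shift: "(\<Prod>i\<in>{1..<Suc m}. f (m - i)) = (\<Prod>j<m. f j :: complex)"
  by (rule prod.reindex_bij_witness[of _ "\<lambda>j. m - j" "\<lambda>i. m - i"]) auto

text \<open>The missing factor \<open>i = 0\<close> of both products is the same number \<open>\<Gamma>(u)\<close>, so it may be inserted above and below.\<close>
lemma stable_quotient_reduce:
  assumes "1 \<le> m" "m < r" "Re s < 1 / real m"
  defines "u \<equiv> of_real (1 / real m) - s"
  shows "gamma_quotient (upper_real m r) (lower_real m) z s =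
     (\<Prod>i<r. Gamma (u + of_nat i / of_nat r)) * (\<Prod>i<m. rGamma (u + of_nat i / of_nat m)) * of_real z powr (- s)"
proof -
  have 1: "(\<Prod>a\<leftarrow>upper_real m r. Gamma (1 - of_real a - s)) = (\<Prod>i\<in>{1..<r}. Gamma (u + of_nat i / of_nat r))"
    by (simp add: upper_real_def o_def prod_list_upt u_def algebra_simps)
  have 2: "(\<Prod>a\<leftarrow>lower_real m. rGamma (1 - of_real a - s)) = (\<Prod>i\<in>{1..<m}. rGamma (u + of_nat i / of_nat m))"
    by (simp add: lower_real_def o_def prod_list_upt u_def algebra_simps)
  have "Re u > 0" using assms(3) by (simp add: u_def)
  hence "u \<notin> \<int>\<^sub>\<le>\<^sub>0" by (auto elim!: nonpos_Ints_cases)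
  hence "Gamma u * rGamma u = 1" by (simp add: Gamma_def rGamma_eq_zero_iff)
  hence "(\<Prod>i<r. Gamma (u + of_nat i / of_nat r)) * (\<Prod>i<m. rGamma (u + of_nat i / of_nat m)) =
     (\<Prod>i\<in>{1..<r}. Gamma (u + of_nat i / of_nat r)) * (\<Prod>i\<in>{1..<m}. rGamma (u + of_nat i / of_nat m))"
    using assms(1,2) by (simp add: prod_from_0 mult_ac)
  thus ?thesis unfolding gamma_quotient_def 1 2 by simp
qed

text \<open>
  In reverse order the last \<open>m\<close> upper parameters give \<open>\<Gamma>(u + j / m)\<close> with \<open>0 \<le> j < m\<close>, and the first \<open>m - 1\<close> lower ones
  cancel all of these except \<open>\<Gamma>(u)\<close>, which is the factor \<open>i = 0\<close> missing from the first \<open>r - 1\<close> upper parameters.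
\<close>
lemma tau_quotient_reduce:
  fixes m r k n :: nat and s :: complex
  assumes "1 \<le> m" "m < r" "Re s < 1 / real m + real k / real r"
  defines "u \<equiv> of_real (1 / real m + real k / real r) - s" and "v \<equiv> of_real ((real n + 1) / real m) - s"
  shows "gamma_quotient (tau_real m r k) (delta_real m r n k) z s =
     (\<Prod>i<r. Gamma (u + of_nat i / of_nat r)) * (\<Prod>i<m. rGamma (v + of_nat i / of_nat m)) * of_real z powr (- s)"
proof -
  have 1: "(\<Prod>a\<leftarrow>tau_real m r k. Gamma (1 - of_real a - s)) =
     (\<Prod>i\<in>{1..<r}. Gamma (u + of_nat i / of_nat r)) * (\<Prod>i<m. Gamma (u + of_nat i / of_nat m))"
  proof -
    have "(\<Prod>i\<in>{1..<Suc m}. Gamma (1 - of_real ((real i - 1) / real m - real k / real r) - s)) =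
      (\<Prod>i\<in>{1..<Suc m}. Gamma (u + of_nat (m - i) / of_nat m))"
      using assms(1) by (intro prod.cong refl arg_cong[of _ _ Gamma])
        (auto simp: u_def of_nat_diff field_simps)
    also have "\<dots> = (\<Prod>i<m. Gamma (u + of_nat i / of_nat m))"
      by (rule prod_rev_shift)
    finally have a: "(\<Prod>i\<in>{1..<Suc m}. Gamma (1 - of_real ((real i - 1) / real m - real k / real r) - s)) = \<dots>" .
    have b: "1 - of_real (1 - 1 / real m - (real i + real k) / real r) - s = u + of_nat i / of_nat r" for i
      by (simp add: u_def algebra_simps add_divide_distrib)
    show ?thesis unfolding tau_real_def map_append prod_list.append map_map o_def prod_list_upt a b ..
  qed
  have 2: "(\<Prod>a\<leftarrow>delta_real m r n k. rGamma (1 - of_real a - s)) =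
     (\<Prod>i\<in>{1..<m}. rGamma (u + of_nat i / of_nat m)) * (\<Prod>i<m. rGamma (v + of_nat i / of_nat m))"
  proof -
    have "(\<Prod>i\<in>{1..<Suc m}. rGamma (1 - of_real ((real i - 1 - real n) / real m) - s)) =
      (\<Prod>i\<in>{1..<Suc m}. rGamma (v + of_nat (m - i) / of_nat m))"
      using assms(1) by (intro prod.cong refl arg_cong[of _ _ rGamma])
        (auto simp: v_def of_nat_diff field_simps)
    also have "\<dots> = (\<Prod>i<m. rGamma (v + of_nat i / of_nat m))"
      by (rule prod_rev_shift)
    finally have a: "(\<Prod>i\<in>{1..<Suc m}. rGamma (1 - of_real ((real i - 1 - real n) / real m) - s)) = \<dots>" .
    have b: "1 - of_real (1 - 1 / real m - real i / real m - real k / real r) - s = u + of_nat i / of_nat m" for i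
      by (simp add: u_def algebra_simps)
    show ?thesis unfolding delta_real_def map_append prod_list.append map_map o_def prod_list_upt a b ..
  qed
  have "Re u > 0" using assms(3) by (simp add: u_def)
  hence "Re (u + of_nat i / of_nat m) > 0" for i by (simp add: add_pos_nonneg)
  hence np: "u + of_nat i / of_nat m \<notin> \<int>\<^sub>\<le>\<^sub>0" for i
    by (metis nonpos_Ints_cases complex_Re_of_int of_int_0_less_iff not_le)
  have G: "Gamma (u + of_nat i / of_nat m) * rGamma (u + of_nat i / of_nat m) = 1" for i
    using np[of i] by (simp add: Gamma_def rGamma_eq_zero_iff)
  have "(\<Prod>i\<in>{1..<m}. Gamma (u + of_nat i / of_nat m)) * (\<Prod>i\<in>{1..<m}. rGamma (u + of_nat i / of_nat m)) = 1"
    unfolding prod.distrib[symmetric] G by simp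
  hence "(\<Prod>i<m. Gamma (u + of_nat i / of_nat m)) * (\<Prod>i\<in>{1..<m}. rGamma (u + of_nat i / of_nat m)) = Gamma u"
    using assms(1) by (simp add: prod_from_0 mult_ac)
  moreover have "(\<Prod>i<r. Gamma (u + of_nat i / of_nat r)) = Gamma u * (\<Prod>i\<in>{1..<r}. Gamma (u + of_nat i / of_nat r))"
    using assms(2) by (simp add: prod_from_0)
  moreover have "(c * a) * (b * d) * e = Q * d * e" if "a * b = G" "Q = G * c" for a b c d e G Q :: complex
    by (simp add: that(2) that(1)[symmetric] mult_ac)
  ultimately show ?thesis unfolding gamma_quotient_def 1 2 by blast
qed

abbreviation meijer_arg :: "nat \<Rightarrow> nat \<Rightarrow> real \<Rightarrow> real" where
  "meijer_arg m r t \<equiv> real r ^ r / real m ^ m * t ^ m"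

text \<open>
  Up to a constant, the Mellin transform at \<open>m s\<close> of \<open>t\<^sup>-\<^sup>n q(t)\<close>, where \<open>q\<close> is the Riemann-Liouville
  integral of order \<open>n - k m / r\<close> of the stable density, together with the power of \<open>t\<close> of Mellin inversion.
\<close>
definition reduced_integrand :: "nat \<Rightarrow> nat \<Rightarrow> nat \<Rightarrow> nat \<Rightarrow> real \<Rightarrow> complex \<Rightarrow> complex" where
  "reduced_integrand m r k n t s = of_nat m ^ n / of_nat r ^ k *
     (Gamma (of_nat r / of_nat m + of_nat k - of_nat r * s) * rGamma (of_nat n + 1 - of_nat m * s) *
      exp (- (of_nat m * s * of_real (ln t))))"

text \<open>One constant \<open>K\<close> serves both integrands; this is why it drops out of the theorem.\<close>
lemma gamma_quotient_reduced:
  assumes m: "1 \<le> m" "m < r"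
  obtains K :: complex where "K \<noteq> 0"
    "\<And>k n t s. Re s \<le> 0 \<Longrightarrow> t > 0 \<Longrightarrow>
       gamma_quotient (tau_real m r k) (delta_real m r n k) (meijer_arg m r t) s = K * reduced_integrand m r k n t s"
    "\<And>t s. Re s \<le> 0 \<Longrightarrow> t > 0 \<Longrightarrow>
       gamma_quotient (upper_real m r) (lower_real m) (meijer_arg m r t) s = K * reduced_integrand m r 0 0 t s"
proof -
  have r0: "r > 0" and m0: "m > 0" using assms by auto
  obtain Kr :: complex where Kr: "Kr \<noteq> 0"
    "\<And>z. Re z > 0 \<Longrightarrow> (\<Prod>i<r. Gamma (z + of_nat i / of_nat r)) =
       Kr * exp (- (of_nat r * z * of_real (ln (real r)))) * Gamma (of_nat r * z)"
    by (rule Gamma_multiplication_up_to_constant[OF r0]) (rule that)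
  obtain Km :: complex where Km: "Km \<noteq> 0"
    "\<And>z. Re z > 0 \<Longrightarrow> (\<Prod>i<m. Gamma (z + of_nat i / of_nat m)) =
       Km * exp (- (of_nat m * z * of_real (ln (real m)))) * Gamma (of_nat m * z)"
    by (rule Gamma_multiplication_up_to_constant[OF m0]) (rule that)
  define lr lm where "lr = complex_of_real (ln (real r))" and "lm = complex_of_real (ln (real m))"
  define K where "K = Kr / Km * exp (- (of_nat r / of_nat m * lr)) * exp lm"
  have "K \<noteq> 0" using Kr Km by (simp add: K_def)
  have pos: "0 < 1 / real m + real k / real r" "0 < (real n + 1) / real m" "0 < 1 / real m" for k n :: nat
    using m0 r0 by (auto intro!: add_pos_nonneg divide_pos_pos)
  have main: "(\<Prod>i<r. Gamma (of_real (1 / real m + real k / real r) - s + of_nat i / of_nat r)) *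
      (\<Prod>i<m. rGamma (of_real ((real n + 1) / real m) - s + of_nat i / of_nat m)) *
      of_real (meijer_arg m r t) powr (- s) = K * reduced_integrand m r k n t s"
    if "Re s \<le> 0" "t > 0" for k n :: nat and s :: complex and t :: real
  proof -
    have s: "Re s < 1 / real m + real k / real r" "Re s < (real n + 1) / real m" and t: "t > 0"
      using that pos(1)[of k] pos(2)[of n] by linarith+
    define u v where "u = complex_of_real (1 / real m + real k / real r) - s"
      and "v = complex_of_real ((real n + 1) / real m) - s"
    have ru: "of_nat r * u = of_nat r / of_nat m + of_nat k - of_nat r * s"
      using r0 m0 by (simp add: u_def field_simps)
    have mv: "of_nat m * v = of_nat n + 1 - of_nat m * s"
      using m0 by (simp add: v_def field_simps)
    have 1: "(\<Prod>i<r. Gamma (u + of_nat i / of_nat r)) = Kr * exp (- (of_nat r * u * lr)) * Gamma (of_nat r * u)"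
      unfolding lr_def using s by (intro Kr(2)) (simp add: u_def)
    have "(\<Prod>i<m. rGamma (v + of_nat i / of_nat m)) = inverse (\<Prod>i<m. Gamma (v + of_nat i / of_nat m))"
      by (simp add: rGamma_inverse_Gamma prod_inversef[symmetric] o_def)
    also have "\<dots> = inverse (Km * exp (- (of_nat m * v * lm)) * Gamma (of_nat m * v))"
      unfolding lm_def using s by (subst Km(2)) (simp_all add: v_def)
    also have "\<dots> = exp (of_nat m * v * lm) / Km * rGamma (of_nat m * v)"
      by (simp add: rGamma_inverse_Gamma exp_minus field_simps)
    finally have 2: "(\<Prod>i<m. rGamma (v + of_nat i / of_nat m)) = exp (of_nat m * v * lm) / Km * rGamma (of_nat m * v)" .
    have "ln (real r ^ r / real m ^ m * t ^ m) = real r * ln (real r) - real m * ln (real m) + real m * ln t"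
      using r0 m0 t by (simp add: ln_mult ln_div ln_realpow)
    hence 3: "complex_of_real (real r ^ r / real m ^ m * t ^ m) powr (- s) =
       exp (- s * (of_nat r * lr - of_nat m * lm + of_nat m * of_real (ln t)))"
      using r0 m0 t unfolding powr_def
      by (subst Ln_of_real) (auto simp: lr_def lm_def)
    have "exp lr = of_real (exp (ln (real r)))" "exp lm = of_real (exp (ln (real m)))"
      by (simp_all only: lr_def lm_def exp_of_real)
    hence "exp lr = of_nat r" "exp lm = of_nat m" using r0 m0 by simp_all
    hence er: "exp (of_nat k * lr) = of_nat r ^ k" and em: "exp (of_nat n * lm) = of_nat m ^ n"
      by (simp_all add: exp_of_nat_mult)
    have "exp (- (of_nat r * u * lr)) * exp (of_nat m * v * lm) *
        exp (- s * (of_nat r * lr - of_nat m * lm + of_nat m * of_real (ln t))) =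
        exp (- (of_nat r / of_nat m * lr)) * exp lm * (exp (of_nat n * lm) / exp (of_nat k * lr)) *
        exp (- (of_nat m * s * of_real (ln t)))"
      unfolding ru mv exp_add[symmetric] exp_diff[symmetric]
      by (rule arg_cong[of _ _ exp]) (simp add: algebra_simps)
    hence e: "exp (- (of_nat r * u * lr)) * exp (of_nat m * v * lm) *
        exp (- s * (of_nat r * lr - of_nat m * lm + of_nat m * of_real (ln t))) =
        exp (- (of_nat r / of_nat m * lr)) * exp lm * (of_nat m ^ n / of_nat r ^ k) *
        exp (- (of_nat m * s * of_real (ln t)))" unfolding er em .
    have "(\<Prod>i<r. Gamma (u + of_nat i / of_nat r)) * (\<Prod>i<m. rGamma (v + of_nat i / of_nat m)) *
      of_real (real r ^ r / real m ^ m * t ^ m) powr (- s) =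
      Kr / Km * (exp (- (of_nat r * u * lr)) * exp (of_nat m * v * lm) *
        exp (- s * (of_nat r * lr - of_nat m * lm + of_nat m * of_real (ln t)))) * (Gamma (of_nat r * u) * rGamma (of_nat m * v))"
      unfolding 1 2 3 by simp
    also have "\<dots> = K * (of_nat m ^ n / of_nat r ^ k) *
       (Gamma (of_nat r * u) * rGamma (of_nat m * v) * exp (- (of_nat m * s * of_real (ln t))))"
      unfolding e K_def by simp
    finally show ?thesis
      unfolding u_def[symmetric] v_def[symmetric] ru mv by (simp add: reduced_integrand_def)
  qed
  show ?thesis
  proof (rule that[OF \<open>K \<noteq> 0\<close>])
    fix k n :: nat and t :: real and s :: complex assume "Re s \<le> 0" "t > 0"
    moreover from this have "Re s < 1 / real m + real k / real r" using pos(1)[of k] by linarith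
    ultimately show "gamma_quotient (tau_real m r k) (delta_real m r n k) (meijer_arg m r t) s = K * reduced_integrand m r k n t s"
      using main[of s t k n] tau_quotient_reduce[OF m] by simp
  next
    fix t :: real and s :: complex assume "Re s \<le> 0" "t > 0"
    moreover from this have "Re s < 1 / real m" using pos(3) by linarith
    ultimately show "gamma_quotient (upper_real m r) (lower_real m) (meijer_arg m r t) s = K * reduced_integrand m r 0 0 t s"
      using main[of s t 0 0] stable_quotient_reduce[OF m] by simp
  qed
qed

section \<open>Mellin transforms from Laplace transforms\<close>

text \<open>
  The substitution \<open>t = exp x\<close> turns multiplicative scalings into translations, which Lebesgue measure respects.
\<close>
lemma exp_substitution:
  fixes f :: "real \<Rightarrow> 'a :: euclidean_space"
  assumes f: "f \<in> borel_measurable borel"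
  shows "set_integrable lborel {0<..} f \<longleftrightarrow> integrable lborel (\<lambda>x. exp x *\<^sub>R f (exp x))"
    and "(LINT t:{0<..}|lborel. f t) = (LINT x|lborel. exp x *\<^sub>R f (exp x))"
proof -
  have m1[measurable]: "(\<lambda>x. exp x *\<^sub>R f (exp x)) \<in> borel_measurable borel" using f by measurable
  have m2: "(\<lambda>x. indicator {0<..} x *\<^sub>R f x) \<in> borel_measurable borel" using f by measurable
  have img: "exp ` UNIV = {0::real<..}"
  proof safe
    fix x :: real assume "x > 0"
    thus "x \<in> range exp" by (metis exp_ln rangeI)
  qed simp
  have iff: "(\<lambda>x. \<bar>exp x\<bar> *\<^sub>R f (exp x)) absolutely_integrable_on UNIV \<and> integral UNIV (\<lambda>x. \<bar>exp x\<bar> *\<^sub>R f (exp x)) = b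
          \<longleftrightarrow> f absolutely_integrable_on (exp ` UNIV) \<and> integral (exp ` UNIV) f = b" for b
    by (rule has_absolute_integral_change_of_variables_real)
       (auto intro!: derivative_eq_intros inj_onI)
  have a1: "f absolutely_integrable_on {0<..} \<longleftrightarrow> set_integrable lborel {0<..} f"
    unfolding set_integrable_def using m2 by (intro integrable_completion) simp
  have a2: "(\<lambda>x. exp x *\<^sub>R f (exp x)) absolutely_integrable_on UNIV \<longleftrightarrow> integrable lborel (\<lambda>x. exp x *\<^sub>R f (exp x))"
    unfolding set_integrable_def using integrable_completion[of "\<lambda>x. exp x *\<^sub>R f (exp x)" lborel] by simp
  show 1: "set_integrable lborel {0<..} f \<longleftrightarrow> integrable lborel (\<lambda>x. exp x *\<^sub>R f (exp x))"
    using iff unfolding img a1[symmetric] a2[symmetric] by auto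
  show "(LINT t:{0<..}|lborel. f t) = (LINT x|lborel. exp x *\<^sub>R f (exp x))"
  proof (cases "set_integrable lborel {0<..} f")
    case True
    hence "integral {0<..} f = integral UNIV (\<lambda>x. exp x *\<^sub>R f (exp x))"
      using iff unfolding img a1[symmetric] by auto
    moreover have "integral {0<..} f = (LINT t:{0<..}|lborel. f t)"
      using set_borel_integral_eq_integral(2)[OF True] by simp
    moreover have "integral UNIV (\<lambda>x. exp x *\<^sub>R f (exp x)) = (LINT x|lborel. exp x *\<^sub>R f (exp x))"
      using True 1 by (intro integral_lborel) simp
    ultimately show ?thesis by simp
  next
    case False
    thus ?thesis using 1 unfolding set_integrable_def set_lebesgue_integral_def
      by (simp add: not_integrable_integral_eq)
  qed
qed

lemma Gamma_log_integral:
  assumes "Re w > 0"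
  shows "integrable lborel (\<lambda>x::real. exp (w * of_real x) * of_real (exp (- exp x)))"
    and "(LBINT x. exp (w * of_real x) * of_real (exp (- exp x))) = Gamma w"
proof -
  define f where "f = (\<lambda>t::real. of_real t powr (w - 1) / of_real (exp t) :: complex)"
  have fm: "f \<in> borel_measurable borel"
    unfolding f_def by measurable
  have eq: "exp x *\<^sub>R f (exp x) = exp (w * of_real x) * of_real (exp (- exp x))" for x
  proof -
    have "complex_of_real (exp x) powr (w - 1) = exp ((w - 1) * of_real x)"
      by (simp add: powr_def Ln_of_real)
    thus ?thesis
      by (simp add: f_def scaleR_conv_of_real exp_of_real exp_minus ring_distribs exp_diff divide_inverse)
  qed
  have abs: "f absolutely_integrable_on {0<..}"
    unfolding f_def by (rule absolutely_integrable_Gamma_integral'[OF assms])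
  have int: "set_integrable lborel {0<..} f"
    using abs fm unfolding set_integrable_def
    by (subst (asm) integrable_completion) auto
  show "integrable lborel (\<lambda>x::real. exp (w * of_real x) * of_real (exp (- exp x)))"
    using int unfolding exp_substitution(1)[OF fm] eq .
  have "(LINT t:{0<..}|lborel. f t) = integral {0<..} f"
    by (rule set_borel_integral_eq_integral(2)[OF int])
  also have "\<dots> = Gamma w"
    unfolding f_def by (rule integral_unique[OF Gamma_integral_complex'[OF assms]])
  finally show "(LBINT x. exp (w * of_real x) * of_real (exp (- exp x))) = Gamma w"
    unfolding exp_substitution(2)[OF fm] eq .
qed

text \<open>
  The integral of \<open>t\<^sup>-\<^sup>w q(t)\<close> over the half-line for a function \<open>q\<close> with Laplace transform \<open>l\<^sup>-\<^sup>b exp(-l\<^sup>\<alpha>)\<close>.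
\<close>
definition stable_mellin :: "real \<Rightarrow> real \<Rightarrow> complex \<Rightarrow> complex" where
  "stable_mellin \<alpha> b w = Gamma ((w - of_real b) / of_real \<alpha>) * rGamma w / of_real \<alpha>"

text \<open>
  Here \<open>h(x) = exp x q(exp x)\<close> and \<open>l = exp y\<close>.  Fubini's theorem is applied to \<open>exp(w y) exp(-exp(y + x)) h(x)\<close>:
  integrating over \<open>x\<close> first uses the Laplace transform, integrating over \<open>y\<close> first produces \<open>\<Gamma>(w)\<close>.
\<close>
lemma mellin_of_log_laplace:
  fixes h :: "real \<Rightarrow> real" and \<alpha> b :: real and w :: complex
  assumes h: "h \<in> borel_measurable borel" "\<And>x. h x \<ge> 0"
    and int: "\<And>y. integrable lborel (\<lambda>x. exp (- exp (y + x)) * h x)"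
    and lap: "\<And>y. (LBINT x. exp (- exp (y + x)) * h x) = exp (- b * y) * exp (- exp (\<alpha> * y))"
    and \<alpha>: "\<alpha> > 0" and b: "b \<ge> 0" and w: "Re w > b"
  shows "integrable lborel (\<lambda>x. exp (- (w * of_real x)) * of_real (h x))"
    and "(LBINT x. exp (- (w * of_real x)) * of_real (h x)) = stable_mellin \<alpha> b w"
proof -
  define K where "K = (\<lambda>y x. exp (w * of_real y) * of_real (exp (- exp (y + x)) * h x) :: complex)"
  have Km[measurable]: "(\<lambda>(y, x). K y x) \<in> borel_measurable (lborel \<Otimes>\<^sub>M lborel)"
    unfolding K_def using h(1) by measurable
  have outer: "integrable lborel (\<lambda>y. exp ((w - of_real b) * of_real y) * of_real (exp (- exp (\<alpha> * y))) :: complex)"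
    "(LBINT y. exp ((w - of_real b) * of_real y) * of_real (exp (- exp (\<alpha> * y)))) = Gamma ((w - of_real b) / of_real \<alpha>) / of_real \<alpha>"
    if "Re w > b" for w :: complex
  proof -
    have w': "Re ((w - of_real b) / of_real \<alpha>) > 0" using that \<alpha> by (simp add: Re_divide_of_real)
    define G where "G = (\<lambda>x::real. exp ((w - of_real b) / of_real \<alpha> * of_real x) * of_real (exp (- exp x)) :: complex)"
    have eq: "exp ((w - of_real b) * of_real y) * of_real (exp (- exp (\<alpha> * y))) = G (0 + \<alpha> * y)" for y
      using \<alpha> by (simp add: G_def)
    show "integrable lborel (\<lambda>y. exp ((w - of_real b) * of_real y) * of_real (exp (- exp (\<alpha> * y))) :: complex)"
      unfolding eq using \<alpha> Gamma_log_integral(1)[OF w']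
      by (intro lborel_integrable_real_affine) (simp_all add: G_def)
    have "(LBINT x. G x) = \<bar>\<alpha>\<bar> *\<^sub>R (LBINT y. G (0 + \<alpha> * y))"
      using \<alpha> by (intro lborel_integral_real_affine) auto
    thus "(LBINT y. exp ((w - of_real b) * of_real y) * of_real (exp (- exp (\<alpha> * y)))) = Gamma ((w - of_real b) / of_real \<alpha>) / of_real \<alpha>"
      unfolding eq using Gamma_log_integral(2)[OF w'] \<alpha>
      by (simp add: G_def scaleR_conv_of_real field_simps)
  qed
  have inner_y: "integrable lborel (\<lambda>x. K y x)" for y
    unfolding K_def using int[of y] by (intro integrable_mult_right integrable_of_real)
  have inner_int: "(LBINT x. K y x) = exp ((w - of_real b) * of_real y) * of_real (exp (- exp (\<alpha> * y)))" for y
  proof -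
    have "(LBINT x. K y x) = exp (w * of_real y) * of_real (LBINT x. exp (- exp (y + x)) * h x)"
      unfolding K_def by (simp only: integral_mult_right_zero integral_complex_of_real)
    also have "\<dots> = exp (w * of_real y) * of_real (exp (- b * y)) * of_real (exp (- exp (\<alpha> * y)))"
      unfolding lap of_real_mult by (simp only: mult.assoc)
    also have "exp (w * of_real y) * of_real (exp (- b * y)) = exp ((w - of_real b) * of_real y)"
      unfolding exp_of_real[symmetric] exp_add[symmetric] by (simp add: algebra_simps)
    finally show ?thesis .
  qed
  have norm_int: "(LBINT x. norm (K y x)) = Re (exp ((of_real (Re w) - of_real b) * of_real y) * of_real (exp (- exp (\<alpha> * y))))" for y
  proof -
    have "(LBINT x. norm (K y x)) = (LBINT x. exp (Re w * y) * (exp (- exp (y + x)) * h x))"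
      using h(2) by (intro Bochner_Integration.integral_cong) (auto simp: K_def norm_mult)
    also have "\<dots> = exp (Re w * y) * (exp (- b * y) * exp (- exp (\<alpha> * y)))"
      by (simp only: integral_mult_right_zero lap)
    also have "\<dots> = exp (Re w * y) * exp (- b * y) * exp (- exp (\<alpha> * y))"
      by (simp only: mult.assoc)
    also have "exp (Re w * y) * exp (- b * y) = exp ((Re w - b) * y)"
      unfolding exp_add[symmetric] by (simp add: algebra_simps)
    also have "exp ((Re w - b) * y) * exp (- exp (\<alpha> * y)) = Re (of_real (exp ((Re w - b) * y) * exp (- exp (\<alpha> * y))))"
      by (simp only: Re_complex_of_real)
    also have "of_real (exp ((Re w - b) * y) * exp (- exp (\<alpha> * y))) =
        exp ((of_real (Re w) - of_real b) * of_real y) * complex_of_real (exp (- exp (\<alpha> * y)))"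
      by (metis exp_of_real of_real_diff of_real_mult)
    finally show ?thesis .
  qed
  have prod_int: "integrable (lborel \<Otimes>\<^sub>M lborel) (\<lambda>(y, x). K y x)"
  proof (rule lborel_pair.Fubini_integrable)
    have "integrable lborel (\<lambda>y. Re (exp ((of_real (Re w) - of_real b) * of_real y) * of_real (exp (- exp (\<alpha> * y)))))"
      using w by (intro integrable_Re outer(1)) auto
    thus "integrable lborel (\<lambda>y. LBINT x. norm (case (y, x) of (y, x) \<Rightarrow> K y x))"
      by (simp add: norm_int)
    show "AE y in lborel. integrable lborel (\<lambda>x. case (y, x) of (y, x) \<Rightarrow> K y x)"
      using inner_y by simp
  qed measurable
  have inner_x: "(LBINT y. K y x) = Gamma w * (exp (- (w * of_real x)) * of_real (h x))" for x
  proof -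
    define G where "G = (\<lambda>x::real. exp (w * of_real x) * of_real (exp (- exp x)) :: complex)"
    have "Re w > 0" using w b by linarith
    have "K y x = exp (- (w * of_real x)) * of_real (h x) * G (x + 1 * y)" for y
      by (simp add: K_def G_def ring_distribs exp_add exp_minus field_simps)
    hence "(LBINT y. K y x) = exp (- (w * of_real x)) * of_real (h x) * (LBINT y. G (x + 1 * y))"
      by (simp only: integral_mult_right_zero)
    also have "(LBINT y. G (x + 1 * y)) = (LBINT y. G y)"
      using lborel_integral_real_affine[of 1 G x] by simp
    also have "\<dots> = Gamma w" unfolding G_def by (rule Gamma_log_integral(2)) fact
    finally show ?thesis by simp
  qed
  have Gnz: "Gamma w \<noteq> 0"
    using w b by (auto simp: Gamma_eq_zero_iff elim!: nonpos_Ints_cases)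
  have "integrable lborel (\<lambda>x. inverse (Gamma w) * (LBINT y. K y x))"
    by (intro integrable_mult_right lborel_pair.integrable_snd[OF prod_int])
  thus int2: "integrable lborel (\<lambda>x. exp (- (w * of_real x)) * of_real (h x))"
    unfolding inner_x using Gnz by (simp add: mult.assoc[symmetric])
  have "(LBINT x. LBINT y. K y x) = (LBINT y. LBINT x. K y x)"
    by (rule lborel_pair.Fubini_integral[OF prod_int])
  hence "Gamma w * (LBINT x. exp (- (w * of_real x)) * of_real (h x)) = Gamma ((w - of_real b) / of_real \<alpha>) / of_real \<alpha>"
    unfolding inner_x inner_int outer(2)[OF w] by (simp only: integral_mult_right_zero)
  moreover have "X = c * inverse G / d" if "G * X = c / d" "G \<noteq> 0" for X c d G :: complex
  proof -
    have "X = inverse G * (G * X)" using that(2) by (simp add: mult.assoc[symmetric])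
    also have "\<dots> = c * inverse G / d" unfolding that(1) by (simp add: divide_inverse mult_ac)
    finally show ?thesis .
  qed
  ultimately show "(LBINT x. exp (- (w * of_real x)) * of_real (h x)) = stable_mellin \<alpha> b w"
    using Gnz unfolding stable_mellin_def rGamma_inverse_Gamma by blast
qed

section \<open>Fourier inversion\<close>

lemma continuous_eq_of_integral_eq:
  fixes p q :: "real \<Rightarrow> complex"
  assumes "continuous_on UNIV p" "continuous_on UNIV q"
    and eq: "\<And>a b. a \<le> b \<Longrightarrow> integral {a..b} p = integral {a..b} q"
  shows "p x = q x"
proof -
  have D: "((\<lambda>u. integral {x - 1..u} f) has_vector_derivative f x) (at x)" if "continuous_on UNIV f" for f :: "real \<Rightarrow> complex"
  proof -
    have "((\<lambda>u. integral {x - 1..u} f) has_vector_derivative f x) (at x within {x - 1..x + 1})"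
      by (intro integral_has_vector_derivative continuous_on_subset[OF that]) auto
    thus ?thesis by (subst (asm) at_within_interior) auto
  qed
  from D[OF assms(1)] have "((\<lambda>u. integral {x - 1..u} q) has_vector_derivative p x) (at x)"
    by (rule has_vector_derivative_transform_within_open[of _ _ _ "{x - 1<..}"]) (auto intro!: eq)
  moreover have "((\<lambda>u. integral {x - 1..u} q) has_vector_derivative q x) (at x)" by (rule D[OF assms(2)])
  ultimately show ?thesis by (rule vector_derivative_unique_at)
qed

definition fourier_kernel :: "real \<Rightarrow> real \<Rightarrow> real \<Rightarrow> complex" where
  "fourier_kernel a b t = (iexp (- (t * a)) - iexp (- (t * b))) / (\<i> * of_real t)"

lemma fourier_kernel_integral:
  assumes "a \<le> b" "t \<noteq> 0"
  shows "(LINT x:{a..b}|lborel. iexp (- (t * x))) = fourier_kernel a b t"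
proof -
  define c where "c = - (\<i> * of_real t)"
  have c: "c \<noteq> 0" using assms(2) by (simp add: c_def)
  have ie: "iexp (- (t * x)) = exp (c * of_real x)" for x by (simp add: c_def mult.assoc)
  have "((\<lambda>x. iexp (- (t * x))) has_integral (exp (c * of_real b) / c - exp (c * of_real a) / c)) {a..b}"
    unfolding ie
  proof (rule fundamental_theorem_of_calculus[OF assms(1)])
    fix x :: real
    have "((\<lambda>z. exp (c * z) / c) has_field_derivative exp (c * of_real x)) (at (of_real x))"
      using c by (auto intro!: derivative_eq_intros)
    thus "((\<lambda>x. exp (c * of_real x) / c) has_vector_derivative exp (c * of_real x)) (at x within {a..b})"
      by (rule has_vector_derivative_real_field)
  qed
  moreover have "set_integrable lborel {a..b} (\<lambda>x. iexp (- (t * x)))"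
    by (intro borel_integrable_atLeastAtMost' continuous_intros)
  ultimately have "(LINT x:{a..b}|lborel. iexp (- (t * x))) = exp (c * of_real b) / c - exp (c * of_real a) / c"
    by (metis integral_unique set_borel_integral_eq_integral(2))
  also have "\<dots> = fourier_kernel a b t"
    using assms(2) by (simp add: fourier_kernel_def c_def diff_divide_distrib mult.assoc)
  finally show ?thesis .
qed

lemma isCont_parameter_integral:
  fixes f :: "real \<Rightarrow> real \<Rightarrow> 'b :: {banach, second_countable_topology}"
  assumes cont: "\<And>t. isCont (\<lambda>x. f x t) x"
    and meas: "\<And>x. f x \<in> borel_measurable lborel"
    and w: "integrable lborel w" and bound: "\<And>x t. norm (f x t) \<le> w t"
  shows "isCont (\<lambda>x. LBINT t. f x t) x"
proof (rule continuous_at_sequentiallyI)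
  fix u :: "nat \<Rightarrow> real" assume u: "u \<longlonglongrightarrow> x"
  show "(\<lambda>n. LBINT t. f (u n) t) \<longlonglongrightarrow> (LBINT t. f x t)"
  proof (rule integral_dominated_convergence[where w = w])
    show "AE t in lborel. (\<lambda>n. f (u n) t) \<longlonglongrightarrow> f x t"
      using isCont_tendsto_compose[OF cont u] by simp
  qed (use assms in auto)
qed

text \<open>
  After normalisation \<open>p\<close> is a probability density, and Levy's inversion formula gives its integral over any
  interval.  As the transform is integrable, this is also the integral of the candidate density \<open>d\<close>, and two
  continuous functions with equal integrals over all intervals agree everywhere.
\<close>
lemma fourier_inversion:
  fixes p :: "real \<Rightarrow> real"
  assumes cont: "continuous_on UNIV p" and nonneg: "\<And>x. p x \<ge> 0" and int: "integrable lborel p"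
    and \<phi>: "\<And>t. (LBINT x. iexp (t * x) * of_real (p x)) = \<phi> t"
    and int\<phi>: "integrable lborel \<phi>"
  shows "of_real (p x) = 1 / (2 * of_real pi) * (LBINT t. iexp (- (t * x)) * \<phi> t)"
proof -
  have pm[measurable]: "p \<in> borel_measurable borel"
    using cont by (rule borel_measurable_continuous_onI)
  have \<phi>m[measurable]: "\<phi> \<in> borel_measurable borel" using int\<phi> by simp
  define d where "d = (\<lambda>x. 1 / (2 * of_real pi) * (LBINT t. iexp (- (t * x)) * \<phi> t))"
  have int_prod: "integrable lborel (\<lambda>t. iexp (- (t * x)) * \<phi> t)" for x
    by (rule Bochner_Integration.integrable_bound[OF int\<phi>]) (auto simp: norm_mult)
  have dcont: "continuous_on UNIV d"
  proof -
    have "continuous (at x) (\<lambda>x. LBINT t. iexp (- (t * x)) * \<phi> t)" for x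
      by (rule isCont_parameter_integral[where w = "\<lambda>t. norm (\<phi> t)"])
         (use int\<phi> in \<open>auto simp: norm_mult intro!: continuous_intros\<close>)
    thus ?thesis unfolding d_def
      by (intro continuous_intros continuous_at_imp_continuous_on) auto
  qed
  define P where "P = (LBINT x. p x)"
  have P0: "P \<ge> 0" unfolding P_def using nonneg by (intro Bochner_Integration.integral_nonneg) auto
  have "of_real (p x) = d x"
  proof (cases "P = 0")
    case True
    hence ae: "AE x in lborel. p x = 0"
      using integral_nonneg_eq_0_iff_AE[OF int] nonneg by (auto simp: P_def)
    have "\<phi> t = 0" for t
    proof -
      have "(LBINT x. iexp (t * x) * of_real (p x)) = (LBINT x::real. 0)"
        by (rule Bochner_Integration.integral_cong_AE) (use ae in auto)
      thus ?thesis using \<phi>[of t] by simp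
    qed
    hence "d x = 0" by (simp add: d_def)
    moreover have "complex_of_real (p x) = 0"
    proof (rule continuous_eq_of_integral_eq[where p = "\<lambda>x. complex_of_real (p x)" and q = "\<lambda>_. 0"])
      show "continuous_on UNIV (\<lambda>x. complex_of_real (p x))" using cont by (intro continuous_intros)
      fix a b :: real
      have "(LINT x:{a..b}|lborel. complex_of_real (p x)) = (LBINT x::real. 0)"
        unfolding set_lebesgue_integral_def by (rule Bochner_Integration.integral_cong_AE) (use ae in auto)
      moreover have "(LINT x:{a..b}|lborel. complex_of_real (p x)) = integral {a..b} (\<lambda>x. complex_of_real (p x))"
        using cont by (intro set_borel_integral_eq_integral borel_integrable_atLeastAtMost')
          (auto intro!: continuous_intros elim: continuous_on_subset)
      ultimately show "integral {a..b} (\<lambda>x. complex_of_real (p x)) = integral {a..b} (\<lambda>_. 0)" by simp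
    qed simp
    ultimately show ?thesis by simp
  next
    case False
    with P0 have P: "P > 0" by simp
    define M where "M = density lborel (\<lambda>x. ennreal (p x / P))"
    have dens: "prob_space M"
    proof
      have "emeasure M (space M) = (\<integral>\<^sup>+x. ennreal (p x / P) \<partial>lborel)"
        unfolding M_def by (subst emeasure_density) auto
      also have "\<dots> = ennreal (LBINT x. p x / P)"
        using P nonneg int by (intro nn_integral_eq_integral) auto
      also have "(LBINT x. p x / P) = 1" using P by (simp add: P_def)
      finally show "emeasure M (space M) = 1" by simp
    qed
    interpret M: real_distribution M
      using dens by (simp add: real_distribution_def real_distribution_axioms_def M_def)
    have meas: "measure M A = (LINT x:A|lborel. p x) / P" if "A \<in> sets borel" for A
    proof -
      have "emeasure M A = (\<integral>\<^sup>+x. ennreal (p x / P) * indicator A x \<partial>lborel)"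
        unfolding M_def using that by (subst emeasure_density) auto
      also have "\<dots> = (\<integral>\<^sup>+x. ennreal (indicator A x *\<^sub>R p x / P) \<partial>lborel)"
        by (intro nn_integral_cong) (auto simp: indicator_def)
      also have "\<dots> = ennreal (LBINT x. indicator A x *\<^sub>R p x / P)"
        using that int P nonneg
        by (intro nn_integral_eq_integral integrable_divide integrable_mult_indicator) auto
      also have "(LBINT x. indicator A x *\<^sub>R p x / P) = (LINT x:A|lborel. p x) / P"
        by (simp add: set_lebesgue_integral_def)
      finally have "emeasure M A = ennreal ((LINT x:A|lborel. p x) / P)" .
      thus ?thesis unfolding measure_def using P nonneg
        by (simp add: set_lebesgue_integral_def Bochner_Integration.integral_nonneg)
    qed
    have atoms: "measure M {a} = 0" for a
    proof -
      have "(LINT x:{a}|lborel. p x) = (LBINT x::real. 0)"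
        unfolding set_lebesgue_integral_def
      proof (rule Bochner_Integration.integral_cong_AE)
        show "AE x in lborel. indicator {a} x *\<^sub>R p x = 0"
          using AE_lborel_singleton[of a] by eventually_elim auto
      qed auto
      thus ?thesis by (subst meas) auto
    qed
    have char: "char M t = \<phi> t / of_real P" for t
    proof -
      have "char M t = (LBINT x. (p x / P) *\<^sub>R iexp (t * x))"
        unfolding char_def M_def using P nonneg by (subst integral_density) auto
      also have "\<dots> = (LBINT x. iexp (t * x) * of_real (p x) / of_real P)"
        by (intro Bochner_Integration.integral_cong refl) (simp add: scaleR_conv_of_real)
      also have "\<dots> = (LBINT x. iexp (t * x) * of_real (p x)) / of_real P"
        by (rule integral_divide_zero)
      also have "\<dots> = \<phi> t / of_real P" unfolding \<phi> ..
      finally show ?thesis .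
    qed
    show ?thesis
    proof (rule continuous_eq_of_integral_eq[where p = "\<lambda>x. of_real (p x)" and q = d])
      show "continuous_on UNIV (\<lambda>x. complex_of_real (p x))" using cont by (intro continuous_intros)
      show "continuous_on UNIV d" by (rule dcont)
      fix a b :: real assume ab: "a \<le> b"
      have kb: "norm (fourier_kernel a b t) \<le> b - a" for t
      proof (cases "t = 0")
        case False
        have "norm (fourier_kernel a b t) = norm ((iexp (t * (-a)) - iexp (t * (-b))) / (\<i> * of_real t))"
          by (simp add: fourier_kernel_def)
        also have "\<dots> \<le> - a - (- b)" using ab False by (intro Levy_Inversion_aux2) auto
        finally show ?thesis by simp
      qed (use ab in \<open>simp add: fourier_kernel_def\<close>)
      have km[measurable]: "fourier_kernel a b \<in> borel_measurable borel"
        unfolding fourier_kernel_def[abs_def] by measurable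
      define k where "k = (\<lambda>t. fourier_kernel a b t * \<phi> t)"
      have km'[measurable]: "k \<in> borel_measurable borel" unfolding k_def by measurable
      have kint: "integrable lborel k"
      proof (rule Bochner_Integration.integrable_bound)
        show "integrable lborel (\<lambda>t. (b - a) * norm (\<phi> t))" using int\<phi> by auto
        show "AE t in lborel. norm (k t) \<le> norm ((b - a) * norm (\<phi> t))"
          using kb ab by (intro AE_I2) (simp add: k_def norm_mult mult_right_mono)
      qed simp
      \<comment> \<open>Levy's formula is a principal value; by integrability of \<open>\<phi>\<close> it becomes an integral over the whole line.\<close>
      have lim1: "(\<lambda>T. of_real (1 / (2 * pi)) * (CLBINT t=ereal (real_of_int (- int T))..ereal (real T).
              fourier_kernel a b t * char M t)) \<longlonglongrightarrow> of_real (measure M {a<..b})"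
        using M.Levy_Inversion[OF ab atoms atoms] by (simp add: fourier_kernel_def)
      have eqT: "(CLBINT t=ereal (real_of_int (- int T))..ereal (real T). fourier_kernel a b t * char M t) =
              (LBINT t. indicator {- real T<..<real T} t *\<^sub>R (k t / of_real P))" for T
        by (simp add: interval_lebesgue_integral_def set_lebesgue_integral_def einterval_eq char k_def scaleR_conv_of_real)
      have lim2: "(\<lambda>T. LBINT t. indicator {- real T<..<real T} t *\<^sub>R (k t / of_real P)) \<longlonglongrightarrow> (LBINT t. k t / of_real P)"
      proof (rule integral_dominated_convergence[where w = "\<lambda>t. norm (k t / of_real P)"])
        show "AE t in lborel. (\<lambda>T. indicator {- real T<..<real T} t *\<^sub>R (k t / of_real P)) \<longlonglongrightarrow> k t / of_real P"
        proof (rule AE_I2)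
          fix t :: real
          obtain N :: nat where N: "\<bar>t\<bar> < real N" using reals_Archimedean2 by blast
          have "eventually (\<lambda>T. indicator {- real T<..<real T} t *\<^sub>R (k t / of_real P) = k t / of_real P) sequentially"
            using eventually_ge_at_top[of N]
          proof eventually_elim
            case (elim T)
            hence "real N \<le> real T" by simp
            hence "t \<in> {- real T<..<real T}" using N by auto
            thus ?case by simp
          qed
          thus "(\<lambda>T. indicator {- real T<..<real T} t *\<^sub>R (k t / of_real P)) \<longlonglongrightarrow> k t / of_real P"
            by (rule tendsto_eventually)
        qed
        show "integrable lborel (\<lambda>t. norm (k t / of_real P))" using kint by auto
        show "AE t in lborel. norm (indicator {- real T<..<real T} t *\<^sub>R (k t / of_real P)) \<le> norm (k t / of_real P)" for T
          by (intro AE_I2) (auto simp: indicator_def)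
      qed auto
      have "of_real (measure M {a<..b}) = of_real (1 / (2 * pi)) * (LBINT t. k t / of_real P)"
        by (rule LIMSEQ_unique[OF lim1]) (unfold eqT, intro tendsto_intros lim2)
      hence "of_real (P * measure M {a<..b}) = 1 / (2 * of_real pi) * (LBINT t. k t)"
        using P by simp
      also have "P * measure M {a<..b} = (LINT x:{a..b}|lborel. p x)"
      proof -
        have "measure M {a..b} = measure M {a<..b} + measure M {a}"
          using ab by (subst M.finite_measure_Union[symmetric]) (auto intro: arg_cong[of _ _ "measure M"])
        hence "measure M {a<..b} = (LINT x:{a..b}|lborel. p x) / P"
          using meas[of "{a..b}"] atoms[of a] by simp
        thus ?thesis using P by simp
      qed
      also have "of_real (LINT x:{a..b}|lborel. p x) = (LINT x:{a..b}|lborel. complex_of_real (p x))"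
        by (simp add: set_integral_complex_of_real)
      also have "\<dots> = integral {a..b} (\<lambda>x. complex_of_real (p x))"
        using cont by (intro set_borel_integral_eq_integral borel_integrable_atLeastAtMost')
          (auto intro!: continuous_intros elim: continuous_on_subset)
      finally have L: "integral {a..b} (\<lambda>x. complex_of_real (p x)) = 1 / (2 * of_real pi) * (LBINT t. k t)" .
      \<comment> \<open>The kernel of Levy's formula is itself the integral of \<open>exp(- i t x)\<close> over \<open>[a, b]\<close>, except at \<open>t = 0\<close>.\<close>
      have "(LBINT t. k t) = (LBINT t. LBINT x. indicator {a..b} x *\<^sub>R (iexp (- (t * x)) * \<phi> t))"
      proof (rule Bochner_Integration.integral_cong_AE)
        show "(\<lambda>t. LBINT x. indicator {a..b} x *\<^sub>R (iexp (- (t * x)) * \<phi> t)) \<in> borel_measurable lborel"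
          by measurable
        show "AE t in lborel. k t = (LBINT x. indicator {a..b} x *\<^sub>R (iexp (- (t * x)) * \<phi> t))"
          using AE_lborel_singleton[of 0]
        proof eventually_elim
          case (elim t)
          have "(LBINT x. indicator {a..b} x *\<^sub>R (iexp (- (t * x)) * \<phi> t)) = (LINT x:{a..b}|lborel. iexp (- (t * x))) * \<phi> t"
            unfolding set_lebesgue_integral_def by (simp flip: integral_mult_left_zero)
          thus ?case using fourier_kernel_integral[OF ab elim] by (simp add: k_def)
        qed
      qed auto
      also have "\<dots> = (LBINT x. LBINT t. indicator {a..b} x *\<^sub>R (iexp (- (t * x)) * \<phi> t))"
      proof (rule lborel_pair.Fubini_integral, rule lborel_pair.Fubini_integrable)
        show "(\<lambda>(x, t). indicator {a..b} x *\<^sub>R (iexp (- (t * x)) * \<phi> t)) \<in> borel_measurable (lborel \<Otimes>\<^sub>M lborel)"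
          by measurable
        have "(LBINT t. norm (indicator {a..b} x *\<^sub>R (iexp (- (t * x)) * \<phi> t))) = indicator {a..b} x *\<^sub>R (LBINT t. norm (\<phi> t))" for x
          by (simp add: norm_mult)
        moreover have "integrable lborel (\<lambda>x::real. indicator {a..b} x *\<^sub>R (LBINT t. norm (\<phi> t)))"
        proof (intro integrable_scaleR_left)
          show "integrable lborel (indicat_real {a..b})"
            by (rule integrable_real_indicator) (auto simp: emeasure_lborel_Icc_eq)
        qed
        ultimately show "integrable lborel (\<lambda>x. LBINT t. norm (case (x, t) of (x, t) \<Rightarrow> indicator {a..b} x *\<^sub>R (iexp (- (t * x)) * \<phi> t)))"
          by (simp only: prod.case)
        show "AE x in lborel. integrable lborel (\<lambda>t. case (x, t) of (x, t) \<Rightarrow> indicator {a..b} x *\<^sub>R (iexp (- (t * x)) * \<phi> t))"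
          using int_prod by (intro AE_I2) auto
      qed
      also have "\<dots> = (LINT x:{a..b}|lborel. LBINT t. iexp (- (t * x)) * \<phi> t)"
        by (simp add: set_lebesgue_integral_def)
      finally have "1 / (2 * of_real pi) * (LBINT t. k t) = (LINT x:{a..b}|lborel. d x)"
        by (simp add: d_def set_lebesgue_integral_def)
      also have "\<dots> = integral {a..b} d"
        using dcont by (intro set_borel_integral_eq_integral borel_integrable_atLeastAtMost')
          (auto elim: continuous_on_subset)
      finally show "integral {a..b} (\<lambda>x. complex_of_real (p x)) = integral {a..b} d" using L by simp
    qed
  qed
  thus ?thesis by (simp add: d_def)
qed

section \<open>Stable densities and their fractional integrals\<close>

text \<open>
  Nonnegativity makes the tilted functions \<open>t\<^sup>-\<^sup>c q(t)\<close> multiples of probability densities, and continuity makes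
  their inversion formula hold at every point.
\<close>
definition stable_laplace :: "(real \<Rightarrow> real) \<Rightarrow> real \<Rightarrow> real \<Rightarrow> bool" where
  "stable_laplace q \<alpha> b \<longleftrightarrow>
     continuous_on {0<..} q \<and> (\<forall>t>0. q t \<ge> 0) \<and>
     (\<forall>l>0. set_integrable lborel {0<..} (\<lambda>t. exp (- l * t) * q t) \<and>
        (LINT t:{0<..}|lborel. exp (- l * t) * q t) = l powr (- b) * exp (- (l powr \<alpha>)))"

text \<open>
  Tilting by \<open>exp(-c x)\<close>, with \<open>c > b\<close>, makes \<open>h(x) = exp x q(exp x)\<close> integrable, and the Fourier transform of the
  tilted function is the Mellin transform of \<open>q\<close> on the line with real part \<open>c\<close>.
\<close>
lemma stable_mellin_inversion:
  assumes q: "stable_laplace q \<alpha> b" and \<alpha>: "\<alpha> > 0" and b: "0 \<le> b" "b < c"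
    and int: "integrable lborel (\<lambda>\<tau>. stable_mellin \<alpha> b (Complex c \<tau>))" and t: "t > 0"
  shows "complex_of_real (q t) = of_real (t powr (c - 1)) / (2 * of_real pi) *
     (LBINT \<tau>. stable_mellin \<alpha> b (Complex c \<tau>) * iexp (\<tau> * ln t))"
proof -
  have cont: "continuous_on {0<..} q" and nonneg: "\<And>t. t > 0 \<Longrightarrow> q t \<ge> 0"
    and lap: "\<And>l. l > 0 \<Longrightarrow> set_integrable lborel {0<..} (\<lambda>t. exp (- l * t) * q t)"
      "\<And>l. l > 0 \<Longrightarrow> (LINT t:{0<..}|lborel. exp (- l * t) * q t) = l powr (- b) * exp (- (l powr \<alpha>))"
    using q by (auto simp: stable_laplace_def)
  define h where "h = (\<lambda>x. q (exp x) * exp x)"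
  have hcont: "continuous_on UNIV h"
    unfolding h_def by (intro continuous_intros continuous_on_compose2[OF cont]) auto
  hence hm: "h \<in> borel_measurable borel" by (rule borel_measurable_continuous_onI)
  have h0: "h x \<ge> 0" for x using nonneg[of "exp x"] by (simp add: h_def)
  have log: "integrable lborel (\<lambda>x. exp (- exp (y + x)) * h x)"
    "(LBINT x. exp (- exp (y + x)) * h x) = exp (- b * y) * exp (- exp (\<alpha> * y))" for y
  proof -
    define g where "g = (\<lambda>t. indicator {0<..} t *\<^sub>R (exp (- exp y * t) * q t))"
    have gm: "g \<in> borel_measurable borel"
      unfolding g_def by (rule borel_measurable_continuous_on_indicator) (auto intro!: continuous_intros cont)
    have eq: "exp x *\<^sub>R g (exp x) = exp (- exp (y + x)) * h x" for x
      by (simp add: g_def h_def exp_add)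
    have ind: "indicator {0<..} t *\<^sub>R g t = indicator {0<..} t *\<^sub>R (exp (- exp y * t) * q t)" for t
      by (simp add: g_def indicator_def)
    have "set_integrable lborel {0<..} g"
      using lap(1)[of "exp y"] unfolding set_integrable_def ind by simp
    thus "integrable lborel (\<lambda>x. exp (- exp (y + x)) * h x)"
      unfolding exp_substitution(1)[OF gm] eq .
    have "(LINT t:{0<..}|lborel. g t) = exp y powr (- b) * exp (- (exp y powr \<alpha>))"
      using lap(2)[of "exp y"] unfolding set_lebesgue_integral_def ind by simp
    thus "(LBINT x. exp (- exp (y + x)) * h x) = exp (- b * y) * exp (- exp (\<alpha> * y))"
      unfolding exp_substitution(2)[OF gm] eq by (simp add: powr_def)
  qed
  note mellin = mellin_of_log_laplace[OF hm h0 log \<alpha> b(1)]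
  define p where "p = (\<lambda>x. exp (- (c * x)) * h x)"
  define g where "g = (\<lambda>\<tau>. stable_mellin \<alpha> b (Complex c \<tau>))"
  have pcont: "continuous_on UNIV p" unfolding p_def by (intro continuous_intros hcont)
  have p0: "p x \<ge> 0" for x using h0 by (simp add: p_def)
  have pint: "integrable lborel p"
  proof -
    have "integrable lborel (\<lambda>x. Re (exp (- (of_real c * of_real x)) * of_real (h x)))"
      using b by (intro integrable_Re mellin(1)) auto
    also have "(\<lambda>x. Re (exp (- (of_real c * of_real x)) * of_real (h x))) = p"
    proof
      fix x
      have "exp (- (of_real c * of_real x)) * of_real (h x) = complex_of_real (p x)"
        unfolding p_def of_real_mult exp_of_real[symmetric] by simp
      thus "Re (exp (- (of_real c * of_real x)) * of_real (h x)) = p x" by simp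
    qed
    finally show ?thesis .
  qed
  have four: "(LBINT x. iexp (\<tau> * x) * of_real (p x)) = g (0 + (-1) * \<tau>)" for \<tau>
  proof -
    have "iexp (\<tau> * x) * of_real (p x) = exp (- (Complex c (- \<tau>) * of_real x)) * of_real (h x)" for x
    proof -
      have "iexp (\<tau> * x) * of_real (exp (- (c * x))) = exp (- (Complex c (- \<tau>) * of_real x))"
        unfolding exp_of_real[symmetric] exp_add[symmetric]
        by (rule arg_cong[of _ _ exp]) (simp add: complex_eq_iff)
      thus ?thesis by (simp add: p_def mult.assoc[symmetric])
    qed
    hence "(LBINT x. iexp (\<tau> * x) * of_real (p x)) = (LBINT x. exp (- (Complex c (- \<tau>) * of_real x)) * of_real (h x))"
      by (simp only:)
    also have "\<dots> = g (0 + (-1) * \<tau>)"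
      using mellin(2)[of "Complex c (- \<tau>)"] b by (simp add: g_def)
    finally show ?thesis .
  qed
  have gint: "integrable lborel g" using int by (simp add: g_def)
  have gint': "integrable lborel (\<lambda>\<tau>. g (0 + (-1) * \<tau>))"
    by (rule lborel_integrable_real_affine[OF gint]) simp
  define x where "x = ln t"
  have "of_real (p x) = 1 / (2 * of_real pi) * (LBINT \<tau>. iexp (- (\<tau> * x)) * g (0 + (-1) * \<tau>))"
    by (rule fourier_inversion[OF pcont p0 pint four gint'])
  also have "(LBINT \<tau>. iexp (- (\<tau> * x)) * g (0 + (-1) * \<tau>)) = (LBINT \<tau>. g \<tau> * iexp (\<tau> * x))"
  proof -
    define G where "G = (\<lambda>\<tau>. g \<tau> * iexp (\<tau> * x))"
    have "(LBINT \<tau>. G \<tau>) = \<bar>-1\<bar> *\<^sub>R (LBINT \<tau>. G (0 + (-1) * \<tau>))"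
      by (rule lborel_integral_real_affine) simp
    also have "(\<lambda>\<tau>. G (0 + (-1) * \<tau>)) = (\<lambda>\<tau>. iexp (- (\<tau> * x)) * g (0 + (-1) * \<tau>))"
      by (simp add: G_def fun_eq_iff)
    finally show ?thesis by (simp add: G_def)
  qed
  finally have "of_real (p x) = 1 / (2 * of_real pi) * (LBINT \<tau>. g \<tau> * iexp (\<tau> * x))" .
  moreover have "q t = t powr (c - 1) * p x"
    using t by (simp add: p_def h_def x_def powr_def algebra_simps exp_diff exp_minus)
  ultimately show ?thesis by (simp add: g_def x_def)
qed

text \<open>
  Integrability comes for free: the integral of a function that is not integrable is 0, but the Laplace transform is positive.
\<close>
lemma stable_density_laplace:
  assumes "stable_density_of M \<alpha> S f"
  shows "stable_laplace f \<alpha> 0"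
proof -
  have ps: "positive_stable M \<alpha> S"
    and dist: "distributed M lborel S (\<lambda>x. ennreal (indicator {0<..} x * f x))"
    and cont: "continuous_on {0<..} f" and nonneg: "\<And>x. x > 0 \<Longrightarrow> 0 \<le> f x"
    using assms by (auto simp: stable_density_of_def)
  have "set_integrable lborel {0<..} (\<lambda>t. exp (- l * t) * f t) \<and>
        (LINT t:{0<..}|lborel. exp (- l * t) * f t) = l powr (- 0) * exp (- (l powr \<alpha>))" if l: "l > 0" for l
  proof -
    have "(\<integral>x. indicator {0<..} x * f x * exp (- l * x) \<partial>lborel) = (\<integral>x. exp (- l * S x) \<partial>M)"
      using nonneg by (intro distributed_integral[OF dist]) (auto simp: indicator_def)
    also have "\<dots> = exp (- (l powr \<alpha>))" using ps l by (simp add: positive_stable_def)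
    also have "(\<lambda>x. indicator {0<..} x * f x * exp (- l * x)) = (\<lambda>x. indicator {0<..} x *\<^sub>R (exp (- l * x) * f x))"
      by (auto simp: fun_eq_iff indicator_def)
    finally have eq: "(LINT t:{0<..}|lborel. exp (- l * t) * f t) = exp (- (l powr \<alpha>))"
      by (simp add: set_lebesgue_integral_def)
    have "set_integrable lborel {0<..} (\<lambda>t. exp (- l * t) * f t)"
    proof (rule ccontr)
      assume "\<not> set_integrable lborel {0<..} (\<lambda>t. exp (- l * t) * f t)"
      hence "(LINT t:{0<..}|lborel. exp (- l * t) * f t) = 0"
        unfolding set_integrable_def set_lebesgue_integral_def by (rule not_integrable_integral_eq)
      thus False using eq by simp
    qed
    thus ?thesis using eq l by simp
  qed
  thus ?thesis using cont nonneg by (auto simp: stable_laplace_def)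
qed

text \<open>
  The fractional integral of order \<open>b\<close>, the integral of \<open>f(v) (t - v)\<^sup>b\<^sup>-\<^sup>1 / \<Gamma>(b)\<close> over \<open>0 < v < t\<close>, after the
  substitution \<open>v = t u\<close>; in this form it contains the integral of the theorem.
\<close>
definition riemann_liouville :: "real \<Rightarrow> (real \<Rightarrow> real) \<Rightarrow> real \<Rightarrow> real" where
  "riemann_liouville b f t =
     t powr b / Gamma b * (LBINT u=0..1. f (t * u) * (1 - u) powr (b - 1))"

lemma integrable_one_minus_powr:
  fixes b :: real
  assumes "b > 0"
  shows "integrable lborel (\<lambda>u. indicator {0<..<1} u * (1 - u) powr (b - 1))"
proof -
  have "(\<lambda>u. u powr (b - 1)) absolutely_integrable_on {0<..<1::real}"
  proof (rule nonnegative_absolutely_integrable_1)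
    have "(\<lambda>u. u powr (b - 1)) integrable_on {0..1::real}"
      using assms by (intro integrable_on_powr_from_0) auto
    thus "(\<lambda>u. u powr (b - 1)) integrable_on {0<..<1::real}"
      by (simp add: integrable_on_open_interval_real)
  qed auto
  hence "set_integrable lborel {0<..<1} (\<lambda>u::real. u powr (b - 1))"
    unfolding set_integrable_def by (subst (asm) integrable_completion) auto
  hence "integrable lborel (\<lambda>u. (\<lambda>u. indicator {0<..<1} u *\<^sub>R u powr (b - 1)) (1 + (-1) * u))"
    unfolding set_integrable_def by (intro lborel_integrable_real_affine) auto
  thus ?thesis
    by (rule Bochner_Integration.integrable_cong[THEN iffD1, rotated 2]) (auto simp: indicator_def)
qed

lemma nn_integral_exp_powr_shifted:
  fixes b l v :: real
  assumes b: "b > 0" and l: "l > 0"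
  shows "(\<integral>\<^sup>+t. ennreal (indicator {v<..} t * (exp (- l * t) * (t - v) powr (b - 1))) \<partial>lborel) =
     ennreal (exp (- l * v) * l powr (- b) * Gamma b)"
proof -
  define F where "F = (\<lambda>t. indicator {v<..} t * (exp (- l * t) * (t - v) powr (b - 1)))"
  have Fm: "(\<lambda>t. ennreal (F t)) \<in> borel_measurable borel" unfolding F_def by measurable
  have "(\<integral>\<^sup>+t. ennreal (F t) \<partial>lborel) = ennreal \<bar>1 / l\<bar> * (\<integral>\<^sup>+x. ennreal (F (v + 1 / l * x)) \<partial>lborel)"
    using l by (intro nn_integral_real_affine Fm) auto
  also have "\<dots> = (\<integral>\<^sup>+x. ennreal \<bar>1 / l\<bar> * ennreal (F (v + 1 / l * x)) \<partial>lborel)"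
    by (intro nn_integral_cmult[symmetric]) (unfold F_def, measurable)
  also have "\<dots> = (\<integral>\<^sup>+x. ennreal (exp (- l * v) * l powr (- b)) * ennreal (indicator {0..} x * x powr (b - 1) / exp x) \<partial>lborel)"
  proof (rule nn_integral_cong_AE)
    show "AE x in lborel. ennreal \<bar>1 / l\<bar> * ennreal (F (v + 1 / l * x)) =
       ennreal (exp (- l * v) * l powr (- b)) * ennreal (indicator {0..} x * x powr (b - 1) / exp x)"
      using AE_lborel_singleton[of 0]
    proof eventually_elim
      case (elim x)
      show ?case
      proof (cases "x > 0")
        case True
        have "v + 1 / l * x > v" using True l by simp
        hence "F (v + 1 / l * x) = exp (- l * v - x) * (x powr (b - 1) / l powr (b - 1))"
          using True l by (simp add: F_def algebra_simps powr_divide)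
        hence "\<bar>1 / l\<bar> * F (v + 1 / l * x) = exp (- l * v) * l powr (- b) * (indicator {0..} x * x powr (b - 1) / exp x)"
          using True l by (simp add: powr_diff powr_minus exp_diff field_simps)
        thus ?thesis using True l by (simp add: ennreal_mult'[symmetric] F_def)
      next
        case False
        with elim have "x < 0" by simp
        hence "\<not> v + 1 / l * x > v" using l by (simp add: zero_less_divide_iff)
        thus ?thesis using \<open>x < 0\<close> by (simp add: F_def)
      qed
    qed
  qed
  also have "\<dots> = ennreal (exp (- l * v) * l powr (- b)) * (\<integral>\<^sup>+x. ennreal (indicator {0..} x * x powr (b - 1) / exp x) \<partial>lborel)"
    by (intro nn_integral_cmult) measurable
  also have "(\<integral>\<^sup>+x. ennreal (indicator {0..} x * x powr (b - 1) / exp x) \<partial>lborel) = ennreal (Gamma b)"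
    using Gamma_conv_nn_integral_real[OF b] by simp
  also have "ennreal (exp (- l * v) * l powr (- b)) * ennreal (Gamma b) = ennreal (exp (- l * v) * l powr (- b) * Gamma b)"
    using b by (subst ennreal_mult'[symmetric]) auto
  finally show ?thesis unfolding F_def .
qed

text \<open>
  Fractional integration multiplies the Laplace transform by \<open>l\<^sup>-\<^sup>b\<close>, by Tonelli's theorem.  The bound on \<open>f\<close>
  dominates \<open>f(t u) (1 - u)\<^sup>b\<^sup>-\<^sup>1\<close> uniformly in \<open>t\<close> and so gives continuity.
\<close>
lemma stable_laplace_riemann_liouville:
  assumes f: "stable_laplace f \<alpha> 0" and b: "b > 0" and bound: "\<And>t. t > 0 \<Longrightarrow> f t \<le> C"
  shows "stable_laplace (riemann_liouville b f) \<alpha> b"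
proof -
  have cont: "continuous_on {0<..} f" and nonneg: "\<And>t. t > 0 \<Longrightarrow> f t \<ge> 0"
    and lap: "\<And>l. l > 0 \<Longrightarrow> set_integrable lborel {0<..} (\<lambda>t. exp (- l * t) * f t)"
      "\<And>l. l > 0 \<Longrightarrow> (LINT t:{0<..}|lborel. exp (- l * t) * f t) = exp (- (l powr \<alpha>))"
    using f by (auto simp: stable_laplace_def)
  have C: "C \<ge> 0" using nonneg[of 1] bound[of 1] by simp
  have Gb: "Gamma b > 0" using b by simp
  \<comment> \<open>The values of \<open>f\<close> on \<open>{..0}\<close> are arbitrary, so \<open>f\<close> is first cut off to obtain a Borel function.\<close>
  define f0 where "f0 = (\<lambda>t. indicator {0<..} t *\<^sub>R f t)"
  have f0m[measurable]: "f0 \<in> borel_measurable borel"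
    unfolding f0_def by (rule borel_measurable_continuous_on_indicator[OF _ cont]) auto
  have f0: "f0 t = f t" if "t > 0" for t using that by (simp add: f0_def)
  have f0_nonneg: "f0 t \<ge> 0" for t using nonneg by (simp add: f0_def indicator_def)
  have f0_le: "f0 t \<le> C" for t using bound C by (simp add: f0_def indicator_def)
  define k where "k = (\<lambda>t u. indicator {0<..<1} u * (f0 (t * u) * (1 - u) powr (b - 1)))"
  have km[measurable]: "k t \<in> borel_measurable borel" for t unfolding k_def by measurable
  have k_nonneg: "k t u \<ge> 0" for t u unfolding k_def using f0_nonneg by (intro mult_nonneg_nonneg) auto
  have k_bound: "k t u \<le> C * (indicator {0<..<1} u * (1 - u) powr (b - 1))" for t u
    unfolding k_def using f0_le[of "t * u"] by (auto simp: indicator_def intro!: mult_right_mono)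
  have w: "integrable lborel (\<lambda>u. C * (indicator {0<..<1} u * (1 - u) powr (b - 1)))"
    using integrable_one_minus_powr[OF b] by simp
  have kint: "integrable lborel (k t)" for t
    by (rule Bochner_Integration.integrable_bound[OF w]) (use k_nonneg k_bound in \<open>auto simp: abs_le_iff intro!: AE_I2 order_trans[OF k_bound]\<close>)
  define Q where "Q = (\<lambda>t. t powr b / Gamma b * (LBINT u. k t u))"
  have Q: "riemann_liouville b f t = Q t" if "t > 0" for t
  proof -
    have "(LBINT u=0..1. f (t * u) * (1 - u) powr (b - 1)) = (LBINT u. k t u)"
      unfolding interval_lebesgue_integral_def set_lebesgue_integral_def
      using that by (auto simp: einterval_eq k_def f0 zero_ereal_def one_ereal_def indicator_def intro!: Bochner_Integration.integral_cong)
    thus ?thesis by (simp add: riemann_liouville_def Q_def)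
  qed
  have Qcont: "continuous_on {0<..} Q"
  proof -
    have "isCont (\<lambda>x. LBINT u. k (exp x) u) x" for x
    proof (rule isCont_parameter_integral[OF _ _ w])
      show "isCont (\<lambda>x. k (exp x) u) x" for u
      proof (cases "u \<in> {0<..<1}")
        case True
        have "isCont f0 (exp x * u)"
        proof -
          have "continuous_on {0<..} f0" using cont by (rule continuous_on_eq) (simp add: f0)
          thus ?thesis using True by (simp add: continuous_on_eq_continuous_at)
        qed
        moreover have "isCont (\<lambda>x. exp x * u) x" by (intro continuous_intros)
        ultimately have "isCont (\<lambda>x. f0 (exp x * u)) x" by (rule isCont_o2[rotated])
        thus ?thesis unfolding k_def by (intro continuous_intros)
      qed (simp add: k_def)
      show "norm (k (exp x) u) \<le> C * (indicator {0<..<1} u * (1 - u) powr (b - 1))" for x u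
        using k_nonneg k_bound by simp
    qed simp
    hence "continuous_on UNIV (\<lambda>x. LBINT u. k (exp x) u)" by (intro continuous_at_imp_continuous_on) auto
    hence "continuous_on {0<..} (\<lambda>t. LBINT u. k (exp (ln t)) u)"
      by (rule continuous_on_compose2) (auto intro!: continuous_intros)
    hence "continuous_on {0<..} (\<lambda>t. LBINT u. k t u)" by (rule continuous_on_eq) simp
    thus ?thesis unfolding Q_def using Gb by (intro continuous_intros) auto
  qed
  have Q_nonneg: "Q t \<ge> 0" for t
    unfolding Q_def using k_nonneg Gb by (intro mult_nonneg_nonneg Bochner_Integration.integral_nonneg) auto
  \<comment> \<open>Back to the convolution form by \<open>v = t u\<close>; only there does Tonelli's theorem decouple the two variables.\<close>
  have nnQ: "ennreal (Gamma b * Q t) = (\<integral>\<^sup>+v. ennreal (indicator {0<..<t} v * (f0 v * (t - v) powr (b - 1))) \<partial>lborel)"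
    if t: "t > 0" for t
  proof -
    define G where "G = (\<lambda>v. indicator {0<..<t} v * (f0 v * (t - v) powr (b - 1)))"
    have Gm: "(\<lambda>v. ennreal (G v)) \<in> borel_measurable borel" unfolding G_def by measurable
    have "(\<integral>\<^sup>+v. ennreal (G v) \<partial>lborel) = ennreal \<bar>t\<bar> * (\<integral>\<^sup>+u. ennreal (G (0 + t * u)) \<partial>lborel)"
      using t by (intro nn_integral_real_affine Gm) auto
    also have "(\<integral>\<^sup>+u. ennreal (G (0 + t * u)) \<partial>lborel) = (\<integral>\<^sup>+u. ennreal (t powr (b - 1)) * ennreal (k t u) \<partial>lborel)"
    proof (rule nn_integral_cong)
      fix u
      have "G (0 + t * u) = t powr (b - 1) * k t u"
      proof (cases "u \<in> {0<..<1}")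
        case True
        hence "t * u \<in> {0<..<t}" using t by auto
        moreover have "(t - t * u) powr (b - 1) = t powr (b - 1) * (1 - u) powr (b - 1)"
          using True t by (simp add: powr_mult[symmetric] algebra_simps)
        ultimately show ?thesis using True by (simp add: G_def k_def)
      next
        case False
        hence "t * u \<notin> {0<..<t}" using t by (auto simp: zero_less_mult_iff)
        thus ?thesis using False by (simp add: G_def k_def)
      qed
      thus "ennreal (G (0 + t * u)) = ennreal (t powr (b - 1)) * ennreal (k t u)"
        using k_nonneg by (simp add: ennreal_mult')
    qed
    also have "\<dots> = ennreal (t powr (b - 1)) * (\<integral>\<^sup>+u. ennreal (k t u) \<partial>lborel)"
      by (intro nn_integral_cmult) measurable
    also have "(\<integral>\<^sup>+u. ennreal (k t u) \<partial>lborel) = ennreal (LBINT u. k t u)"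
      using kint k_nonneg by (intro nn_integral_eq_integral) auto
    also have "ennreal \<bar>t\<bar> * (ennreal (t powr (b - 1)) * ennreal (LBINT u. k t u)) = ennreal (t * t powr (b - 1) * (LBINT u. k t u))"
      using t k_nonneg by (simp add: ennreal_mult' Bochner_Integration.integral_nonneg mult.assoc)
    also have "t * t powr (b - 1) = t powr b" using t by (simp add: powr_diff)
    also have "t powr b * (LBINT u. k t u) = Gamma b * Q t" using Gb by (simp add: Q_def)
    finally show ?thesis unfolding G_def ..
  qed
  have Qm: "(\<lambda>t. indicator {0<..} t *\<^sub>R Q t) \<in> borel_measurable borel"
    by (rule borel_measurable_continuous_on_indicator[OF _ Qcont]) auto
  have lapQ: "set_integrable lborel {0<..} (\<lambda>t. exp (- l * t) * Q t) \<and>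
       (LINT t:{0<..}|lborel. exp (- l * t) * Q t) = l powr (- b) * exp (- (l powr \<alpha>))" if l: "l > 0" for l
  proof -
    define H where "H = (\<lambda>t. indicator {0<..} t *\<^sub>R (exp (- l * t) * Q t))"
    have H_alt: "H t = exp (- l * t) * (indicator {0<..} t *\<^sub>R Q t)" for t by (simp add: H_def)
    have Hm[measurable]: "H \<in> borel_measurable borel" unfolding H_alt[abs_def] using Qm by measurable
    have H_nonneg: "H t \<ge> 0" for t using Q_nonneg by (simp add: H_def)
    define E where "E = (\<lambda>t v. indicator {v<..} t * (exp (- l * t) * (t - v) powr (b - 1)))"
    have E_alt: "E t v = indicator {0<..} (t - v) * (exp (- l * t) * (t - v) powr (b - 1))" for t v
      by (simp add: E_def indicator_def)
    have Em[measurable]: "(\<lambda>v. E t v) \<in> borel_measurable borel" "(\<lambda>t. E t v) \<in> borel_measurable borel" for t v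
      unfolding E_alt by measurable
    have "(\<integral>\<^sup>+t. ennreal (Gamma b * H t) \<partial>lborel) =
       (\<integral>\<^sup>+t. \<integral>\<^sup>+v. ennreal (f0 v) * ennreal (E t v) \<partial>lborel \<partial>lborel)"
    proof (rule nn_integral_cong)
      fix t :: real
      show "ennreal (Gamma b * H t) = (\<integral>\<^sup>+v. ennreal (f0 v) * ennreal (E t v) \<partial>lborel)"
      proof (cases "t > 0")
        case True
        have "ennreal (Gamma b * H t) = ennreal (exp (- l * t)) * ennreal (Gamma b * Q t)"
          using True Gb Q_nonneg by (simp add: H_def ennreal_mult'[symmetric] mult_ac)
        also have "\<dots> = (\<integral>\<^sup>+v. ennreal (exp (- l * t)) * ennreal (indicator {0<..<t} v * (f0 v * (t - v) powr (b - 1))) \<partial>lborel)"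
          unfolding nnQ[OF True] by (intro nn_integral_cmult[symmetric]) measurable
        also have "\<dots> = (\<integral>\<^sup>+v. ennreal (f0 v) * ennreal (E t v) \<partial>lborel)"
        proof (rule nn_integral_cong)
          fix v
          have "exp (- l * t) * (indicator {0<..<t} v * (f0 v * (t - v) powr (b - 1))) =
             f0 v * (E t v)"
            by (auto simp: indicator_def f0_def E_def)
          thus "ennreal (exp (- l * t)) * ennreal (indicator {0<..<t} v * (f0 v * (t - v) powr (b - 1))) =
             ennreal (f0 v) * ennreal (E t v)"
            using f0_nonneg by (simp only: ennreal_mult'[symmetric] exp_ge_zero)
        qed
        finally show ?thesis .
      next
        case False
        have "(\<integral>\<^sup>+v. ennreal (f0 v) * ennreal (E t v) \<partial>lborel) = (\<integral>\<^sup>+(v::real). 0 \<partial>lborel)"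
          using False by (intro nn_integral_cong) (auto simp: f0_def indicator_def E_def)
        thus ?thesis using False by (simp add: H_def)
      qed
    qed
    also have "\<dots> = (\<integral>\<^sup>+v. \<integral>\<^sup>+t. ennreal (f0 v) * ennreal (E t v) \<partial>lborel \<partial>lborel)"
    proof (rule lborel_pair.Fubini')
      show "(\<lambda>(v, t). ennreal (f0 v) * ennreal (E t v)) \<in> borel_measurable (lborel \<Otimes>\<^sub>M lborel)"
        unfolding E_alt by measurable
    qed
    also have "\<dots> = (\<integral>\<^sup>+v. ennreal (l powr (- b) * Gamma b) * ennreal (f0 v * exp (- l * v)) \<partial>lborel)"
    proof (rule nn_integral_cong)
      fix v :: real
      have "(\<integral>\<^sup>+t. ennreal (f0 v) * ennreal (E t v) \<partial>lborel) =
         ennreal (f0 v) * ennreal (exp (- l * v) * l powr (- b) * Gamma b)"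
        unfolding E_def nn_integral_exp_powr_shifted[OF b l, symmetric] by (intro nn_integral_cmult) measurable
      also have "\<dots> = ennreal (l powr (- b) * Gamma b) * ennreal (f0 v * exp (- l * v))"
        using f0_nonneg Gb by (simp add: ennreal_mult'[symmetric] mult_ac)
      finally show "(\<integral>\<^sup>+t. ennreal (f0 v) * ennreal (E t v) \<partial>lborel) =
         ennreal (l powr (- b) * Gamma b) * ennreal (f0 v * exp (- l * v))" .
    qed
    also have "\<dots> = ennreal (l powr (- b) * Gamma b) * (\<integral>\<^sup>+v. ennreal (f0 v * exp (- l * v)) \<partial>lborel)"
      by (intro nn_integral_cmult) measurable
    also have "(\<integral>\<^sup>+v. ennreal (f0 v * exp (- l * v)) \<partial>lborel) = ennreal (exp (- (l powr \<alpha>)))"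
    proof -
      have "(\<integral>\<^sup>+v. ennreal (f0 v * exp (- l * v)) \<partial>lborel) = (\<integral>\<^sup>+v. ennreal (indicator {0<..} v *\<^sub>R (exp (- l * v) * f v)) \<partial>lborel)"
        by (intro nn_integral_cong) (simp add: f0_def mult_ac)
      also have "\<dots> = ennreal (LINT v:{0<..}|lborel. exp (- l * v) * f v)"
        unfolding set_lebesgue_integral_def using lap(1)[OF l] nonneg
        by (intro nn_integral_eq_integral) (auto simp: set_integrable_def indicator_def)
      finally show ?thesis unfolding lap(2)[OF l] .
    qed
    also have "ennreal (l powr (- b) * Gamma b) * ennreal (exp (- (l powr \<alpha>))) = ennreal (Gamma b * (l powr (- b) * exp (- (l powr \<alpha>))))"
      using Gb by (simp add: ennreal_mult'[symmetric] mult_ac)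
    finally have nn: "(\<integral>\<^sup>+t. ennreal (Gamma b * H t) \<partial>lborel) = ennreal (Gamma b * (l powr (- b) * exp (- (l powr \<alpha>))))" .
    have GHint: "integrable lborel (\<lambda>t. Gamma b * H t)"
      using nn Gb H_nonneg by (intro integrableI_nonneg) auto
    have "(LBINT t. Gamma b * H t) = Gamma b * (l powr (- b) * exp (- (l powr \<alpha>)))"
      using nn Gb H_nonneg by (subst integral_eq_nn_integral) auto
    moreover have "integrable lborel H" using GHint Gb by simp
    ultimately show ?thesis using Gb unfolding set_integrable_def set_lebesgue_integral_def H_def by simp
  qed
  have lapR: "set_integrable lborel {0<..} (\<lambda>t. exp (- l * t) * riemann_liouville b f t) \<longleftrightarrow> set_integrable lborel {0<..} (\<lambda>t. exp (- l * t) * Q t)"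
    "(LINT t:{0<..}|lborel. exp (- l * t) * riemann_liouville b f t) = (LINT t:{0<..}|lborel. exp (- l * t) * Q t)" for l
  proof -
    have e: "indicator {0<..} t *\<^sub>R (exp (- l * t) * riemann_liouville b f t) = indicator {0<..} t *\<^sub>R (exp (- l * t) * Q t)" for t
      using Q by (simp add: indicator_def)
    show "set_integrable lborel {0<..} (\<lambda>t. exp (- l * t) * riemann_liouville b f t) \<longleftrightarrow> set_integrable lborel {0<..} (\<lambda>t. exp (- l * t) * Q t)"
      "(LINT t:{0<..}|lborel. exp (- l * t) * riemann_liouville b f t) = (LINT t:{0<..}|lborel. exp (- l * t) * Q t)"
      unfolding set_integrable_def set_lebesgue_integral_def e by (rule refl)+
  qed
  have "continuous_on {0<..} (riemann_liouville b f)"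
    using Qcont by (rule continuous_on_eq) (simp add: Q)
  thus ?thesis unfolding stable_laplace_def lapR using lapQ Q Q_nonneg by auto
qed

section \<open>The quotient of two Meijer G-functions\<close>

lemma cmod_iexp: "cmod (iexp x) = 1" for x :: real
  by simp

text \<open>
  Along \<open>s = i y\<close> the reduced integrand is a constant times the Mellin transform at \<open>n + 1 - m i y\<close>, so the integral
  over the imaginary axis is a Mellin inversion integral for \<open>q\<close> on the line with real part \<open>n + 1\<close>.  Conversely the
  integrability of the \<open>G\<close>-function's integrand supplies the integrability that inversion requires.
\<close>
lemma meijer_G_stable:
  fixes m r k n :: nat and q :: "real \<Rightarrow> real" and K :: complex
  defines "\<alpha> \<equiv> real m / real r" and "b \<equiv> real n - real k * (real m / real r)"
  assumes m: "1 \<le> m" "m < r" and t: "t > 0" and b: "b \<ge> 0"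
    and data: "meijer_data A B (meijer_arg m r t)"
    and K: "K \<noteq> 0"
    and red: "\<And>y. gamma_quotient A B (meijer_arg m r t) (Complex 0 y) = K * reduced_integrand m r k n t (Complex 0 y)"
  shows "integrable lborel (\<lambda>\<tau>. stable_mellin \<alpha> b (Complex (real n + 1) \<tau>))"
    and "stable_laplace q \<alpha> b \<Longrightarrow>
      meijer_G 0 (length A) (map of_real A) (map of_real B) (of_real (meijer_arg m r t)) =
        K * of_real (real m ^ n / real r ^ k / real r * t powr (- real n) * q t)"
proof -
  have r0: "r > 0" and m0: "m > 0" using m by auto
  have \<alpha>: "\<alpha> > 0" using r0 m0 by (simp add: \<alpha>_def)
  define z where "z = meijer_arg m r t"
  interpret meijer_data A B z using data by (simp add: z_def)
  define g where "g = (\<lambda>\<tau>. stable_mellin \<alpha> b (Complex (real n + 1) \<tau>) * iexp (\<tau> * ln t))"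
  define D where "D = K * (of_nat m ^ n / of_nat r ^ k) * of_real \<alpha>"
  have D: "D \<noteq> 0" using K r0 m0 \<alpha> by (simp add: D_def)
  have F: "F (Complex 0 y) = D * g (0 + (- real m) * y)" for y
  proof -
    have 1: "of_nat n + 1 - of_nat m * Complex 0 y = Complex (real n + 1) (- real m * y)"
      by (simp add: complex_eq_iff)
    have 2: "of_nat r / of_nat m + of_nat k - of_nat r * Complex 0 y = (Complex (real n + 1) (- real m * y) - of_real b) / of_real \<alpha>"
      using r0 m0 by (simp add: complex_eq_iff b_def \<alpha>_def Re_divide_of_real Im_divide_of_real field_simps)
    have 3: "exp (- (of_nat m * Complex 0 y * of_real (ln t))) = iexp ((0 + (- real m) * y) * ln t)"
      by (rule arg_cong[of _ _ exp]) (simp add: complex_eq_iff)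
    show ?thesis
      unfolding z_def red reduced_integrand_def 1 2 3 g_def stable_mellin_def D_def using \<alpha> by simp
  qed
  have "integrable lborel (\<lambda>y. inverse D * F (Complex 0 y))"
    by (intro integrable_mult_right axis_integrable)
  hence "integrable lborel (\<lambda>y. g (0 + (- real m) * y))"
    unfolding F using D by (simp add: mult.assoc[symmetric])
  hence gint: "integrable lborel g"
    using m0 by (subst (asm) lborel_integrable_real_affine_iff) auto
  show int: "integrable lborel (\<lambda>\<tau>. stable_mellin \<alpha> b (Complex (real n + 1) \<tau>))"
  proof (rule Bochner_Integration.integrable_bound[OF gint])
    have [measurable]: "g \<in> borel_measurable borel" using gint by simp
    have "(\<lambda>\<tau>. stable_mellin \<alpha> b (Complex (real n + 1) \<tau>)) = (\<lambda>\<tau>. g \<tau> * iexp (- (\<tau> * ln t)))"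
      by (simp add: g_def fun_eq_iff mult.assoc flip: exp_add)
    thus "(\<lambda>\<tau>. stable_mellin \<alpha> b (Complex (real n + 1) \<tau>)) \<in> borel_measurable lborel"
      by simp
    show "AE \<tau> in lborel. cmod (stable_mellin \<alpha> b (Complex (real n + 1) \<tau>)) \<le> cmod (g \<tau>)"
      unfolding g_def norm_mult cmod_iexp by simp
  qed
  assume q: "stable_laplace q \<alpha> b"
  have bn: "b < real n + 1"
  proof -
    have "real k * (real m / real r) \<ge> 0" by simp
    thus ?thesis unfolding b_def by linarith
  qed
  have "(LBINT \<tau>. g \<tau>) = \<bar>- real m\<bar> *\<^sub>R (LBINT y. g (0 + (- real m) * y))"
    using m0 by (intro lborel_integral_real_affine) auto
  hence G: "(LBINT y. g (0 + (- real m) * y)) = (LBINT \<tau>. g \<tau>) / of_nat m"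
    using m0 by (simp add: scaleR_conv_of_real)
  have inv: "complex_of_real (q t) = of_real (t powr (real n + 1 - 1)) / (2 * of_real pi) * (LBINT \<tau>. g \<tau>)"
    unfolding g_def by (rule stable_mellin_inversion[OF q \<alpha> b bn int t])
  have tp: "t powr (- real n) * t powr (real n + 1 - 1) = 1"
    using t by (simp flip: powr_add)
  have "meijer_G 0 (length A) (map of_real A) (map of_real B) (of_real z) = 1 / (2 * of_real pi) * (LBINT y. D * g (0 + (- real m) * y))"
    unfolding meijer_G_eq_axis_integral F ..
  also have "\<dots> = D / of_nat m * (1 / (2 * of_real pi) * (LBINT \<tau>. g \<tau>))"
    unfolding integral_mult_right_zero G by simp
  also have "1 / (2 * of_real pi) * (LBINT \<tau>. g \<tau>) = of_real (t powr (- real n)) * complex_of_real (q t)"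
  proof -
    have "of_real (t powr (- real n)) * complex_of_real (q t) =
      of_real (t powr (- real n) * t powr (real n + 1 - 1)) / (2 * of_real pi) * (LBINT \<tau>. g \<tau>)"
      unfolding inv of_real_mult by simp
    thus ?thesis unfolding tp by simp
  qed
  also have "D / of_nat m = K * of_real (real m ^ n / real r ^ k / real r)"
    using m0 by (simp add: D_def \<alpha>_def)
  finally show "meijer_G 0 (length A) (map of_real A) (map of_real B) (of_real (meijer_arg m r t)) =
        K * of_real (real m ^ n / real r ^ k / real r * t powr (- real n) * q t)"
    by (simp add: z_def mult.assoc)
qed

lemma meijer_data_tau:
  assumes "1 \<le> m" "m < r" "1 \<le> k" "z > 0"
  shows "meijer_data (tau_real m r k) (delta_real m r n k) z"
proof
  show "length (delta_real m r n k) < length (tau_real m r k)"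
    using assms by (simp add: tau_real_def delta_real_def)
  show "z > 0" by fact
  fix a assume "a \<in> set (tau_real m r k)"
  then consider i where "i < r" "a = 1 - 1 / real m - (real i + real k) / real r"
    | i where "i \<le> m" "a = (real i - 1) / real m - real k / real r"
    by (auto simp: tau_real_def)
  thus "a < 1"
  proof cases
    case 1
    have "1 / real m > 0" "(real i + real k) / real r \<ge> 0" using assms by auto
    thus ?thesis unfolding 1(2) by linarith
  next
    case 2
    have "(real i - 1) / real m < 1" "real k / real r > 0" using assms 2 by (auto simp: field_simps)
    thus ?thesis unfolding 2(2) by linarith
  qed
qed

lemma meijer_data_stable:
  assumes "1 \<le> m" "m < r" "z > 0"
  shows "meijer_data (upper_real m r) (lower_real m) z"
proof
  show "length (lower_real m) < length (upper_real m r)"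
    using assms by (simp add: upper_real_def lower_real_def)
  show "z > 0" by fact
  fix a assume "a \<in> set (upper_real m r)"
  then obtain i where i: "a = 1 - 1 / real m - real i / real r" by (auto simp: upper_real_def)
  have "1 / real m > 0" "real i / real r \<ge> 0" using assms by auto
  thus "a < 1" unfolding i by linarith
qed

text \<open>
  The density is treated first: its own \<open>G\<close>-function yields an inversion formula with \<open>c = 1\<close>, hence a bound on \<open>f\<close>,
  and this bound makes the fractional integral continuous, so that inversion applies to it as well.
\<close>
lemma GG_eq_meijer_quotient:
  fixes m r k n :: nat and M :: "'a measure" and S :: "'a \<Rightarrow> real" and f :: "real \<Rightarrow> real"
  assumes m: "1 \<le> m" "m < r" and k: "1 \<le> k" "k \<le> n"
    and f: "stable_density_of M (real m / real r) S f" and t: "t > 0"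
  shows "complex_of_real (GG f (real m / real r) n k t) =
            of_nat m powi (int k - int n) *
            meijer_G 0 (m + r - 1) (tau_params m r k) (delta_params m r n k)
              (of_real (meijer_arg m r t)) /
            meijer_G 0 (r - 1) (stable_upper m r) (stable_lower m)
              (of_real (meijer_arg m r t))"
proof -
  define \<alpha> where "\<alpha> = real m / real r"
  define b where "b = real n - real k * \<alpha>"
  have m0: "m > 0" and r0: "r > 0" using m by auto
  have \<alpha>: "0 < \<alpha>" "\<alpha> < 1" using m by (auto simp: \<alpha>_def)
  have b: "b > 0"
  proof -
    have "real k * \<alpha> < real k * 1" using k \<alpha> by (intro mult_strict_left_mono) auto
    moreover have "real k \<le> real n" using k by simp
    ultimately show ?thesis unfolding b_def by linarith
  qed
  have zpos: "meijer_arg m r t > 0" if "t > 0" for t using m0 r0 that by simp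
  obtain K :: complex where K: "K \<noteq> 0"
    "\<And>k n t s. Re s \<le> 0 \<Longrightarrow> t > 0 \<Longrightarrow>
       gamma_quotient (tau_real m r k) (delta_real m r n k) (meijer_arg m r t) s = K * reduced_integrand m r k n t s"
    "\<And>t s. Re s \<le> 0 \<Longrightarrow> t > 0 \<Longrightarrow>
       gamma_quotient (upper_real m r) (lower_real m) (meijer_arg m r t) s = K * reduced_integrand m r 0 0 t s"
    by (rule gamma_quotient_reduced[OF m]) (rule that)
  have axis: "Re (Complex 0 y) \<le> 0" for y by simp
  have lap_f: "stable_laplace f \<alpha> 0" using stable_density_laplace[OF f] by (simp add: \<alpha>_def)
  \<comment> \<open>With \<open>c = 1\<close> the power of \<open>t\<close> in front of the inversion integral is constant.\<close>
  obtain C where C: "\<And>t. t > 0 \<Longrightarrow> f t \<le> C"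
  proof -
    have int: "integrable lborel (\<lambda>\<tau>. stable_mellin \<alpha> 0 (Complex 1 \<tau>))"
      using meijer_G_stable(1)[OF m zero_less_one _ meijer_data_stable[OF m zpos[OF zero_less_one]] K(1) K(3)[OF axis zero_less_one]]
      by (simp add: \<alpha>_def)
    have "f t \<le> 1 / (2 * pi) * (LBINT \<tau>. cmod (stable_mellin \<alpha> 0 (Complex 1 \<tau>)))" if t: "t > 0" for t
    proof -
      have "complex_of_real (f t) = of_real (t powr (1 - 1)) / (2 * of_real pi) *
         (LBINT \<tau>. stable_mellin \<alpha> 0 (Complex 1 \<tau>) * iexp (\<tau> * ln t))"
        by (rule stable_mellin_inversion[OF lap_f \<alpha>(1) _ _ int t]) auto
      hence "cmod (complex_of_real (f t)) = 1 / (2 * pi) * cmod (LBINT \<tau>. stable_mellin \<alpha> 0 (Complex 1 \<tau>) * iexp (\<tau> * ln t))"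
        using t by (simp add: norm_mult norm_divide)
      also have "\<dots> \<le> 1 / (2 * pi) * (LBINT \<tau>. cmod (stable_mellin \<alpha> 0 (Complex 1 \<tau>) * iexp (\<tau> * ln t)))"
        by (intro mult_left_mono integral_norm_bound) auto
      also have "\<dots> = 1 / (2 * pi) * (LBINT \<tau>. cmod (stable_mellin \<alpha> 0 (Complex 1 \<tau>)))"
        unfolding norm_mult cmod_iexp by simp
      finally show ?thesis by simp
    qed
    thus ?thesis by (rule that)
  qed
  have lap_q: "stable_laplace (riemann_liouville b f) \<alpha> b"
    by (rule stable_laplace_riemann_liouville[OF lap_f b C])
  have num: "meijer_G 0 (m + r - 1) (tau_params m r k) (delta_params m r n k) (of_real (meijer_arg m r t)) =
     K * of_real (real m ^ n / real r ^ k / real r * t powr (- real n) * riemann_liouville b f t)"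
  proof -
    have "length (tau_real m r k) = m + r - 1" using m by (simp add: tau_real_def)
    thus ?thesis
      using meijer_G_stable(2)[where q = "riemann_liouville b f", OF m t _ meijer_data_tau[OF m k(1) zpos[OF t]] K(1) K(2)[OF axis t]] b lap_q
      by (simp add: params_of_real \<alpha>_def b_def)
  qed
  have den: "meijer_G 0 (r - 1) (stable_upper m r) (stable_lower m) (of_real (meijer_arg m r t)) =
     K * of_real (f t / real r)"
  proof -
    have "length (upper_real m r) = r - 1" by (simp add: upper_real_def)
    thus ?thesis 
      using meijer_G_stable(2)[where q = f, OF m t _ meijer_data_stable[OF m zpos[OF t]] K(1) K(3)[OF axis t]] lap_f t
      by (simp add: params_of_real \<alpha>_def)
  qed
  have GGeq: "GG f \<alpha> n k t = \<alpha> ^ k * t powr (- real n) * riemann_liouville b f t / f t"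
  proof -
    have "t powr (- (real k * \<alpha>)) = t powr (- real n) * t powr b"
      by (simp add: b_def flip: powr_add)
    thus ?thesis by (simp add: GG_def riemann_liouville_def flip: b_def)
  qed
  have "of_nat m powi (int k - int n) * (complex_of_real (real m ^ n / real r ^ k)) = of_real (\<alpha> ^ k)"
    using m0 r0 by (simp add: power_int_diff \<alpha>_def power_divide)
  moreover have "of_nat m powi (int k - int n) * (K * of_real (real m ^ n / real r ^ k / real r * t powr (- real n) * riemann_liouville b f t)) /
      (K * of_real (f t / real r)) =
     (of_nat m powi (int k - int n) * (complex_of_real (real m ^ n / real r ^ k))) * of_real (t powr (- real n) * riemann_liouville b f t / f t)"
    using K(1) r0 by simp
  ultimately show ?thesis unfolding num den GGeq[unfolded \<alpha>_def] by (simp add: \<alpha>_def)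
qed

theorem theorem3p1:
  fixes m r k n :: nat and M :: "'a measure" and S :: "'a \<Rightarrow> real" and f :: "real \<Rightarrow> real"
  assumes "1 \<le> m" and "m < r" and "1 \<le> k" and "k \<le> n"
    and "stable_density_of M (real m / real r) S f"
  shows "(\<forall>t>0. complex_of_real (GG f (real m / real r) n k t) =
            of_nat m powi (int k - int n) *
            meijer_G 0 (m + r - 1) (tau_params m r k) (delta_params m r n k)
              (of_real (real r ^ r / real m ^ m * t ^ m)) /
            meijer_G 0 (r - 1) (stable_upper m r) (stable_lower m)
              (of_real (real r ^ r / real m ^ m * t ^ m))) \<and>
         (\<forall>s>0. complex_of_real (GG f (real m / real r) n k
              (real m / real r powr (real r / real m) * s powr (1 / real m))) =
            of_nat m powi (int k - int n) *
            meijer_G 0 (m + r - 1) (tau_params m r k) (delta_params m r n k) (of_real s) /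
            meijer_G 0 (r - 1) (stable_upper m r) (stable_lower m) (of_real s))"
  (is "(\<forall>t>0. ?P t) \<and> (\<forall>s>0. ?Q s)")
proof (intro conjI allI impI)
  fix t :: real assume "t > 0"
  thus "?P t" by (rule GG_eq_meijer_quotient[OF assms])
next
  fix s :: real assume s: "s > 0"
  define t where "t = real m / real r powr (real r / real m) * s powr (1 / real m)"
  have m0: "m > 0" and r0: "r > 0" using assms by auto
  have t: "t > 0" using m0 r0 s by (simp add: t_def)
  \<comment> \<open>The second form is the first one at the point \<open>t\<close> whose argument of \<open>G\<close> is \<open>s\<close>.\<close>
  have "(s powr (1 / real m)) ^ m = s" using m0 s by (simp add: powr_power)
  moreover have "(real r powr (real r / real m)) ^ m = real r ^ r"
    using m0 r0 by (simp add: powr_power powr_realpow)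
  ultimately have e: "real r ^ r / real m ^ m * t ^ m = s"
    using m0 r0 by (simp add: t_def power_mult_distrib power_divide)
  show "?Q s"
    using GG_eq_meijer_quotient[OF assms t] unfolding e unfolding t_def .
qed

end
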